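(* Let $(A,\lhd,\rhd)$ be a finite-dimensional pre-Novikov algebra over $\mathbf{k}$ and $(A,\circ)$ the associated Novikov algebra. Let $\{e_1,\dots,e_n\}$ be a basis of $A$ with dual basis $\{e_1^*,\dots,e_n^*\}$ of $A^*$, and let $r=\sum_{\alpha=1}^n(e_\alpha\otimes e_\alpha^*-e_\alpha^*\otimes e_\alpha)$, which is a skewsymmetric solution of the Novikov Yang-Baxter equation in the Novikov algebra $\widetilde{A}:=A\ltimes_{L_\rhd^*+R_\lhd^*,-R_\lhd^*}A^*$. Let $(B,\diamond,(\cdot,\cdot))$ be a quadratic $\mathbb{Z}$-graded right Novikov algebra, and let $L=\widetilde{A}\otimes B$ be the induced Lie algebra. Let $\{b_p\}_{p\in\Pi}$ be a homogeneous basis of $B$ and $\{c_p\}_{p\in\Pi}$ its homogeneous dual basis with respect to $(\cdot,\cdot)$. Then $$r_L=\sum_{p\in\Pi}\sum_{\alpha=1}^n\Big((e_\alpha\otimes b_p)\otimes(e_\alpha^*\otimes c_p)-(e_\alpha^*\otimes b_p)\otimes(e_\alpha\otimes c_p)\Big)\in L\,\widehat{\otimes}\,L$$ is a skewsymmetric completed solution of the classical Yang-Baxter equation in $L$. Hence there is a completed Lie bialgebra $(L,\delta)$ with $\delta(x)=(\mathrm{ad}_x\,\widehat{\otimes}\,\mathrm{id}+\mathrm{id}\,\widehat{\otimes}\,\mathrm{ad}_x)r_L$ for all $x\in L$.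
   Context: $\mathbf{k}$ is a field of characteristic zero. A Novikov algebra $(A,\circ)$: $(a\circ b)\circ c-a\circ(b\circ c)=(b\circ a)\circ c-b\circ(a\circ c)$ and $(a\circ b)\circ c=(a\circ c)\circ b$. A pre-Novikov algebra is a vector space $A$ with operations $\lhd,\rhd$ such that for all $x,y,z$: $x\rhd(y\rhd z)=(x\rhd y+x\lhd y)\rhd z+y\rhd(x\rhd z)-(y\rhd x+y\lhd x)\rhd z$; $x\rhd(y\lhd z)=(x\rhd y)\lhd z+y\lhd(x\lhd z+x\rhd z)-(y\lhd x)\lhd z$; $(x\lhd y+x\rhd y)\rhd z=(x\rhd z)\lhd y$; $(x\lhd y)\lhd z=(x\lhd z)\lhd y$. Its associated Novikov algebra is $(A,\circ)$, $x\circ y=x\lhd y+x\rhd y$. Put $L_\rhd(a)b=a\rhd b$, $R_\lhd(a)b=b\lhd a$, and $\langle\varphi^*(a)f,b\rangle=-\langle f,\varphi(a)b\rangle$ for $\varphi:A\to\mathrm{End}(A)$. The Novikov algebra $\widetilde{A}$ is $A\oplus A^*$ with product $(a+f)\circ(b+g)=a\circ b+(L_\rhd^*+R_\lhd^* )(a)g-R_\lhd^*(b)f$. Novikov Yang-Baxter equation for $r=\sum x_\alpha\otimes y_\alpha$: $\sum_{\alpha,\beta}\big(x_\alpha\otimes x_\beta\otimes y_\alpha\circ y_\beta+x_\alpha\otimes(y_\alpha\circ x_\beta+x_\beta\circ y_\alpha)\otimes y_\beta+x_\alpha\circ x_\beta\otimes y_\beta\otimes y_\alpha\big)=0$. A right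 Novikov algebra $(B,\diamond)$: $(a\diamond b)\diamond c-a\diamond(b\diamond c)=(a\diamond c)\diamond b-a\diamond(c\diamond b)$ and $a\diamond(b\diamond c)=b\diamond(a\diamond c)$. Quadratic $\mathbb{Z}$-graded: $B=\oplus_{i\in\mathbb{Z}}B_i$, each $B_i$ finite-dimensional, $B_i\diamond B_j\subset B_{i+j}$, with a symmetric nondegenerate bilinear form that is graded (for some $m\in\mathbb{Z}$, $(B_i,B_j)=0$ whenever $i+j+m\neq0$) and satisfies $(a\diamond b,c)=-(a,b\diamond c+c\diamond b)$. Dual basis: $(b_p,c_q)=\delta_{p,q}$. Induced Lie algebra: $[a_1\otimes b_1,a_2\otimes b_2]=a_1\circ a_2\otimes b_1\diamond b_2-a_2\circ a_1\otimes b_2\diamond b_1$ on $L=\widetilde{A}\otimes B$, graded by $L_i=\widetilde{A}\otimes B_i$. $L\,\widehat{\otimes}\,L:=\prod_{i,j}L_i\otimes L_j$, $L\,\widehat{\otimes}\,L\,\widehat{\otimes}\,L:=\prod_{i,j,k}L_i\otimes L_j\otimes L_k$; elements are formal sums of homogeneous tensors with finitely many terms in each multidegree; $f\,\widehat{\otimes}\,g$, the flip $\widehat{\tau}$ and iterated coproducts are defined termwise (understood to be well defined, i.e. finitely many contributions in each multidegree). For $s=\sum a_i\otimes b_i\in L\,\widehat{\otimes}\,L$ (a formal sum), $s$ is skewsymmetric if $\widehat{\tau}s=-s$, and a skewsymmetric $s$ is a completed solution of the classical Yang-Baxter equation if $\sum_{i,j}\big([a_i,a_j]\otimes b_i\otimes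 b_j+a_i\otimes[b_i,a_j]\otimes b_j+a_i\otimes a_j\otimes[b_i,b_j]\big)=0$ in $L\,\widehat{\otimes}\,L\,\widehat{\otimes}\,L$ (for $r_L$ each multidegree component is a finite sum). A completed Lie bialgebra $(L,[\cdot,\cdot],\delta)$: $L$ $\mathbb{Z}$-graded space with Lie bracket, $\delta:L\to L\,\widehat{\otimes}\,L$ linear with $\delta=-\widehat{\tau}\delta$, $(\mathrm{id}\,\widehat{\otimes}\,\delta)\delta-(\widehat{\tau}\,\widehat{\otimes}\,\mathrm{id})(\mathrm{id}\,\widehat{\otimes}\,\delta)\delta=(\delta\,\widehat{\otimes}\,\mathrm{id})\delta$, and $\delta([a,b])=(\mathrm{ad}_a\widehat{\otimes}\,\mathrm{id}+\mathrm{id}\,\widehat{\otimes}\,\mathrm{ad}_a)\delta(b)-(\mathrm{ad}_b\widehat{\otimes}\,\mathrm{id}+\mathrm{id}\,\widehat{\otimes}\,\mathrm{ad}_b)\delta(a)$, with $\mathrm{ad}_a(b)=[a,b]$. *)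

theory Defs
  imports Complex_Main "HOL-Library.Function_Algebras" "HOL-Library.Product_Plus"
begin

section \<open>Vector spaces with a carrier\<close>

text \<open>A space is a subspace \<open>carr\<close> of an ambient type that is a vector space under \<open>smul\<close>; the
  carrier is needed because dual spaces and tensor products are cut out of function types.\<close>

record ('k, 'v) vspace =
  carr :: "'v set"
  smul :: "'k \<Rightarrow> 'v \<Rightarrow> 'v"

definition is_vspace :: "('k::field, 'v::ab_group_add) vspace \<Rightarrow> bool" where
  "is_vspace V \<longleftrightarrow> vector_space (smul V) \<and> module.subspace (smul V) (carr V)"

definition whole :: "('k \<Rightarrow> 'v \<Rightarrow> 'v) \<Rightarrow> ('k, 'v) vspace" where
  "whole s = \<lparr>carr = UNIV, smul = s\<rparr>"

abbreviation ground :: "('k::field, 'k) vspace" where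
  "ground \<equiv> whole (*)"

definition linear_map ::
  "('k::field, 'v::ab_group_add) vspace \<Rightarrow> ('k, 'w::ab_group_add) vspace \<Rightarrow> ('v \<Rightarrow> 'w) \<Rightarrow> bool" where
  "linear_map V W f \<longleftrightarrow>
     (\<forall>x\<in>carr V. f x \<in> carr W) \<and>
     (\<forall>x\<in>carr V. \<forall>y\<in>carr V. f (x + y) = f x + f y) \<and>
     (\<forall>c. \<forall>x\<in>carr V. f (smul V c x) = smul W c (f x))"

definition bilinear_map ::
  "('k::field, 'v::ab_group_add) vspace \<Rightarrow> ('k, 'w::ab_group_add) vspace \<Rightarrow>
   ('k, 'x::ab_group_add) vspace \<Rightarrow> ('v \<Rightarrow> 'w \<Rightarrow> 'x) \<Rightarrow> bool" where
  "bilinear_map V W X g \<longleftrightarrow>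
     (\<forall>v\<in>carr V. linear_map W X (g v)) \<and> (\<forall>w\<in>carr W. linear_map V X (\<lambda>v. g v w))"

definition is_basis ::
  "('k::field, 'v::ab_group_add) vspace \<Rightarrow> 'i set \<Rightarrow> ('i \<Rightarrow> 'v) \<Rightarrow> bool" where
  "is_basis V I b \<longleftrightarrow>
     inj_on b I \<and> \<not> module.dependent (smul V) (b ` I) \<and> module.span (smul V) (b ` I) = carr V"

definition fun_scale :: "'k::field \<Rightarrow> ('x \<Rightarrow> 'k) \<Rightarrow> 'x \<Rightarrow> 'k" where
  "fun_scale c f = (\<lambda>x. c * f x)"

definition dual_space :: "('k::field \<Rightarrow> 'v::ab_group_add \<Rightarrow> 'v) \<Rightarrow> ('k, 'v \<Rightarrow> 'k) vspace" where
  "dual_space s = \<lparr>carr = {f. Vector_Spaces.linear s (*) f}, smul = fun_scale\<rparr>"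

definition direct_sum :: "('k, 'v) vspace \<Rightarrow> ('k, 'w) vspace \<Rightarrow> ('k, 'v \<times> 'w) vspace" where
  "direct_sum V W =
     \<lparr>carr = carr V \<times> carr W, smul = (\<lambda>c x. (smul V c (fst x), smul W c (snd x)))\<rparr>"


section \<open>Tensor products\<close>

text \<open>Over a field, \<open>V \<otimes> W\<close> embeds into the dual of the space of bilinear forms on \<open>V \<times> W\<close>, a pure
  tensor going to evaluation. It is taken to be the span of these evaluations; that this is the
  tensor product, i.e. has its universal property, is shown in \<open>tensor_lift_linear\<close>,
  \<open>tensor_lift_tensor\<close> and \<open>tensor_lift_unique\<close>.\<close>

definition tensor ::
  "('k::field, 'v::ab_group_add) vspace \<Rightarrow> ('k, 'w::ab_group_add) vspace \<Rightarrow>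
   'v \<Rightarrow> 'w \<Rightarrow> ('v \<Rightarrow> 'w \<Rightarrow> 'k) \<Rightarrow> 'k" where
  "tensor V W v w = (\<lambda>\<beta>. if bilinear_map V W ground \<beta> then \<beta> v w else 0)"

text \<open>\<open>sub_tensor V W S T\<close> is \<open>S \<otimes> T\<close> inside \<open>V \<otimes> W\<close>, for subspaces \<open>S\<close> of \<open>V\<close> and \<open>T\<close> of \<open>W\<close>.\<close>

definition sub_tensor ::
  "('k::field, 'v::ab_group_add) vspace \<Rightarrow> ('k, 'w::ab_group_add) vspace \<Rightarrow>
   'v set \<Rightarrow> 'w set \<Rightarrow> (('v \<Rightarrow> 'w \<Rightarrow> 'k) \<Rightarrow> 'k) set" where
  "sub_tensor V W S T = module.span fun_scale {tensor V W v w | v w. v \<in> S \<and> w \<in> T}"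

definition tensor_space ::
  "('k::field, 'v::ab_group_add) vspace \<Rightarrow> ('k, 'w::ab_group_add) vspace \<Rightarrow>
   ('k, ('v \<Rightarrow> 'w \<Rightarrow> 'k) \<Rightarrow> 'k) vspace" where
  "tensor_space V W = \<lparr>carr = sub_tensor V W (carr V) (carr W), smul = fun_scale\<rparr>"

text \<open>The linear map on \<open>V \<otimes> W\<close> induced by a bilinear map \<open>g\<close> on \<open>V \<times> W\<close>.\<close>

definition tensor_lift ::
  "('k::field, 'v::ab_group_add) vspace \<Rightarrow> ('k, 'w::ab_group_add) vspace \<Rightarrow>
   ('v \<Rightarrow> 'w \<Rightarrow> 'x::ab_group_add) \<Rightarrow> (('v \<Rightarrow> 'w \<Rightarrow> 'k) \<Rightarrow> 'k) \<Rightarrow> 'x" where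
  "tensor_lift V W g t =
     (THE y. \<exists>xs. set xs \<subseteq> carr V \<times> carr W \<and>
        t = (\<Sum>(v, w)\<leftarrow>xs. tensor V W v w) \<and> y = (\<Sum>(v, w)\<leftarrow>xs. g v w))"

lemma vector_space_fun_scale: "vector_space fun_scale"
  by standard (auto simp: fun_scale_def algebra_simps fun_eq_iff)

lemma tensor_smul_left:
  assumes "is_vspace V" "is_vspace W" "v \<in> carr V" "w \<in> carr W"
  shows "fun_scale c (tensor V W v w) = tensor V W (smul V c v) w"
  using assms
  by (auto simp: tensor_def fun_scale_def fun_eq_iff bilinear_map_def linear_map_def whole_def)

lemma tensor_space_sum_list:
  assumes V: "is_vspace V" and W: "is_vspace W" and t: "t \<in> carr (tensor_space V W)"
  obtains xs where "set xs \<subseteq> carr V \<times> carr W" "t = (\<Sum>(v, w)\<leftarrow>xs. tensor V W v w)"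
proof -
  interpret T: vector_space "fun_scale :: 'a \<Rightarrow> (('b \<Rightarrow> 'c \<Rightarrow> 'a) \<Rightarrow> 'a) \<Rightarrow> _"
    by (rule vector_space_fun_scale)
  interpret VV: vector_space "smul V" using V by (simp add: is_vspace_def)
  let ?P = "\<lambda>t. \<exists>xs. set xs \<subseteq> carr V \<times> carr W \<and> t = (\<Sum>(v, w)\<leftarrow>xs. tensor V W v w)"
  have sub: "VV.subspace (carr V)" using V by (simp add: is_vspace_def)
  have "t \<in> T.span {tensor V W v w | v w. v \<in> carr V \<and> w \<in> carr W}"
    using t by (simp add: tensor_space_def sub_tensor_def)
  then have "?P t"
  proof (induct rule: T.span_induct_alt)
    case base
    show ?case by (rule exI[of _ "[]"]) simp
  next
    case (step c x y)
    then obtain v w xs where *: "v \<in> carr V" "w \<in> carr W" "x = tensor V W v w"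
      "set xs \<subseteq> carr V \<times> carr W" "y = (\<Sum>(v, w)\<leftarrow>xs. tensor V W v w)" by blast
    have "smul V c v \<in> carr V" using sub *(1) VV.subspace_scale by blast
    then show ?case
      using * tensor_smul_left[OF V W *(1,2)]
      by (intro exI[of _ "(smul V c v, w) # xs"]) auto
  qed
  with that show thesis by blast
qed

lemma tensor_lift_eq:
  assumes X: "is_vspace X" and g: "bilinear_map V W X g" and xs: "set xs \<subseteq> carr V \<times> carr W"
  shows "tensor_lift V W g (\<Sum>(v, w)\<leftarrow>xs. tensor V W v w) = (\<Sum>(v, w)\<leftarrow>xs. g v w)"
  unfolding tensor_lift_def
proof (rule the_equality)
  show "\<exists>ys. set ys \<subseteq> carr V \<times> carr W \<and>
      (\<Sum>(v, w)\<leftarrow>xs. tensor V W v w) = (\<Sum>(v, w)\<leftarrow>ys. tensor V W v w) \<and>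
      (\<Sum>(v, w)\<leftarrow>xs. g v w) = (\<Sum>(v, w)\<leftarrow>ys. g v w)"
    using xs by blast
next
  fix y
  assume "\<exists>ys. set ys \<subseteq> carr V \<times> carr W \<and>
      (\<Sum>(v, w)\<leftarrow>xs. tensor V W v w) = (\<Sum>(v, w)\<leftarrow>ys. tensor V W v w) \<and>
      y = (\<Sum>(v, w)\<leftarrow>ys. g v w)"
  then obtain ys where ys: "set ys \<subseteq> carr V \<times> carr W"
    and eq: "(\<Sum>(v, w)\<leftarrow>xs. tensor V W v w) = (\<Sum>(v, w)\<leftarrow>ys. tensor V W v w)"
    and y: "y = (\<Sum>(v, w)\<leftarrow>ys. g v w)" by blast
  interpret X: vector_space "smul X" using X by (simp add: is_vspace_def)
  interpret K: vector_space "(*) :: 'a \<Rightarrow> 'a \<Rightarrow> 'a" by standard (auto simp: algebra_simps)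
  interpret XK: vector_space_pair "smul X" "(*) :: 'a \<Rightarrow> 'a \<Rightarrow> 'a" ..
  show "y = (\<Sum>(v, w)\<leftarrow>xs. g v w)"
  proof (rule ccontr)
    define d where "d = y - (\<Sum>(v, w)\<leftarrow>xs. g v w)"
    assume "y \<noteq> (\<Sum>(v, w)\<leftarrow>xs. g v w)"
    then have "d \<noteq> 0" by (simp add: d_def)
    then have "X.independent {d}" by (simp add: X.dependent_single)
    then obtain \<phi> where \<phi>: "Vector_Spaces.linear (smul X) (*) \<phi>" and \<phi>d: "\<phi> d = 1"
      using XK.linear_independent_extend[of "{d}" "\<lambda>_. 1"] by blast
    interpret \<phi>: Vector_Spaces.linear "smul X" "(*)" \<phi> by (rule \<phi>)
    let ?\<beta> = "\<lambda>v w. \<phi> (g v w)"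
    have bil: "bilinear_map V W ground ?\<beta>"
      using g by (simp add: bilinear_map_def linear_map_def whole_def \<phi>.add \<phi>.scale)
    have ev: "(\<Sum>(v, w)\<leftarrow>zs. tensor V W v w) ?\<beta> = \<phi> (\<Sum>(v, w)\<leftarrow>zs. g v w)" for zs
      by (induct zs) (auto simp: tensor_def bil \<phi>.add \<phi>.zero)
    have "\<phi> y = \<phi> (\<Sum>(v, w)\<leftarrow>xs. g v w)"
      using ev[of xs] ev[of ys] eq y by simp
    then show False using \<phi>d by (simp add: d_def \<phi>.diff)
  qed
qed

lemma tensor_lift_tensor:
  assumes "is_vspace X" "bilinear_map V W X g" "v \<in> carr V" "w \<in> carr W"
  shows "tensor_lift V W g (tensor V W v w) = g v w"
  using tensor_lift_eq[OF assms(1,2), of "[(v, w)]"] assms(3,4) by simp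

lemma tensor_lift_linear:
  assumes V: "is_vspace V" and W: "is_vspace W" and X: "is_vspace X"
    and g: "bilinear_map V W X g"
  shows "linear_map (tensor_space V W) X (tensor_lift V W g)"
proof -
  interpret X: vector_space "smul X" using X by (simp add: is_vspace_def)
  interpret VV: vector_space "smul V" using V by (simp add: is_vspace_def)
  interpret T: vector_space "fun_scale :: 'a \<Rightarrow> (('b \<Rightarrow> 'c \<Rightarrow> 'a) \<Rightarrow> 'a) \<Rightarrow> _"
    by (rule vector_space_fun_scale)
  have subX: "X.subspace (carr X)" and subV: "VV.subspace (carr V)"
    using X V by (simp_all add: is_vspace_def)
  have gX: "g v w \<in> carr X" if "v \<in> carr V" "w \<in> carr W" for v w
    using g that by (auto simp: bilinear_map_def linear_map_def)
  have memX: "(\<Sum>(v, w)\<leftarrow>xs. g v w) \<in> carr X" if "set xs \<subseteq> carr V \<times> carr W" for xs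
    using that subX by (induct xs) (auto intro: gX X.subspace_add X.subspace_0)
  show ?thesis
    unfolding linear_map_def
  proof (intro conjI ballI allI)
    fix t assume "t \<in> carr (tensor_space V W)"
    then obtain xs where xs: "set xs \<subseteq> carr V \<times> carr W" "t = (\<Sum>(v, w)\<leftarrow>xs. tensor V W v w)"
      by (rule tensor_space_sum_list[OF V W])
    then show "tensor_lift V W g t \<in> carr X"
      using tensor_lift_eq[OF X g] memX by simp
    fix c
    let ?ys = "map (\<lambda>(v, w). (smul V c v, w)) xs"
    have ys: "set ?ys \<subseteq> carr V \<times> carr W"
      using xs(1) subV by (auto intro: VV.subspace_scale)
    have "fun_scale c (\<Sum>(v, w)\<leftarrow>xs. tensor V W v w) = (\<Sum>(v, w)\<leftarrow>?ys. tensor V W v w)"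
      using xs(1)
      by (induct xs) (auto simp: T.scale_right_distrib tensor_smul_left[OF V W])
    moreover have "smul X c (\<Sum>(v, w)\<leftarrow>xs. g v w) = (\<Sum>(v, w)\<leftarrow>?ys. g v w)"
      using xs(1) g
      by (induct xs) (auto simp: X.scale_right_distrib bilinear_map_def linear_map_def)
    ultimately show "tensor_lift V W g (smul (tensor_space V W) c t) = smul X c (tensor_lift V W g t)"
      using tensor_lift_eq[OF X g xs(1)] tensor_lift_eq[OF X g ys] xs(2)
      by (simp add: tensor_space_def)
  next
    fix t u assume "t \<in> carr (tensor_space V W)" "u \<in> carr (tensor_space V W)"
    then obtain xs ys where
      xs: "set xs \<subseteq> carr V \<times> carr W" "t = (\<Sum>(v, w)\<leftarrow>xs. tensor V W v w)" and
      ys: "set ys \<subseteq> carr V \<times> carr W" "u = (\<Sum>(v, w)\<leftarrow>ys. tensor V W v w)"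
      by (metis tensor_space_sum_list[OF V W])
    then show "tensor_lift V W g (t + u) = tensor_lift V W g t + tensor_lift V W g u"
      using tensor_lift_eq[OF X g, of "xs @ ys"] tensor_lift_eq[OF X g, of xs]
        tensor_lift_eq[OF X g, of ys] by simp
  qed
qed

lemma tensor_lift_unique:
  assumes V: "is_vspace V" and W: "is_vspace W" and X: "is_vspace X"
    and g: "bilinear_map V W X g" and h: "linear_map (tensor_space V W) X h"
    and hg: "\<And>v w. v \<in> carr V \<Longrightarrow> w \<in> carr W \<Longrightarrow> h (tensor V W v w) = g v w"
    and t: "t \<in> carr (tensor_space V W)"
  shows "h t = tensor_lift V W g t"
proof -
  interpret T: vector_space "fun_scale :: 'a \<Rightarrow> (('b \<Rightarrow> 'c \<Rightarrow> 'a) \<Rightarrow> 'a) \<Rightarrow> _"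
    by (rule vector_space_fun_scale)
  interpret X: vector_space "smul X" using X by (simp add: is_vspace_def)
  let ?S = "{tensor V W v w | v w. v \<in> carr V \<and> w \<in> carr W}"
  have carr: "carr (tensor_space V W) = T.span ?S" and smul: "smul (tensor_space V W) = fun_scale"
    by (simp_all add: tensor_space_def sub_tensor_def)
  note l = tensor_lift_linear[OF V W X g]
  have zero: "f 0 = 0" if "linear_map (tensor_space V W) X f" for f
  proof -
    have "f (fun_scale 0 0) = smul X 0 (f 0)"
      using that T.span_zero[of ?S] unfolding linear_map_def carr smul by blast
    then show ?thesis by simp
  qed
  have "t \<in> T.span ?S \<and> h t = tensor_lift V W g t"
    using t[unfolded carr]
  proof (induct rule: T.span_induct_alt)
    case base
    show ?case using zero[OF h] zero[OF l] T.span_zero by metis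
  next
    case (step c x y)
    then have x: "x \<in> T.span ?S" and y: "y \<in> T.span ?S" by (auto intro: T.span_base)
    have cx: "fun_scale c x \<in> T.span ?S" using x by (rule T.span_scale)
    have f: "f (fun_scale c x + y) = smul X c (f x) + f y"
      if "linear_map (tensor_space V W) X f" for f
      using that x y cx unfolding linear_map_def carr smul by simp
    have "h x = tensor_lift V W g x"
      using step(1) hg tensor_lift_tensor[OF X g] by auto
    then show ?case
      using f[OF h] f[OF l] step(2) T.span_add[OF cx y] by metis
  qed
  then show ?thesis ..
qed

definition tensor_map ::
  "('k::field, 'v::ab_group_add) vspace \<Rightarrow> ('k, 'w::ab_group_add) vspace \<Rightarrow>
   ('k, 'x::ab_group_add) vspace \<Rightarrow> ('k, 'y::ab_group_add) vspace \<Rightarrow>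
   ('v \<Rightarrow> 'x) \<Rightarrow> ('w \<Rightarrow> 'y) \<Rightarrow>
   (('v \<Rightarrow> 'w \<Rightarrow> 'k) \<Rightarrow> 'k) \<Rightarrow> (('x \<Rightarrow> 'y \<Rightarrow> 'k) \<Rightarrow> 'k)" where
  "tensor_map V W X Y f g = tensor_lift V W (\<lambda>v w. tensor X Y (f v) (g w))"

type_synonym ('k, 'v) tens2 = "('v \<Rightarrow> 'v \<Rightarrow> 'k) \<Rightarrow> 'k"
type_synonym ('k, 'v) tens3 = "(('k, 'v) tens2 \<Rightarrow> 'v \<Rightarrow> 'k) \<Rightarrow> 'k"

abbreviation tensor2 ::
  "('k::field, 'v::ab_group_add) vspace \<Rightarrow> 'v \<Rightarrow> 'v \<Rightarrow> ('k, 'v) tens2" where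
  "tensor2 V \<equiv> tensor V V"

text \<open>\<open>V \<otimes> V \<otimes> V\<close> is read as \<open>(V \<otimes> V) \<otimes> V\<close>.\<close>

definition tensor3 ::
  "('k::field, 'v::ab_group_add) vspace \<Rightarrow> 'v \<Rightarrow> 'v \<Rightarrow> 'v \<Rightarrow> ('k, 'v) tens3" where
  "tensor3 V x y z = tensor (tensor_space V V) V (tensor V V x y) z"

definition flip ::
  "('k::field, 'v::ab_group_add) vspace \<Rightarrow> ('k, 'v) tens2 \<Rightarrow> ('k, 'v) tens2" where
  "flip V = tensor_lift V V (\<lambda>x y. tensor2 V y x)"

definition flip12 ::
  "('k::field, 'v::ab_group_add) vspace \<Rightarrow> ('k, 'v) tens3 \<Rightarrow> ('k, 'v) tens3" where
  "flip12 V = tensor_map (tensor_space V V) V (tensor_space V V) V (flip V) id"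


section \<open>Novikov, pre-Novikov and Lie algebras\<close>

definition novikov :: "('k::field, 'v::ab_group_add) vspace \<Rightarrow> ('v \<Rightarrow> 'v \<Rightarrow> 'v) \<Rightarrow> bool" where
  "novikov V m \<longleftrightarrow> is_vspace V \<and> bilinear_map V V V m \<and>
     (\<forall>a\<in>carr V. \<forall>b\<in>carr V. \<forall>c\<in>carr V.
        m (m a b) c - m a (m b c) = m (m b a) c - m b (m a c) \<and>
        m (m a b) c = m (m a c) b)"

definition right_novikov :: "('k::field, 'v::ab_group_add) vspace \<Rightarrow> ('v \<Rightarrow> 'v \<Rightarrow> 'v) \<Rightarrow> bool" where
  "right_novikov V m \<longleftrightarrow> is_vspace V \<and> bilinear_map V V V m \<and>
     (\<forall>a\<in>carr V. \<forall>b\<in>carr V. \<forall>c\<in>carr V.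
        m (m a b) c - m a (m b c) = m (m a c) b - m a (m c b) \<and>
        m a (m b c) = m b (m a c))"

definition pre_novikov ::
  "('k::field, 'v::ab_group_add) vspace \<Rightarrow> ('v \<Rightarrow> 'v \<Rightarrow> 'v) \<Rightarrow> ('v \<Rightarrow> 'v \<Rightarrow> 'v) \<Rightarrow> bool" where
  "pre_novikov V l r \<longleftrightarrow> is_vspace V \<and> bilinear_map V V V l \<and> bilinear_map V V V r \<and>
     (\<forall>x\<in>carr V. \<forall>y\<in>carr V. \<forall>z\<in>carr V.
        r x (r y z) = r (r x y + l x y) z + r y (r x z) - r (r y x + l y x) z \<and>
        r x (l y z) = l (r x y) z + l y (l x z + r x z) - l (l y x) z \<and>
        r (l x y + r x y) z = l (r x z) y \<and>
        l (l x y) z = l (l x z) y)"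

definition lie_algebra :: "('k::field, 'v::ab_group_add) vspace \<Rightarrow> ('v \<Rightarrow> 'v \<Rightarrow> 'v) \<Rightarrow> bool" where
  "lie_algebra V br \<longleftrightarrow> is_vspace V \<and> bilinear_map V V V br \<and>
     (\<forall>x\<in>carr V. br x x = 0) \<and>
     (\<forall>x\<in>carr V. \<forall>y\<in>carr V. \<forall>z\<in>carr V. br x (br y z) + br y (br z x) + br z (br x y) = 0)"

definition assoc_prod :: "('v \<Rightarrow> 'v \<Rightarrow> 'v) \<Rightarrow> ('v \<Rightarrow> 'v \<Rightarrow> 'v) \<Rightarrow> 'v \<Rightarrow> 'v \<Rightarrow> 'v::plus" where
  "assoc_prod l r x y = l x y + r x y"

text \<open>The dual action \<open>\<phi>\<^sup>*\<close> of \<open>\<phi> : A \<rightarrow> End(A)\<close>.\<close>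

definition dual_act :: "('v \<Rightarrow> 'v \<Rightarrow> 'v) \<Rightarrow> 'v \<Rightarrow> ('v \<Rightarrow> 'k::field) \<Rightarrow> 'v \<Rightarrow> 'k" where
  "dual_act \<phi> a f = (\<lambda>b. - f (\<phi> a b))"

definition tilde_space ::
  "('k::field \<Rightarrow> 'v::ab_group_add \<Rightarrow> 'v) \<Rightarrow> ('k, 'v \<times> ('v \<Rightarrow> 'k)) vspace" where
  "tilde_space s = direct_sum (whole s) (dual_space s)"

definition tilde_prod ::
  "('v::ab_group_add \<Rightarrow> 'v \<Rightarrow> 'v) \<Rightarrow> ('v \<Rightarrow> 'v \<Rightarrow> 'v) \<Rightarrow>
   'v \<times> ('v \<Rightarrow> 'k::field) \<Rightarrow> 'v \<times> ('v \<Rightarrow> 'k) \<Rightarrow> 'v \<times> ('v \<Rightarrow> 'k)" where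
  "tilde_prod l r = (\<lambda>(a, f) (b, g).
     let L = (\<lambda>a b. r a b); R = (\<lambda>a b. l b a)
     in (assoc_prod l r a b, (dual_act L a g + dual_act R a g) - dual_act R b f))"

definition nybe_expr ::
  "('k::field, 'v::ab_group_add) vspace \<Rightarrow> ('v \<Rightarrow> 'v \<Rightarrow> 'v) \<Rightarrow> ('k, 'v) tens2 \<Rightarrow> ('k, 'v) tens3" where
  "nybe_expr V m r =
     tensor_lift V V (\<lambda>x y. tensor_lift V V (\<lambda>x' y'.
        tensor3 V x x' (m y y') + tensor3 V x (m y x' + m x' y) y' + tensor3 V (m x x') y' y) r) r"

definition skew_nybe_solution ::
  "('k::field, 'v::ab_group_add) vspace \<Rightarrow> ('v \<Rightarrow> 'v \<Rightarrow> 'v) \<Rightarrow> ('k, 'v) tens2 \<Rightarrow> bool" where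
  "skew_nybe_solution V m r \<longleftrightarrow>
     r \<in> carr (tensor_space V V) \<and> flip V r = - r \<and> nybe_expr V m r = 0"


section \<open>Gradings\<close>

definition graded :: "('k::field, 'v::ab_group_add) vspace \<Rightarrow> (int \<Rightarrow> 'v set) \<Rightarrow> bool" where
  "graded V G \<longleftrightarrow> is_vspace V \<and>
     (\<forall>i. module.subspace (smul V) (G i) \<and> G i \<subseteq> carr V) \<and>
     (\<forall>x\<in>carr V. \<exists>!f. (\<forall>i. f i \<in> G i) \<and> finite {i. f i \<noteq> 0} \<and> x = (\<Sum>i | f i \<noteq> 0. f i))"

definition hom_comp :: "(int \<Rightarrow> 'v set) \<Rightarrow> int \<Rightarrow> 'v \<Rightarrow> 'v::ab_group_add" where
  "hom_comp G i x =
     (THE f. (\<forall>i. f i \<in> G i) \<and> finite {i. f i \<noteq> 0} \<and> x = (\<Sum>i | f i \<noteq> 0. f i)) i"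

definition quadratic_graded_right_novikov ::
  "('k::field, 'v::ab_group_add) vspace \<Rightarrow> (int \<Rightarrow> 'v set) \<Rightarrow> ('v \<Rightarrow> 'v \<Rightarrow> 'v) \<Rightarrow>
   ('v \<Rightarrow> 'v \<Rightarrow> 'k) \<Rightarrow> bool" where
  "quadratic_graded_right_novikov V G m form \<longleftrightarrow>
     right_novikov V m \<and> graded V G \<and>
     (\<forall>i. \<exists>F. finite F \<and> module.span (smul V) F = G i) \<and>
     (\<forall>i j. \<forall>a\<in>G i. \<forall>b\<in>G j. m a b \<in> G (i + j)) \<and>
     bilinear_map V V ground form \<and>
     (\<forall>a\<in>carr V. \<forall>b\<in>carr V. form a b = form b a) \<and>
     (\<forall>a\<in>carr V. (\<forall>b\<in>carr V. form a b = 0) \<longrightarrow> a = 0) \<and>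
     (\<exists>d. \<forall>i j. i + j + d \<noteq> 0 \<longrightarrow> (\<forall>a\<in>G i. \<forall>b\<in>G j. form a b = 0)) \<and>
     (\<forall>a\<in>carr V. \<forall>b\<in>carr V. \<forall>c\<in>carr V. form (m a b) c = - form a (m b c + m c b))"

definition homogeneous_basis ::
  "('k::field, 'v::ab_group_add) vspace \<Rightarrow> (int \<Rightarrow> 'v set) \<Rightarrow> 'i set \<Rightarrow> ('i \<Rightarrow> 'v) \<Rightarrow> bool" where
  "homogeneous_basis V G I b \<longleftrightarrow> is_basis V I b \<and> (\<forall>p\<in>I. \<exists>i. b p \<in> G i)"

definition induced_bracket ::
  "('k::field, 'v::ab_group_add) vspace \<Rightarrow> ('k, 'w::ab_group_add) vspace \<Rightarrow>
   ('v \<Rightarrow> 'v \<Rightarrow> 'v) \<Rightarrow> ('w \<Rightarrow> 'w \<Rightarrow> 'w) \<Rightarrow>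
   (('v \<Rightarrow> 'w \<Rightarrow> 'k) \<Rightarrow> 'k) \<Rightarrow> (('v \<Rightarrow> 'w \<Rightarrow> 'k) \<Rightarrow> 'k) \<Rightarrow> (('v \<Rightarrow> 'w \<Rightarrow> 'k) \<Rightarrow> 'k)" where
  "induced_bracket V W m m' x y =
     tensor_lift V W (\<lambda>a\<^sub>1 b\<^sub>1. tensor_lift V W (\<lambda>a\<^sub>2 b\<^sub>2.
       tensor V W (m a\<^sub>1 a\<^sub>2) (m' b\<^sub>1 b\<^sub>2) - tensor V W (m a\<^sub>2 a\<^sub>1) (m' b\<^sub>2 b\<^sub>1)) y) x"

definition induced_grading ::
  "('k::field, 'v::ab_group_add) vspace \<Rightarrow> ('k, 'w::ab_group_add) vspace \<Rightarrow>
   (int \<Rightarrow> 'w set) \<Rightarrow> int \<Rightarrow> (('v \<Rightarrow> 'w \<Rightarrow> 'k) \<Rightarrow> 'k) set" where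
  "induced_grading V W G i = sub_tensor V W (carr V) (G i)"


section \<open>Completed tensor products\<close>

text \<open>An element of a completed tensor product is the family of its multidegree components.
  A formal sum is a family of tensors, each contributing to the multidegree \<open>d\<close> its component
  \<open>cmp d\<close>; it is meaningful when only finitely many members contribute to each multidegree.\<close>

type_synonym ('k, 'v) ctens2 = "int \<times> int \<Rightarrow> ('k, 'v) tens2"
type_synonym ('k, 'v) ctens3 = "int \<times> int \<times> int \<Rightarrow> ('k, 'v) tens3"

definition locally_finite :: "('d \<Rightarrow> 't \<Rightarrow> 't::zero) \<Rightarrow> 'i set \<Rightarrow> ('i \<Rightarrow> 't) \<Rightarrow> bool" where
  "locally_finite cmp I t \<longleftrightarrow> (\<forall>d. finite {i \<in> I. cmp d (t i) \<noteq> 0})"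

definition formal_sum ::
  "('d \<Rightarrow> 't \<Rightarrow> 't::comm_monoid_add) \<Rightarrow> 'i set \<Rightarrow> ('i \<Rightarrow> 't) \<Rightarrow> 'd \<Rightarrow> 't" where
  "formal_sum cmp I t = (\<lambda>d. \<Sum>i | i \<in> I \<and> cmp d (t i) \<noteq> 0. cmp d (t i))"

definition comp2 ::
  "('k::field, 'v::ab_group_add) vspace \<Rightarrow> (int \<Rightarrow> 'v set) \<Rightarrow>
   int \<times> int \<Rightarrow> ('k, 'v) tens2 \<Rightarrow> ('k, 'v) tens2" where
  "comp2 V G = (\<lambda>(i, j). tensor_map V V V V (hom_comp G i) (hom_comp G j))"

definition comp3 ::
  "('k::field, 'v::ab_group_add) vspace \<Rightarrow> (int \<Rightarrow> 'v set) \<Rightarrow>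
   int \<times> int \<times> int \<Rightarrow> ('k, 'v) tens3 \<Rightarrow> ('k, 'v) tens3" where
  "comp3 V G = (\<lambda>(i, j, k).
     tensor_map (tensor_space V V) V (tensor_space V V) V (comp2 V G (i, j)) (hom_comp G k))"

definition ctensor2 ::
  "('k::field, 'v::ab_group_add) vspace \<Rightarrow> (int \<Rightarrow> 'v set) \<Rightarrow> ('k, 'v) ctens2 set" where
  "ctensor2 V G = {s. \<forall>i j. s (i, j) \<in> sub_tensor V V (G i) (G j)}"

definition cflip ::
  "('k::field, 'v::ab_group_add) vspace \<Rightarrow> ('k, 'v) ctens2 \<Rightarrow> ('k, 'v) ctens2" where
  "cflip V s = (\<lambda>(i, j). flip V (s (j, i)))"

definition cflip12 ::
  "('k::field, 'v::ab_group_add) vspace \<Rightarrow> ('k, 'v) ctens3 \<Rightarrow> ('k, 'v) ctens3" where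
  "cflip12 V s = (\<lambda>(i, j, k). flip12 V (s (j, i, k)))"

text \<open>Each completed operation comes with a predicate stating that it is well defined.\<close>

definition cmap_defined ::
  "('k::field, 'v::ab_group_add) vspace \<Rightarrow> (int \<Rightarrow> 'v set) \<Rightarrow> ('v \<Rightarrow> 'v) \<Rightarrow> ('v \<Rightarrow> 'v) \<Rightarrow>
   ('k, 'v) ctens2 \<Rightarrow> bool" where
  "cmap_defined V G f g s \<longleftrightarrow>
     locally_finite (comp2 V G) UNIV (\<lambda>d. tensor_map V V V V f g (s d))"

definition cmap ::
  "('k::field, 'v::ab_group_add) vspace \<Rightarrow> (int \<Rightarrow> 'v set) \<Rightarrow> ('v \<Rightarrow> 'v) \<Rightarrow> ('v \<Rightarrow> 'v) \<Rightarrow>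
   ('k, 'v) ctens2 \<Rightarrow> ('k, 'v) ctens2" where
  "cmap V G f g s = formal_sum (comp2 V G) UNIV (\<lambda>d. tensor_map V V V V f g (s d))"

definition ad_hat_defined ::
  "('k::field, 'v::ab_group_add) vspace \<Rightarrow> (int \<Rightarrow> 'v set) \<Rightarrow> ('v \<Rightarrow> 'v \<Rightarrow> 'v) \<Rightarrow> 'v \<Rightarrow>
   ('k, 'v) ctens2 \<Rightarrow> bool" where
  "ad_hat_defined V G br x s \<longleftrightarrow> cmap_defined V G (br x) id s \<and> cmap_defined V G id (br x) s"

definition ad_hat ::
  "('k::field, 'v::ab_group_add) vspace \<Rightarrow> (int \<Rightarrow> 'v set) \<Rightarrow> ('v \<Rightarrow> 'v \<Rightarrow> 'v) \<Rightarrow> 'v \<Rightarrow>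
   ('k, 'v) ctens2 \<Rightarrow> ('k, 'v) ctens2" where
  "ad_hat V G br x s = cmap V G (br x) id s + cmap V G id (br x) s"

text \<open>For the iterated coproducts, the formal sum runs over the components \<open>s d\<close> of \<open>s\<close> and the
  components \<open>d'\<close> of the values of \<open>\<delta>\<close>.\<close>

definition id_delta_terms ::
  "('k::field, 'v::ab_group_add) vspace \<Rightarrow> ('v \<Rightarrow> ('k, 'v) ctens2) \<Rightarrow> ('k, 'v) ctens2 \<Rightarrow>
   (int \<times> int) \<times> (int \<times> int) \<Rightarrow> ('k, 'v) tens3" where
  "id_delta_terms V \<delta> s = (\<lambda>(d, d').
     tensor_lift V V (\<lambda>x y. tensor_lift V V (\<lambda>y\<^sub>1 y\<^sub>2. tensor3 V x y\<^sub>1 y\<^sub>2) (\<delta> y d')) (s d))"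

definition delta_id_terms ::
  "('k::field, 'v::ab_group_add) vspace \<Rightarrow> ('v \<Rightarrow> ('k, 'v) ctens2) \<Rightarrow> ('k, 'v) ctens2 \<Rightarrow>
   (int \<times> int) \<times> (int \<times> int) \<Rightarrow> ('k, 'v) tens3" where
  "delta_id_terms V \<delta> s = (\<lambda>(d, d').
     tensor_lift V V (\<lambda>x y. tensor_lift V V (\<lambda>x\<^sub>1 x\<^sub>2. tensor3 V x\<^sub>1 x\<^sub>2 y) (\<delta> x d')) (s d))"

definition completed_lie_bialgebra ::
  "('k::field, 'v::ab_group_add) vspace \<Rightarrow> (int \<Rightarrow> 'v set) \<Rightarrow> ('v \<Rightarrow> 'v \<Rightarrow> 'v) \<Rightarrow>
   ('v \<Rightarrow> ('k, 'v) ctens2) \<Rightarrow> bool" where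
  "completed_lie_bialgebra L G br \<delta> \<longleftrightarrow>
     graded L G \<and> lie_algebra L br \<and>
     (\<forall>x\<in>carr L. \<delta> x \<in> ctensor2 L G) \<and>
     (\<forall>x\<in>carr L. \<forall>y\<in>carr L. \<delta> (x + y) = \<delta> x + \<delta> y) \<and>
     (\<forall>c. \<forall>x\<in>carr L. \<delta> (smul L c x) = (\<lambda>d. fun_scale c (\<delta> x d))) \<and>
     (\<forall>x\<in>carr L. \<delta> x = - cflip L (\<delta> x)) \<and>
     (\<forall>x\<in>carr L.
        let t = id_delta_terms L \<delta> (\<delta> x); u = delta_id_terms L \<delta> (\<delta> x)
        in locally_finite (comp3 L G) UNIV t \<and> locally_finite (comp3 L G) UNIV u \<and>
           formal_sum (comp3 L G) UNIV t - cflip12 L (formal_sum (comp3 L G) UNIV t) =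
             formal_sum (comp3 L G) UNIV u) \<and>
     (\<forall>a\<in>carr L. \<forall>b\<in>carr L.
        ad_hat_defined L G br a (\<delta> b) \<and>
        \<delta> (br a b) = ad_hat L G br a (\<delta> b) - ad_hat L G br b (\<delta> a))"

text \<open>For \<open>s = \<Sum> a \<otimes> b\<close>, the three sums in the classical Yang-Baxter equation; each is a formal
  sum over pairs of components of \<open>s\<close>, expanded bilinearly.\<close>

definition cybe_terms ::
  "('k::field, 'v::ab_group_add) vspace \<Rightarrow> ('v \<Rightarrow> 'v \<Rightarrow> 'v \<Rightarrow> 'v \<Rightarrow> ('k, 'v) tens3) \<Rightarrow>
   ('k, 'v) ctens2 \<Rightarrow> (int \<times> int) \<times> (int \<times> int) \<Rightarrow> ('k, 'v) tens3" where
  "cybe_terms V h s = (\<lambda>(d, d').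
     tensor_lift V V (\<lambda>a b. tensor_lift V V (\<lambda>a' b'. h a b a' b') (s d')) (s d))"

definition skew_completed_cybe_solution ::
  "('k::field, 'v::ab_group_add) vspace \<Rightarrow> (int \<Rightarrow> 'v set) \<Rightarrow> ('v \<Rightarrow> 'v \<Rightarrow> 'v) \<Rightarrow>
   ('k, 'v) ctens2 \<Rightarrow> bool" where
  "skew_completed_cybe_solution L G br s \<longleftrightarrow>
     s \<in> ctensor2 L G \<and> cflip L s = - s \<and>
     (let t1 = cybe_terms L (\<lambda>a b a' b'. tensor3 L (br a a') b b') s;
          t2 = cybe_terms L (\<lambda>a b a' b'. tensor3 L a (br b a') b') s;
          t3 = cybe_terms L (\<lambda>a b a' b'. tensor3 L a a' (br b b')) s
      in locally_finite (comp3 L G) UNIV t1 \<and> locally_finite (comp3 L G) UNIV t2 \<and>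
         locally_finite (comp3 L G) UNIV t3 \<and>
         formal_sum (comp3 L G) UNIV t1 + formal_sum (comp3 L G) UNIV t2 +
           formal_sum (comp3 L G) UNIV t3 = 0)"

end

theory Submission
  imports Defs
begin

text \<open>
  The theorem rests on one principle: a nondegenerate skew \<open>2\<close>-cocycle \<open>\<Omega>\<close> on a Lie algebra and a
  skew solution \<open>s\<close> of the classical Yang-Baxter equation are inverse to each other, and the
  cobracket defined by \<open>s\<close> is the transpose of the bracket under \<open>\<Omega>\<close>. So it is enough to find
  \<open>\<Omega>\<close>, to check that it is a cocycle, and to recognise \<open>r\<^sub>L\<close> as its inverse.

  On \<open>A \<oplus> A\<^sup>*\<close> take \<open>\<omega>(a + f, b + g) = f(b) - g(a)\<close>. Its inverse is \<open>r\<close>, in the sense that pairing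
  \<open>r\<close> with \<open>y\<close> and \<open>z\<close> through \<open>\<omega>\<close> gives \<open>\<omega>(z, y)\<close>, and the definition of the product gives
  \<open>\<omega>(x \<circ> y, z) + \<omega>(z \<circ> y, x) = \<omega>(x \<circ> z + z \<circ> x, y)\<close>.
  Pairing the Novikov Yang-Baxter expression of \<open>r\<close> with \<open>x\<close>, \<open>y\<close>, \<open>z\<close> yields exactly the difference
  of the two sides (\<open>skew_nybe_solutionI\<close>, \<open>quasi_frobenius_novikov_tilde\<close>).

  On \<open>L\<close> take \<open>\<Omega> = \<omega> \<otimes> (\<cdot>, \<cdot>)\<close>. Since \<open>{b\<^sub>p}\<close> and \<open>{c\<^sub>p}\<close> are dual, \<open>r\<^sub>L\<close> is the inverse of \<open>\<Omega>\<close>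
  (\<open>represents_canonical\<close>). The cocycle identity for \<open>\<Omega>\<close> combines two facts: the number
  \<open>(b\<^sub>1 \<diamondop> b\<^sub>2, b\<^sub>3)\<close> is symmetric in \<open>b\<^sub>2\<close>, \<open>b\<^sub>3\<close> and its three cyclic values add up to zero, while
  \<open>\<omega>(a\<^sub>1 \<circ> a\<^sub>2, a\<^sub>3) - \<omega>(a\<^sub>1 \<circ> a\<^sub>3, a\<^sub>2)\<close> is invariant under cyclic permutations (\<open>cocycle_tensor\<close>).

  A tensor is here a functional on bilinear forms, so \<open>t \<in> L \<otimes> L\<close> can be evaluated at the
  form \<open>(u, v) \<mapsto> \<Omega>(u, y) \<Omega>(v, z)\<close>, and these values determine \<open>t\<close> (\<open>tensor_separated\<close>). Hence a completed
  tensor is recorded by a single bilinear form on \<open>L\<close> (\<open>represents\<close>), and for homogeneous arguments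
  each formal sum in the Yang-Baxter and co-Jacobi expressions has one contributing term
  (\<open>comp3_single_term\<close>). In this dictionary \<open>s\<close>
  is \<open>(y, z) \<mapsto> \<Omega>(z, y)\<close>, the Yang-Baxter equation is the cocycle identity, \<open>\<delta>(x)\<close> is
  \<open>(y, z) \<mapsto> \<Omega>([y, z], x)\<close>, and the co-Jacobi identity is the Jacobi identity. The operator
  \<open>ad\<^sub>x\<close> on a tensor factor becomes its \<open>\<Omega>\<close>-adjoint on an argument; the adjoint exists
  although \<open>L\<close> may be infinite-dimensional, because the components of \<open>s\<close> represent graded functionals
  (\<open>riesz\<close>). The compatibility of \<open>\<delta>\<close> with the bracket is then an identity between adjoints.
\<close>

section \<open>Linear algebra on a carrier\<close>

lemma vspace_vector_space: "is_vspace V \<Longrightarrow> vector_space (smul V)"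
  by (simp add: is_vspace_def)

lemma vspace_zero: "is_vspace V \<Longrightarrow> 0 \<in> carr V"
  unfolding is_vspace_def using module.subspace_0 module_iff_vector_space by blast

lemma vspace_add: "is_vspace V \<Longrightarrow> x \<in> carr V \<Longrightarrow> y \<in> carr V \<Longrightarrow> x + y \<in> carr V"
  unfolding is_vspace_def using module.subspace_add module_iff_vector_space by blast

lemma vspace_scale: "is_vspace V \<Longrightarrow> x \<in> carr V \<Longrightarrow> smul V c x \<in> carr V"
  unfolding is_vspace_def using module.subspace_scale module_iff_vector_space by blast

lemma vspace_neg: "is_vspace V \<Longrightarrow> x \<in> carr V \<Longrightarrow> - x \<in> carr V"
  unfolding is_vspace_def using module.subspace_neg module_iff_vector_space by blast

lemma vspace_diff: "is_vspace V \<Longrightarrow> x \<in> carr V \<Longrightarrow> y \<in> carr V \<Longrightarrow> x - y \<in> carr V"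
  unfolding is_vspace_def using module.subspace_diff module_iff_vector_space by blast

lemma vspace_sum: "is_vspace V \<Longrightarrow> (\<And>i. i \<in> I \<Longrightarrow> f i \<in> carr V) \<Longrightarrow> sum f I \<in> carr V"
  unfolding is_vspace_def using module.subspace_sum module_iff_vector_space by blast

lemma whole_sel [simp]: "carr (whole s) = UNIV" "smul (whole s) = s"
  by (simp_all add: whole_def)

lemma is_vspace_whole: "vector_space s \<Longrightarrow> is_vspace (whole s)"
  by (simp add: is_vspace_def module_iff_vector_space module.subspace_UNIV)

lemma is_vspace_ground: "is_vspace (ground :: ('k::field, 'k) vspace)"
  by (rule is_vspace_whole) (unfold_locales, auto simp: algebra_simps)

lemma linear_mapI:
  assumes "\<And>x. x \<in> carr V \<Longrightarrow> f x \<in> carr W"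
    and "\<And>x y. x \<in> carr V \<Longrightarrow> y \<in> carr V \<Longrightarrow> f (x + y) = f x + f y"
    and "\<And>c x. x \<in> carr V \<Longrightarrow> f (smul V c x) = smul W c (f x)"
  shows "linear_map V W f"
  using assms by (simp add: linear_map_def)

lemma linear_map_mem: "linear_map V W f \<Longrightarrow> x \<in> carr V \<Longrightarrow> f x \<in> carr W"
  and linear_map_add:
    "linear_map V W f \<Longrightarrow> x \<in> carr V \<Longrightarrow> y \<in> carr V \<Longrightarrow> f (x + y) = f x + f y"
  and linear_map_scale: "linear_map V W f \<Longrightarrow> x \<in> carr V \<Longrightarrow> f (smul V c x) = smul W c (f x)"
  by (simp_all add: linear_map_def)

lemma linear_map_zero:
  assumes "is_vspace V" "linear_map V W f"
  shows "f 0 = 0"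
  using linear_map_add[OF assms(2), of 0 0] vspace_zero[OF assms(1)] by simp

lemma linear_map_neg:
  assumes "is_vspace V" "linear_map V W f" "x \<in> carr V"
  shows "f (- x) = - f x"
  using linear_map_add[OF assms(2), of x "- x"] linear_map_zero[OF assms(1,2)] assms
  by (simp add: vspace_neg eq_neg_iff_add_eq_0 add.commute)

lemma linear_map_diff:
  assumes "is_vspace V" "linear_map V W f" "x \<in> carr V" "y \<in> carr V"
  shows "f (x - y) = f x - f y"
  using linear_map_add[OF assms(2), of x "- y"] linear_map_neg[OF assms(1,2,4)] assms
  by (simp add: vspace_neg)

lemma linear_map_sum:
  assumes "is_vspace V" "linear_map V W f" "\<And>i. i \<in> I \<Longrightarrow> g i \<in> carr V"
  shows "f (sum g I) = (\<Sum>i\<in>I. f (g i))"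
  using assms(3)
proof (induct I rule: infinite_finite_induct)
  case (insert i I)
  then show ?case
    using linear_map_add[OF assms(2), of "g i" "sum g I"] assms(1) by (simp add: vspace_sum)
qed (simp_all add: linear_map_zero[OF assms(1,2)])

lemma linear_map_comp:
  "linear_map V W f \<Longrightarrow> linear_map W X g \<Longrightarrow> linear_map V X (\<lambda>x. g (f x))"
  by (simp add: linear_map_def)

lemma linear_map_id: "linear_map V V (\<lambda>x. x)" "linear_map V V id"
  by (simp_all add: linear_map_def)

lemma bilinear_mapI:
  assumes "\<And>v w. v \<in> carr V \<Longrightarrow> w \<in> carr W \<Longrightarrow> g v w \<in> carr X"
    and "\<And>v v' w. v \<in> carr V \<Longrightarrow> v' \<in> carr V \<Longrightarrow> w \<in> carr W \<Longrightarrow> g (v + v') w = g v w + g v' w"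
    and "\<And>c v w. v \<in> carr V \<Longrightarrow> w \<in> carr W \<Longrightarrow> g (smul V c v) w = smul X c (g v w)"
    and "\<And>v w w'. v \<in> carr V \<Longrightarrow> w \<in> carr W \<Longrightarrow> w' \<in> carr W \<Longrightarrow> g v (w + w') = g v w + g v w'"
    and "\<And>c v w. v \<in> carr V \<Longrightarrow> w \<in> carr W \<Longrightarrow> g v (smul W c w) = smul X c (g v w)"
  shows "bilinear_map V W X g"
  using assms by (simp add: bilinear_map_def linear_map_def)

lemma bilinear_map_left: "bilinear_map V W X g \<Longrightarrow> w \<in> carr W \<Longrightarrow> linear_map V X (\<lambda>v. g v w)"
  and bilinear_map_right: "bilinear_map V W X g \<Longrightarrow> v \<in> carr V \<Longrightarrow> linear_map W X (g v)"
  by (simp_all add: bilinear_map_def)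

lemma bilinear_map_mem:
  "bilinear_map V W X g \<Longrightarrow> v \<in> carr V \<Longrightarrow> w \<in> carr W \<Longrightarrow> g v w \<in> carr X"
  by (simp add: bilinear_map_def linear_map_def)

lemma bilinear_map_compose_linear:
  "bilinear_map V W X g \<Longrightarrow> linear_map X Y f \<Longrightarrow> bilinear_map V W Y (\<lambda>v w. f (g v w))"
  by (simp add: bilinear_map_def linear_map_def)

lemma bilinear_map_precompose:
  "bilinear_map V W X g \<Longrightarrow> linear_map V' V f \<Longrightarrow> linear_map W' W h \<Longrightarrow>
   bilinear_map V' W' X (\<lambda>v w. g (f v) (h w))"
  by (simp add: bilinear_map_def linear_map_def)

lemma bilinear_map_mult:
  "linear_map V ground \<phi> \<Longrightarrow> linear_map W ground \<psi> \<Longrightarrow>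
   bilinear_map V W ground (\<lambda>v w. \<phi> v * \<psi> w)"
  by (simp add: bilinear_map_def linear_map_def algebra_simps)

lemma bilinear_map_scale_vector:
  assumes "is_vspace W" "linear_map V ground \<phi>"
  shows "bilinear_map V W W (\<lambda>v w. smul W (\<phi> v) w)" (is ?L)
    and "bilinear_map W V W (\<lambda>w v. smul W (\<phi> v) w)" (is ?R)
proof -
  interpret vector_space "smul W" using assms(1) by (rule vspace_vector_space)
  show ?L
    using assms by (auto intro!: bilinear_mapI
        simp: vspace_scale linear_map_def scale_left_distrib scale_right_distrib mult.commute)
  show ?R
    using assms by (auto intro!: bilinear_mapI
        simp: vspace_scale linear_map_def scale_left_distrib scale_right_distrib mult.commute)
qed

section \<open>Tensors as functionals on bilinear forms\<close>

lemma tensor_apply: "bilinear_map V W ground \<beta> \<Longrightarrow> tensor V W v w \<beta> = \<beta> v w"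
  by (simp add: tensor_def)

lemma smul_tensor_space [simp]: "smul (tensor_space V W) = fun_scale"
  by (simp add: tensor_space_def)

lemma tensor_vspace:
  fixes V :: "('k::field, 'v::ab_group_add) vspace" and W :: "('k, 'w::ab_group_add) vspace"
  shows "is_vspace (tensor_space V W)"
proof -
  interpret T: vector_space "fun_scale :: 'k \<Rightarrow> (('v \<Rightarrow> 'w \<Rightarrow> 'k) \<Rightarrow> 'k) \<Rightarrow> _"
    by (rule vector_space_fun_scale)
  show ?thesis
    by (simp add: is_vspace_def tensor_space_def sub_tensor_def T.vector_space_axioms)
qed

lemma tensor_mem:
  fixes V :: "('k::field, 'v::ab_group_add) vspace" and W :: "('k, 'w::ab_group_add) vspace"
  assumes "v \<in> carr V" "w \<in> carr W"
  shows "tensor V W v w \<in> carr (tensor_space V W)"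
proof -
  interpret T: vector_space "fun_scale :: 'k \<Rightarrow> (('v \<Rightarrow> 'w \<Rightarrow> 'k) \<Rightarrow> 'k) \<Rightarrow> _"
    by (rule vector_space_fun_scale)
  show ?thesis
    using assms by (auto simp: tensor_space_def sub_tensor_def intro: T.span_base)
qed

lemma bilinear_map_tensor: "bilinear_map V W (tensor_space V W) (tensor V W)"
  by (auto intro!: bilinear_mapI simp: tensor_mem)
    (auto simp: tensor_def fun_eq_iff fun_scale_def bilinear_map_def linear_map_def)

lemma tensor_add_left:
    "v \<in> carr V \<Longrightarrow> v' \<in> carr V \<Longrightarrow> w \<in> carr W \<Longrightarrow>
     tensor V W (v + v') w = tensor V W v w + tensor V W v' w"
  and tensor_add_right:
    "v \<in> carr V \<Longrightarrow> w \<in> carr W \<Longrightarrow> w' \<in> carr W \<Longrightarrow>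
     tensor V W v (w + w') = tensor V W v w + tensor V W v w'"
  and tensor_scale_left:
    "v \<in> carr V \<Longrightarrow> w \<in> carr W \<Longrightarrow> tensor V W (smul V c v) w = fun_scale c (tensor V W v w)"
  and tensor_scale_right:
    "v \<in> carr V \<Longrightarrow> w \<in> carr W \<Longrightarrow> tensor V W v (smul W c w) = fun_scale c (tensor V W v w)"
  using bilinear_map_tensor[of V W] by (simp_all add: bilinear_map_def linear_map_def)

lemma tensor_induct [consumes 3, case_names tensor add]:
  assumes V: "is_vspace V" and W: "is_vspace W" and t: "t \<in> carr (tensor_space V W)"
    and tensor: "\<And>v w. v \<in> carr V \<Longrightarrow> w \<in> carr W \<Longrightarrow> P (tensor V W v w)"
    and add: "\<And>t u. t \<in> carr (tensor_space V W) \<Longrightarrow> u \<in> carr (tensor_space V W) \<Longrightarrow>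
        P t \<Longrightarrow> P u \<Longrightarrow> P (t + u)"
  shows "P t"
proof -
  obtain xs where xs: "set xs \<subseteq> carr V \<times> carr W" and t: "t = (\<Sum>(v, w)\<leftarrow>xs. tensor V W v w)"
    using tensor_space_sum_list[OF V W t] .
  have "tensor V W 0 0 = 0"
    using linear_map_zero[OF V bilinear_map_left[OF bilinear_map_tensor]] vspace_zero[OF W] by blast
  then have "P 0" using tensor[of 0 0] vspace_zero[OF V] vspace_zero[OF W] by simp
  then have "(\<Sum>(v, w)\<leftarrow>xs. tensor V W v w) \<in> carr (tensor_space V W) \<and> P (\<Sum>(v, w)\<leftarrow>xs. tensor V W v w)"
    using xs by (induct xs)
      (auto intro!: tensor add tensor_mem vspace_zero vspace_add tensor_vspace)
  then show ?thesis by (simp add: t)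
qed

lemma linear_map_apply_tensor: "linear_map (tensor_space V W) ground (\<lambda>t. t \<beta>)"
  by (simp add: linear_map_def fun_scale_def)

lemma tensor_apply_cong:
  assumes V: "is_vspace V" and W: "is_vspace W" and t: "t \<in> carr (tensor_space V W)"
    and eq: "\<And>v w. v \<in> carr V \<Longrightarrow> w \<in> carr W \<Longrightarrow> \<beta> v w = \<gamma> v w"
  shows "t \<beta> = t \<gamma>"
  using V W t
proof (induct t rule: tensor_induct)
  case (tensor v w)
  have "bilinear_map V W ground \<beta> \<longleftrightarrow> bilinear_map V W ground \<gamma>"
    using eq vspace_add[OF V] vspace_add[OF W] vspace_scale[OF V] vspace_scale[OF W]
    by (simp add: bilinear_map_def linear_map_def)
  then show ?case using eq tensor by (simp add: tensor_def)
qed simp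

lemma tensor_apply_add:
  assumes V: "is_vspace V" and W: "is_vspace W" and t: "t \<in> carr (tensor_space V W)"
    and "bilinear_map V W ground \<beta>" "bilinear_map V W ground \<gamma>"
  shows "t (\<lambda>v w. \<beta> v w + \<gamma> v w) = t \<beta> + t \<gamma>"
proof -
  have bil: "bilinear_map V W ground (\<lambda>v w. \<beta> v w + \<gamma> v w)"
    using assms(4,5) by (simp add: bilinear_map_def linear_map_def algebra_simps)
  show ?thesis using V W t
    by (induct t rule: tensor_induct) (simp_all add: tensor_apply assms(4,5) bil)
qed

lemma tensor_apply_scale:
  assumes V: "is_vspace V" and W: "is_vspace W" and t: "t \<in> carr (tensor_space V W)"
    and "bilinear_map V W ground \<beta>"
  shows "t (\<lambda>v w. c * \<beta> v w) = c * t \<beta>"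
proof -
  have bil: "bilinear_map V W ground (\<lambda>v w. c * \<beta> v w)"
    using assms(4) by (simp add: bilinear_map_def linear_map_def algebra_simps)
  show ?thesis using V W t
    by (induct t rule: tensor_induct) (simp_all add: tensor_apply assms(4) bil algebra_simps)
qed

text \<open>Linear functionals commute with lifts. As a target space of tensors consists of functions,
  evaluation at a form is such a functional; every lift below is computed by evaluating it.\<close>

lemma functional_tensor_lift:
  assumes V: "is_vspace V" and W: "is_vspace W" and X: "is_vspace X"
    and g: "bilinear_map V W X g" and \<phi>: "linear_map X ground \<phi>"
    and t: "t \<in> carr (tensor_space V W)"
  shows "\<phi> (tensor_lift V W g t) = t (\<lambda>v w. \<phi> (g v w))"
  using V W t
proof (induct t rule: tensor_induct)
  case (tensor v w)
  then show ?case
    using tensor_lift_tensor[OF X g] tensor_apply[OF bilinear_map_compose_linear[OF g \<phi>]] by simp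
next
  case (add t u)
  note l = tensor_lift_linear[OF V W X g]
  have "\<phi> (tensor_lift V W g (t + u)) = (t + u) (\<lambda>v w. \<phi> (g v w))"
    using add linear_map_add[OF l] linear_map_mem[OF l] linear_map_add[OF \<phi>] by simp
  then show ?case .
qed

lemma linear_map_apply_fun:
  assumes "smul X = fun_scale"
  shows "linear_map X ground (\<lambda>t. t \<beta>)"
  by (simp add: linear_map_def assms fun_scale_def)

lemma tensor_lift_apply:
  assumes "is_vspace V" "is_vspace W" "is_vspace X" "smul X = fun_scale"
    and "bilinear_map V W X g" "t \<in> carr (tensor_space V W)"
  shows "tensor_lift V W g t \<beta> = t (\<lambda>v w. g v w \<beta>)"
  using functional_tensor_lift[OF assms(1,2,3,5) linear_map_apply_fun[OF assms(4)] assms(6)] .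

text \<open>The form of a map on \<open>(V \<times> W) \<times> (V' \<times> W')\<close> that may be lifted twice: both lifts, in
  either order, are lifts of bilinear maps.\<close>

definition quadrilinear_map where
  "quadrilinear_map V W V' W' X g \<longleftrightarrow>
     (\<forall>a\<in>carr V. \<forall>b\<in>carr W. bilinear_map V' W' X (g a b)) \<and>
     (\<forall>a'\<in>carr V'. \<forall>b'\<in>carr W'. bilinear_map V W X (\<lambda>a b. g a b a' b'))"

lemma linear_map_param_lift:
  assumes V: "is_vspace V" and V': "is_vspace V'" and W': "is_vspace W'" and X: "is_vspace X"
    and g: "\<And>v. v \<in> carr V \<Longrightarrow> bilinear_map V' W' X (g v)"
    and g': "\<And>a b. a \<in> carr V' \<Longrightarrow> b \<in> carr W' \<Longrightarrow> linear_map V X (\<lambda>v. g v a b)"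
    and t: "t \<in> carr (tensor_space V' W')"
  shows "linear_map V X (\<lambda>v. tensor_lift V' W' (g v) t)"
  using V' W' t
proof (induct t rule: tensor_induct)
  case (tensor a b)
  have "tensor_lift V' W' (g v) (tensor V' W' a b) = g v a b" if "v \<in> carr V" for v
    using tensor_lift_tensor[OF X g[OF that] tensor] .
  then show ?case
    using g'[OF tensor] by (simp add: linear_map_def vspace_add[OF V] vspace_scale[OF V])
next
  case (add t u)
  interpret vector_space "smul X" using X by (rule vspace_vector_space)
  have "tensor_lift V' W' (g v) (t + u) = tensor_lift V' W' (g v) t + tensor_lift V' W' (g v) u"
    if "v \<in> carr V" for v
    using linear_map_add[OF tensor_lift_linear[OF V' W' X g[OF that]] add(1,2)] .
  then have "linear_map V X (\<lambda>v. tensor_lift V' W' (g v) (t + u))"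
    using add(3,4)
    by (simp add: linear_map_def vspace_add[OF V] vspace_scale[OF V] vspace_add[OF X]
        scale_right_distrib algebra_simps)
  then show ?case .
qed

lemma bilinear_map_param_lift:
  assumes V: "is_vspace V" and V': "is_vspace V'" and W': "is_vspace W'" and X: "is_vspace X"
    and g: "\<And>v. v \<in> carr V \<Longrightarrow> bilinear_map V' W' X (g v)"
    and g': "\<And>a b. a \<in> carr V' \<Longrightarrow> b \<in> carr W' \<Longrightarrow> linear_map V X (\<lambda>v. g v a b)"
  shows "bilinear_map V (tensor_space V' W') X (\<lambda>v t. tensor_lift V' W' (g v) t)"
  using linear_map_param_lift[OF assms] tensor_lift_linear[OF V' W' X g]
  by (simp add: bilinear_map_def)

lemma bilinear_map_partial_lift:
  assumes V: "is_vspace V" and W: "is_vspace W"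
    and V': "is_vspace V'" and W': "is_vspace W'" and X: "is_vspace X"
    and g: "quadrilinear_map V W V' W' X g" and t: "t \<in> carr (tensor_space V' W')"
  shows "bilinear_map V W X (\<lambda>a b. tensor_lift V' W' (g a b) t)"
  unfolding bilinear_map_def
proof (intro conjI ballI)
  fix a assume "a \<in> carr V"
  then show "linear_map W X (\<lambda>b. tensor_lift V' W' (g a b) t)"
    by (intro linear_map_param_lift[OF W V' W' X _ _ t])
      (use g in \<open>simp_all add: quadrilinear_map_def bilinear_map_def\<close>)
next
  fix b assume "b \<in> carr W"
  then show "linear_map V X (\<lambda>a. tensor_lift V' W' (g a b) t)"
    by (intro linear_map_param_lift[OF V V' W' X _ _ t])
      (use g in \<open>simp_all add: quadrilinear_map_def bilinear_map_def\<close>)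
qed

lemma bilinear_map_double_lift:
  assumes V: "is_vspace V" and W: "is_vspace W"
    and V': "is_vspace V'" and W': "is_vspace W'" and X: "is_vspace X"
    and g: "quadrilinear_map V W V' W' X g"
  shows "bilinear_map (tensor_space V W) (tensor_space V' W') X
     (\<lambda>t t'. tensor_lift V W (\<lambda>a b. tensor_lift V' W' (g a b) t') t)"
  unfolding bilinear_map_def
proof (intro conjI ballI)
  note b = bilinear_map_partial_lift[OF V W V' W' X g]
  show "linear_map (tensor_space V W) X (\<lambda>t. tensor_lift V W (\<lambda>a b. tensor_lift V' W' (g a b) t') t)"
    if "t' \<in> carr (tensor_space V' W')" for t'
    using tensor_lift_linear[OF V W X b[OF that]] .
  show "linear_map (tensor_space V' W') X (\<lambda>t'. tensor_lift V W (\<lambda>a b. tensor_lift V' W' (g a b) t') t)"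
    if "t \<in> carr (tensor_space V W)" for t
    by (intro linear_map_param_lift[OF tensor_vspace V W X b _ that]
        tensor_lift_linear[OF V' W' X])
      (use g in \<open>simp_all add: quadrilinear_map_def\<close>)
qed

lemma double_tensor_lift_apply:
  assumes V: "is_vspace V" and W: "is_vspace W"
    and V': "is_vspace V'" and W': "is_vspace W'" and X: "is_vspace X" and s: "smul X = fun_scale"
    and g: "quadrilinear_map V W V' W' X g"
    and t: "t \<in> carr (tensor_space V W)" and t': "t' \<in> carr (tensor_space V' W')"
  shows "tensor_lift V W (\<lambda>a b. tensor_lift V' W' (g a b) t') t \<beta> =
     t (\<lambda>a b. t' (\<lambda>a' b'. g a b a' b' \<beta>))"
  unfolding tensor_lift_apply[OF V W X s bilinear_map_partial_lift[OF V W V' W' X g t'] t]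
proof (rule tensor_apply_cong[OF V W t])
  fix v w assume "v \<in> carr V" "w \<in> carr W"
  then show "tensor_lift V' W' (g v w) t' \<beta> = t' (\<lambda>a' b'. g v w a' b' \<beta>)"
    using tensor_lift_apply[OF V' W' X s _ t'] g by (simp add: quadrilinear_map_def)
qed

text \<open>Contracting one leg with a functional of its separating family gives a vector that the other
  family detects, so \<open>t\<close> vanishes on \<open>\<phi> \<otimes> \<chi>\<close> for all linear \<open>\<phi>\<close> and \<open>\<chi>\<close>, one leg at a time. Coordinates
  in a basis of \<open>V\<close> then write every bilinear form, on the finitely many vectors that occur in \<open>t\<close>,
  as a sum of such products.\<close>

lemma tensor_separated:
  assumes V: "is_vspace V" and W: "is_vspace W" and t: "t \<in> carr (tensor_space V W)"
    and \<Phi>: "\<And>\<phi>. \<phi> \<in> \<Phi> \<Longrightarrow> linear_map V ground \<phi>"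
    and \<Psi>: "\<And>\<psi>. \<psi> \<in> \<Psi> \<Longrightarrow> linear_map W ground \<psi>"
    and sepV: "\<And>v. v \<in> carr V \<Longrightarrow> (\<And>\<phi>. \<phi> \<in> \<Phi> \<Longrightarrow> \<phi> v = 0) \<Longrightarrow> v = 0"
    and sepW: "\<And>w. w \<in> carr W \<Longrightarrow> (\<And>\<psi>. \<psi> \<in> \<Psi> \<Longrightarrow> \<psi> w = 0) \<Longrightarrow> w = 0"
    and zero: "\<And>\<phi> \<psi>. \<phi> \<in> \<Phi> \<Longrightarrow> \<psi> \<in> \<Psi> \<Longrightarrow> t (\<lambda>v w. \<phi> v * \<psi> w) = 0"
  shows "t = 0"
proof -
  have right: "t (\<lambda>v w. \<phi> v * \<chi> w) = 0"
    if \<phi>: "linear_map V ground \<phi>" and \<chi>: "linear_map W ground \<chi>"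
      and 0: "\<And>\<psi>. \<psi> \<in> \<Psi> \<Longrightarrow> t (\<lambda>v w. \<phi> v * \<psi> w) = 0" for \<phi> \<chi>
  proof -
    note b = bilinear_map_scale_vector(1)[OF W \<phi>]
    let ?z = "tensor_lift V W (\<lambda>v w. smul W (\<phi> v) w) t"
    have ev: "\<psi> ?z = t (\<lambda>v w. \<phi> v * \<psi> w)" if "linear_map W ground \<psi>" for \<psi>
      unfolding functional_tensor_lift[OF V W W b that t]
      by (rule tensor_apply_cong[OF V W t]) (simp add: linear_map_scale[OF that])
    have "?z = 0"
      by (rule sepW[OF linear_map_mem[OF tensor_lift_linear[OF V W W b] t]]) (simp add: ev \<Psi> 0)
    then show ?thesis using ev[OF \<chi>] linear_map_zero[OF W \<chi>] by simp
  qed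
  have left: "t (\<lambda>v w. \<phi> v * \<psi> w) = 0" if \<phi>: "linear_map V ground \<phi>" and \<psi>: "\<psi> \<in> \<Psi>" for \<phi> \<psi>
  proof -
    note b = bilinear_map_scale_vector(2)[OF V \<Psi>[OF \<psi>]]
    let ?z = "tensor_lift V W (\<lambda>v w. smul V (\<psi> w) v) t"
    have ev: "\<phi> ?z = t (\<lambda>v w. \<phi> v * \<psi> w)" if "linear_map V ground \<phi>" for \<phi>
      unfolding functional_tensor_lift[OF V W V b that t]
      by (rule tensor_apply_cong[OF V W t]) (simp add: linear_map_scale[OF that])
    have "?z = 0"
      by (rule sepV[OF linear_map_mem[OF tensor_lift_linear[OF V W V b] t]]) (simp add: ev \<Phi> zero \<psi>)
    then show ?thesis using ev[OF \<phi>] linear_map_zero[OF V \<phi>] by simp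
  qed
  have all: "t (\<lambda>v w. \<phi> v * \<chi> w) = 0"
    if "linear_map V ground \<phi>" "linear_map W ground \<chi>" for \<phi> \<chi>
  proof (rule right[of \<phi> \<chi>])
    show "linear_map V ground \<phi>" "linear_map W ground \<chi>" by (fact that)+
    show "t (\<lambda>v w. \<phi> v * \<psi> w) = 0" if "\<psi> \<in> \<Psi>" for \<psi>
      by (rule left[of \<phi> \<psi>]) fact+
  qed
  interpret VV: vector_space "smul V" using V by (rule vspace_vector_space)
  obtain B where B: "B \<subseteq> carr V" "VV.independent B" "carr V \<subseteq> VV.span B"
    by (rule VV.basis_exists)
  let ?c = "VV.representation B"
  have c: "linear_map V ground (\<lambda>v. ?c v k)" for k
    using B by (intro linear_mapI) (auto simp: VV.representation_add VV.representation_scale subsetD)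
  obtain xs where xs: "set xs \<subseteq> carr V \<times> carr W" and t_xs: "t = (\<Sum>(v, w)\<leftarrow>xs. tensor V W v w)"
    using tensor_space_sum_list[OF V W t] .
  define K where "K = (\<Union>(v, w)\<in>set xs. {k. ?c v k \<noteq> 0})"
  have finK: "finite K"
    unfolding K_def by (auto intro!: VV.finite_representation)
  have KB: "K \<subseteq> B"
    unfolding K_def using VV.representation_ne_zero by fastforce
  have "t \<beta> = 0" if \<beta>: "bilinear_map V W ground \<beta>" for \<beta>
  proof -
    have \<beta>k: "linear_map W ground (\<beta> k)" if "k \<in> K" for k
      using bilinear_map_right[OF \<beta>] KB B(1) that by blast
    have expand: "\<beta> v w = (\<Sum>k\<in>K. ?c v k * \<beta> k w)" if "(v, w) \<in> set xs" for v w
    proof -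
      have vw: "v \<in> carr V" "w \<in> carr W" using that xs by auto
      have "v = (\<Sum>k | ?c v k \<noteq> 0. smul V (?c v k) k)"
        using VV.sum_nonzero_representation_eq[OF B(2), of v] vw B(3) by auto
      also have "\<dots> = (\<Sum>k\<in>K. smul V (?c v k) k)"
        by (rule sum.mono_neutral_left) (use finK that in \<open>auto simp: K_def\<close>)
      finally have v: "v = (\<Sum>k\<in>K. smul V (?c v k) k)" .
      have "\<beta> v w = (\<Sum>k\<in>K. \<beta> (smul V (?c v k) k) w)"
        by (subst v, rule linear_map_sum[OF V bilinear_map_left[OF \<beta> vw(2)]])
          (use KB B(1) vspace_scale[OF V] in blast)
      then show ?thesis
        using KB B(1) linear_map_scale[OF bilinear_map_left[OF \<beta> vw(2)]]
        by (simp add: subset_iff)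
    qed
    have "(\<Sum>(v, w)\<leftarrow>ys. tensor V W v w) \<beta> =
        (\<Sum>k\<in>K. (\<Sum>(v, w)\<leftarrow>ys. tensor V W v w) (\<lambda>v w. ?c v k * \<beta> k w))"
      if "set ys \<subseteq> set xs" for ys
      using that
    proof (induct ys)
      case (Cons y ys)
      obtain v w where y: "y = (v, w)" by (cases y)
      have vw: "(v, w) \<in> set xs" and ys: "set ys \<subseteq> set xs" using Cons(2) by (auto simp: y)
      let ?S = "\<Sum>(v, w)\<leftarrow>ys. tensor V W v w"
      have "(\<Sum>(v, w)\<leftarrow>y # ys. tensor V W v w) \<beta> = \<beta> v w + ?S \<beta>"
        by (simp add: y tensor_apply \<beta>)
      also have "\<dots> = (\<Sum>k\<in>K. ?c v k * \<beta> k w) + (\<Sum>k\<in>K. ?S (\<lambda>v w. ?c v k * \<beta> k w))"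
        by (rule arg_cong2[of _ _ _ _ "(+)", OF expand[OF vw] Cons(1)[OF ys]])
      also have "\<dots> = (\<Sum>k\<in>K. ?c v k * \<beta> k w + ?S (\<lambda>v w. ?c v k * \<beta> k w))"
        by (simp only: sum.distrib)
      also have "\<dots> = (\<Sum>k\<in>K. (\<Sum>(v, w)\<leftarrow>y # ys. tensor V W v w) (\<lambda>v w. ?c v k * \<beta> k w))"
        by (rule sum.cong) (simp_all add: y tensor_apply[OF bilinear_map_mult[OF c \<beta>k]])
      finally show ?case .
    qed simp
    from this[of xs] show ?thesis
      using all[OF c \<beta>k] by (simp add: t_xs)
  qed
  moreover have "t \<beta> = 0" if "\<not> bilinear_map V W ground \<beta>" for \<beta>
    using V W t by (induct t rule: tensor_induct) (simp_all add: tensor_def that)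
  ultimately show ?thesis by (auto simp: fun_eq_iff)
qed

section \<open>Graded spaces\<close>

lemma graded_vspace: "graded V G \<Longrightarrow> is_vspace V"
  and graded_subset: "graded V G \<Longrightarrow> x \<in> G i \<Longrightarrow> x \<in> carr V"
  by (auto simp: graded_def)

lemma graded_piece_vspace: "graded V G \<Longrightarrow> is_vspace \<lparr>carr = G i, smul = smul V\<rparr>"
  by (simp add: graded_def is_vspace_def)

lemma graded_zero: "graded V G \<Longrightarrow> 0 \<in> G i"
  and graded_add: "graded V G \<Longrightarrow> x \<in> G i \<Longrightarrow> y \<in> G i \<Longrightarrow> x + y \<in> G i"
  and graded_scale: "graded V G \<Longrightarrow> x \<in> G i \<Longrightarrow> smul V c x \<in> G i"
  using vspace_zero[OF graded_piece_vspace] vspace_add[OF graded_piece_vspace]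
    vspace_scale[OF graded_piece_vspace] by fastforce+

lemma graded_decomposition:
  assumes "graded V G" "x \<in> carr V"
  shows "\<exists>!f. (\<forall>i. f i \<in> G i) \<and> finite {i. f i \<noteq> 0} \<and> x = (\<Sum>i | f i \<noteq> 0. f i)"
  using assms unfolding graded_def by blast

lemma
  assumes "graded V G" "x \<in> carr V"
  shows hom_comp_mem: "hom_comp G i x \<in> G i"
    and finite_hom_comp: "finite {i. hom_comp G i x \<noteq> 0}"
    and sum_hom_comp: "(\<Sum>i | hom_comp G i x \<noteq> 0. hom_comp G i x) = x"
proof -
  let ?P = "\<lambda>f. (\<forall>i. f i \<in> G i) \<and> finite {i. f i \<noteq> 0} \<and> x = (\<Sum>i | f i \<noteq> 0. f i)"
  have "?P (THE f. ?P f)" by (rule theI'[of ?P]) (rule graded_decomposition[OF assms])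
  moreover have "(THE f. ?P f) = (\<lambda>i. hom_comp G i x)" by (simp add: hom_comp_def)
  ultimately have "?P (\<lambda>i. hom_comp G i x)" by simp
  then show "hom_comp G i x \<in> G i" "finite {i. hom_comp G i x \<noteq> 0}"
    "(\<Sum>i | hom_comp G i x \<noteq> 0. hom_comp G i x) = x" by auto
qed

text \<open>The decomposition may be indexed by any finite set that contains its support; this avoids
  computing supports.\<close>

lemma hom_comp_eqI:
  assumes "graded V G" "x \<in> carr V" and f: "\<And>i. f i \<in> G i"
    and F: "finite F" "\<And>i. i \<notin> F \<Longrightarrow> f i = 0" and x: "x = (\<Sum>i\<in>F. f i)"
  shows "hom_comp G i x = f i"
proof -
  let ?P = "\<lambda>f. (\<forall>i. f i \<in> G i) \<and> finite {i. f i \<noteq> 0} \<and> x = (\<Sum>i | f i \<noteq> 0. f i)"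
  have "{i. f i \<noteq> 0} \<subseteq> F" using F(2) by blast
  moreover from this have "(\<Sum>i | f i \<noteq> 0. f i) = (\<Sum>i\<in>F. f i)"
    by (intro sum.mono_neutral_left) (auto simp: F(1))
  ultimately have "?P f" using f F(1) x by (auto intro: finite_subset)
  then have "(THE f. ?P f) = f"
    by (rule the1_equality[OF graded_decomposition[OF assms(1,2)]])
  then show ?thesis by (simp add: hom_comp_def)
qed

lemma sum_hom_comp_superset:
  assumes "graded V G" "x \<in> carr V" "finite F" "\<And>i. hom_comp G i x \<noteq> 0 \<Longrightarrow> i \<in> F"
  shows "(\<Sum>i\<in>F. hom_comp G i x) = x"
proof -
  have "(\<Sum>i\<in>F. hom_comp G i x) = (\<Sum>i | hom_comp G i x \<noteq> 0. hom_comp G i x)"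
    by (rule sum.mono_neutral_right) (use assms(3,4) in auto)
  then show ?thesis using sum_hom_comp[OF assms(1,2)] by simp
qed

lemma hom_comp_homogeneous:
  assumes "graded V G" "x \<in> G i"
  shows "hom_comp G j x = (if j = i then x else 0)"
  by (rule hom_comp_eqI[OF assms(1), where F = "{i}"])
    (use assms graded_subset graded_zero[OF assms(1)] in auto)

lemma linear_map_hom_comp:
  assumes gr: "graded V G"
  shows "linear_map V V (hom_comp G i)"
proof (rule linear_mapI)
  interpret vector_space "smul V" using graded_vspace[OF gr] by (rule vspace_vector_space)
  note V = graded_vspace[OF gr]
  fix x assume x: "x \<in> carr V"
  show "hom_comp G i x \<in> carr V" using graded_subset[OF gr hom_comp_mem[OF gr x]] .
  have "smul V c x = (\<Sum>j | hom_comp G j x \<noteq> 0. smul V c (hom_comp G j x))" for c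
    by (simp add: scale_sum_right[symmetric] sum_hom_comp[OF gr x])
  then show "hom_comp G i (smul V c x) = smul V c (hom_comp G i x)" for c
    by (intro hom_comp_eqI[OF gr vspace_scale[OF V x], where F = "{j. hom_comp G j x \<noteq> 0}"])
      (auto simp: finite_hom_comp[OF gr x] graded_scale[OF gr] hom_comp_mem[OF gr x])
  fix y assume y: "y \<in> carr V"
  let ?F = "{j. hom_comp G j x \<noteq> 0} \<union> {j. hom_comp G j y \<noteq> 0}"
  have F: "finite ?F" using finite_hom_comp[OF gr] x y by simp
  have "x + y = (\<Sum>j\<in>?F. hom_comp G j x + hom_comp G j y)"
    using sum_hom_comp_superset[OF gr x F] sum_hom_comp_superset[OF gr y F]
    by (simp add: sum.distrib)
  then show "hom_comp G i (x + y) = hom_comp G i x + hom_comp G i y"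
    by (intro hom_comp_eqI[OF gr vspace_add[OF V x y] _ F])
      (auto simp: graded_add[OF gr] hom_comp_mem[OF gr] x y)
qed

lemma hom_comp_carr: "graded V G \<Longrightarrow> x \<in> carr V \<Longrightarrow> hom_comp G i x \<in> carr V"
  by (rule linear_map_mem[OF linear_map_hom_comp])

lemma hom_comp_hom_comp:
  "graded V G \<Longrightarrow> x \<in> carr V \<Longrightarrow> hom_comp G i (hom_comp G j x) = (if i = j then hom_comp G j x else 0)"
  by (simp add: hom_comp_homogeneous[OF _ hom_comp_mem])

section \<open>Subspaces of tensors, tensor products of maps, formal sums\<close>

lemma sub_tensor_vspace:
  fixes V :: "('k::field, 'v::ab_group_add) vspace" and W :: "('k, 'w::ab_group_add) vspace"
  shows "is_vspace \<lparr>carr = sub_tensor V W S T, smul = fun_scale\<rparr>"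
proof -
  interpret T: vector_space "fun_scale :: 'k \<Rightarrow> (('v \<Rightarrow> 'w \<Rightarrow> 'k) \<Rightarrow> 'k) \<Rightarrow> _"
    by (rule vector_space_fun_scale)
  show ?thesis by (simp add: is_vspace_def sub_tensor_def T.vector_space_axioms)
qed

lemma sub_tensor_mono:
  fixes V :: "('k::field, 'v::ab_group_add) vspace" and W :: "('k, 'w::ab_group_add) vspace"
  assumes "S \<subseteq> S'" "T \<subseteq> T'"
  shows "sub_tensor V W S T \<subseteq> sub_tensor V W S' T'"
proof -
  interpret T: vector_space "fun_scale :: 'k \<Rightarrow> (('v \<Rightarrow> 'w \<Rightarrow> 'k) \<Rightarrow> 'k) \<Rightarrow> _"
    by (rule vector_space_fun_scale)
  show ?thesis unfolding sub_tensor_def by (rule T.span_mono) (use assms in blast)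
qed

lemma tensor_mem_sub_tensor:
  fixes V :: "('k::field, 'v::ab_group_add) vspace" and W :: "('k, 'w::ab_group_add) vspace"
  assumes "v \<in> S" "w \<in> T"
  shows "tensor V W v w \<in> sub_tensor V W S T"
proof -
  interpret T: vector_space "fun_scale :: 'k \<Rightarrow> (('v \<Rightarrow> 'w \<Rightarrow> 'k) \<Rightarrow> 'k) \<Rightarrow> _"
    by (rule vector_space_fun_scale)
  show ?thesis using assms by (auto simp: sub_tensor_def intro: T.span_base)
qed

lemma sub_tensor_induct [consumes 5, case_names tensor add]:
  fixes V :: "('k::field, 'v::ab_group_add) vspace" and W :: "('k, 'w::ab_group_add) vspace"
  assumes t: "t \<in> sub_tensor V W S T"
    and S: "is_vspace \<lparr>carr = S, smul = smul V\<rparr>" and T0: "0 \<in> T"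
    and SV: "S \<subseteq> carr V" and TW: "T \<subseteq> carr W"
    and tensor: "\<And>v w. v \<in> S \<Longrightarrow> w \<in> T \<Longrightarrow> P (tensor V W v w)"
    and add: "\<And>t u. t \<in> sub_tensor V W S T \<Longrightarrow> u \<in> sub_tensor V W S T \<Longrightarrow> P t \<Longrightarrow> P u \<Longrightarrow> P (t + u)"
  shows "P t"
proof -
  interpret K: vector_space "fun_scale :: 'k \<Rightarrow> (('v \<Rightarrow> 'w \<Rightarrow> 'k) \<Rightarrow> 'k) \<Rightarrow> _"
    by (rule vector_space_fun_scale)
  have scale: "smul V c v \<in> S" if "v \<in> S" for c v
    using vspace_scale[OF S, of v c] that by simp
  have S0: "0 \<in> S" using vspace_zero[OF S] by simp
  have "tensor V W 0 0 = 0"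
    using tensor_add_left[of 0 V 0 0 W] S0 T0 SV TW by auto
  then have zero: "P 0" using tensor[OF S0 T0] by simp
  have "t \<in> sub_tensor V W S T \<and> P t"
    using t[unfolded sub_tensor_def]
  proof (induct rule: K.span_induct_alt)
    case base
    have "0 \<in> sub_tensor V W S T \<and> P 0"
      using zero by (simp add: sub_tensor_def K.span_zero)
    then show ?case .
  next
    case (step c x y)
    then obtain v w where vw: "v \<in> S" "w \<in> T" "x = tensor V W v w" by blast
    then have cx: "fun_scale c x = tensor V W (smul V c v) w"
      using tensor_scale_left[OF subsetD[OF SV] subsetD[OF TW], of v w c] by simp
    have mem: "fun_scale c x \<in> sub_tensor V W S T"
      unfolding cx using vw scale by (simp add: tensor_mem_sub_tensor)
    have "P (fun_scale c x)" unfolding cx using vw scale tensor by blast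
    then have "P (fun_scale c x + y)" using add[OF mem] step by blast
    moreover have "fun_scale c x + y \<in> sub_tensor V W S T"
      using mem step K.span_add unfolding sub_tensor_def by blast
    ultimately show ?case by (rule conjI[rotated])
  qed
  then show ?thesis ..
qed

lemma tensor_map_mem_sub_tensor:
  assumes V: "is_vspace V" and W: "is_vspace W"
    and f: "linear_map V X f" and g: "linear_map W Y g"
    and fS: "\<And>v. v \<in> carr V \<Longrightarrow> f v \<in> S" and gT: "\<And>w. w \<in> carr W \<Longrightarrow> g w \<in> T"
    and t: "t \<in> carr (tensor_space V W)"
  shows "tensor_map V W X Y f g t \<in> sub_tensor X Y S T"
proof -
  let ?S = "\<lparr>carr = sub_tensor X Y S T, smul = fun_scale\<rparr>"
  have "bilinear_map V W (tensor_space X Y) (\<lambda>v w. tensor X Y (f v) (g w))"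
    by (rule bilinear_map_precompose[OF bilinear_map_tensor f g])
  then have "bilinear_map V W ?S (\<lambda>v w. tensor X Y (f v) (g w))"
    by (auto simp: bilinear_map_def linear_map_def tensor_mem_sub_tensor fS gT)
  from linear_map_mem[OF tensor_lift_linear[OF V W sub_tensor_vspace this] t]
  show ?thesis by (simp add: tensor_map_def)
qed

lemma tensor_map_apply:
  assumes "is_vspace V" "is_vspace W" "linear_map V X f" "linear_map W Y g" "t \<in> carr (tensor_space V W)"
  shows "tensor_map V W X Y f g t \<beta> = t (\<lambda>v w. tensor X Y (f v) (g w) \<beta>)"
  unfolding tensor_map_def
  by (rule tensor_lift_apply[OF assms(1,2) tensor_vspace smul_tensor_space
        bilinear_map_precompose[OF bilinear_map_tensor assms(3,4)] assms(5)])

lemma tensor_map_tensor: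
  assumes "linear_map V X f" "linear_map W Y g" "v \<in> carr V" "w \<in> carr W"
  shows "tensor_map V W X Y f g (tensor V W v w) = tensor X Y (f v) (g w)"
  unfolding tensor_map_def
  by (rule tensor_lift_tensor[OF tensor_vspace
        bilinear_map_precompose[OF bilinear_map_tensor assms(1,2)] assms(3,4)])

lemma linear_map_tensor_map:
  assumes "is_vspace V" "is_vspace W" "linear_map V X f" "linear_map W Y g"
  shows "linear_map (tensor_space V W) (tensor_space X Y) (tensor_map V W X Y f g)"
  unfolding tensor_map_def
  by (rule tensor_lift_linear[OF assms(1,2) tensor_vspace
        bilinear_map_precompose[OF bilinear_map_tensor assms(3,4)]])

lemma sum_fun_apply: "(\<Sum>i\<in>I. g i) \<beta> = (\<Sum>i\<in>I. g i \<beta>)"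
  by (induct I rule: infinite_finite_induct) auto

lemma formal_sum_eq_sum:
  assumes "finite F" "F \<subseteq> I" "\<And>q. q \<in> I - F \<Longrightarrow> cmp d (t q) = 0"
  shows "formal_sum cmp I t d = (\<Sum>q\<in>F. cmp d (t q))"
  unfolding formal_sum_def
  by (rule sum.mono_neutral_left) (use assms in auto)

lemma finite_formal_sum_terms:
  assumes "finite F" "\<And>q. q \<in> I - F \<Longrightarrow> cmp d (t q) = 0"
  shows "finite {q \<in> I. cmp d (t q) \<noteq> 0}"
  by (rule finite_subset[OF _ assms(1)]) (use assms in auto)

lemma tensor3_mem:
  "x \<in> carr V \<Longrightarrow> y \<in> carr V \<Longrightarrow> z \<in> carr V \<Longrightarrow>
   tensor3 V x y z \<in> carr (tensor_space (tensor_space V V) V)"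
  by (simp add: tensor3_def tensor_mem)

lemma tensor3_add:
  assumes "x \<in> carr V" "x' \<in> carr V" "y \<in> carr V" "y' \<in> carr V" "z \<in> carr V" "z' \<in> carr V"
  shows "tensor3 V (x + x') y z = tensor3 V x y z + tensor3 V x' y z"
    and "tensor3 V x (y + y') z = tensor3 V x y z + tensor3 V x y' z"
    and "tensor3 V x y (z + z') = tensor3 V x y z + tensor3 V x y z'"
  using assms by (simp_all add: tensor3_def tensor_add_left tensor_add_right tensor_mem)

lemma tensor3_scale:
  assumes "x \<in> carr V" "y \<in> carr V" "z \<in> carr V"
  shows "tensor3 V (smul V c x) y z = fun_scale c (tensor3 V x y z)"
    and "tensor3 V x (smul V c y) z = fun_scale c (tensor3 V x y z)"
    and "tensor3 V x y (smul V c z) = fun_scale c (tensor3 V x y z)"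
  using assms tensor_scale_left[where V = "tensor_space V V" and W = V]
  by (simp_all add: tensor3_def tensor_scale_left tensor_scale_right tensor_mem)

section \<open>Nondegenerate skew forms\<close>

text \<open>The evaluation points for tensors: the functionals \<open>\<omega>(\<cdot>, y) \<otimes> \<omega>(\<cdot>, z)\<close> and
  \<open>\<omega>(\<cdot>, x) \<otimes> \<omega>(\<cdot>, y) \<otimes> \<omega>(\<cdot>, z)\<close>.\<close>

definition pair2 :: "('v \<Rightarrow> 'v \<Rightarrow> 'k) \<Rightarrow> 'v \<Rightarrow> 'v \<Rightarrow> 'v \<Rightarrow> 'v \<Rightarrow> 'k::field" where
  "pair2 \<omega> y z = (\<lambda>u v. \<omega> u y * \<omega> v z)"

definition pair3 ::
  "('v \<Rightarrow> 'v \<Rightarrow> 'k) \<Rightarrow> 'v \<Rightarrow> 'v \<Rightarrow> 'v \<Rightarrow> ('k, 'v) tens2 \<Rightarrow> 'v \<Rightarrow> 'k::field" where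
  "pair3 \<omega> x y z = (\<lambda>t w. t (pair2 \<omega> x y) * \<omega> w z)"

locale skew_form =
  fixes V :: "('k::field, 'v::ab_group_add) vspace" and \<omega> :: "'v \<Rightarrow> 'v \<Rightarrow> 'k"
  assumes vspace: "is_vspace V"
    and bilinear: "bilinear_map V V ground \<omega>"
    and skew: "x \<in> carr V \<Longrightarrow> y \<in> carr V \<Longrightarrow> \<omega> x y = - \<omega> y x"
    and nondegenerate: "x \<in> carr V \<Longrightarrow> (\<And>y. y \<in> carr V \<Longrightarrow> \<omega> x y = 0) \<Longrightarrow> x = 0"
begin

lemmas closed [simp] =
  vspace_zero[OF vspace] vspace_add[OF vspace] vspace_scale[OF vspace] vspace_neg[OF vspace] vspace_diff[OF vspace]

lemma form_add_left: "x \<in> carr V \<Longrightarrow> x' \<in> carr V \<Longrightarrow> y \<in> carr V \<Longrightarrow> \<omega> (x + x') y = \<omega> x y + \<omega> x' y"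
  and form_add_right: "x \<in> carr V \<Longrightarrow> y \<in> carr V \<Longrightarrow> y' \<in> carr V \<Longrightarrow> \<omega> x (y + y') = \<omega> x y + \<omega> x y'"
  and form_scale_left: "x \<in> carr V \<Longrightarrow> y \<in> carr V \<Longrightarrow> \<omega> (smul V c x) y = c * \<omega> x y"
  and form_scale_right: "x \<in> carr V \<Longrightarrow> y \<in> carr V \<Longrightarrow> \<omega> x (smul V c y) = c * \<omega> x y"
  using bilinear by (simp_all add: bilinear_map_def linear_map_def)

lemma linear_form_left: "y \<in> carr V \<Longrightarrow> linear_map V ground (\<lambda>x. \<omega> x y)"
  and linear_form_right: "x \<in> carr V \<Longrightarrow> linear_map V ground (\<omega> x)"
  using bilinear by (simp_all add: bilinear_map_def)

lemma form_zero_left: "y \<in> carr V \<Longrightarrow> \<omega> 0 y = 0"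
  and form_zero_right: "y \<in> carr V \<Longrightarrow> \<omega> y 0 = 0"
  and form_neg_left: "x \<in> carr V \<Longrightarrow> y \<in> carr V \<Longrightarrow> \<omega> (- x) y = - \<omega> x y"
  and form_neg_right: "x \<in> carr V \<Longrightarrow> y \<in> carr V \<Longrightarrow> \<omega> x (- y) = - \<omega> x y"
  using linear_map_zero[OF vspace linear_form_left] linear_map_zero[OF vspace linear_form_right]
    linear_map_neg[OF vspace linear_form_left] linear_map_neg[OF vspace linear_form_right] by auto

lemma form_diff_left: "x \<in> carr V \<Longrightarrow> x' \<in> carr V \<Longrightarrow> y \<in> carr V \<Longrightarrow> \<omega> (x - x') y = \<omega> x y - \<omega> x' y"
  and form_diff_right: "x \<in> carr V \<Longrightarrow> y \<in> carr V \<Longrightarrow> y' \<in> carr V \<Longrightarrow> \<omega> x (y - y') = \<omega> x y - \<omega> x y'"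
  using linear_map_diff[OF vspace linear_form_left] linear_map_diff[OF vspace linear_form_right] by auto

lemmas form_simps = form_add_left form_add_right form_scale_left form_scale_right form_zero_left
  form_zero_right form_neg_left form_neg_right form_diff_left form_diff_right

abbreviation "V2 \<equiv> tensor_space V V"
abbreviation "V3 \<equiv> tensor_space V2 V"

lemma eq_if_form_eq:
  assumes "x \<in> carr V" "x' \<in> carr V" "\<And>y. y \<in> carr V \<Longrightarrow> \<omega> x y = \<omega> x' y"
  shows "x = x'"
  using nondegenerate[of "x - x'"] assms by (simp add: form_simps)

lemma bilinear_pair2: "y \<in> carr V \<Longrightarrow> z \<in> carr V \<Longrightarrow> bilinear_map V V ground (pair2 \<omega> y z)"
  unfolding pair2_def by (intro bilinear_map_mult linear_form_left)

lemma tensor_pair2: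
  "y \<in> carr V \<Longrightarrow> z \<in> carr V \<Longrightarrow> tensor V V u v (pair2 \<omega> y z) = \<omega> u y * \<omega> v z"
  using tensor_apply[OF bilinear_pair2] by (simp add: pair2_def)

lemma bilinear_pair3:
  "z \<in> carr V \<Longrightarrow> bilinear_map V2 V ground (pair3 \<omega> x y z)"
  unfolding pair3_def by (intro bilinear_map_mult linear_form_left linear_map_apply_tensor)

lemma tensor_pair3:
  "z \<in> carr V \<Longrightarrow>
   tensor V2 V t w (pair3 \<omega> x y z) = t (pair2 \<omega> x y) * \<omega> w z"
  using tensor_apply[OF bilinear_pair3] by (simp add: pair3_def)

lemma tensor3_pair3:
  "x \<in> carr V \<Longrightarrow> y \<in> carr V \<Longrightarrow> z \<in> carr V \<Longrightarrow>
   tensor3 V u v w (pair3 \<omega> x y z) = \<omega> u x * \<omega> v y * \<omega> w z"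
  by (simp add: tensor3_def tensor_pair3 tensor_pair2)

lemma tensor2_zeroI:
  assumes "t \<in> carr V2"
    and "\<And>y z. y \<in> carr V \<Longrightarrow> z \<in> carr V \<Longrightarrow> t (pair2 \<omega> y z) = 0"
  shows "t = 0"
proof -
  let ?F = "{\<lambda>x. \<omega> x y | y. y \<in> carr V}"
  have lin: "linear_map V ground \<phi>" if "\<phi> \<in> ?F" for \<phi>
    using that linear_form_left by blast
  have sep: "v = 0" if "v \<in> carr V" "\<And>\<phi>. \<phi> \<in> ?F \<Longrightarrow> \<phi> v = 0" for v
    by (rule nondegenerate) (use that in auto)
  show ?thesis
    by (rule tensor_separated[OF vspace vspace assms(1), of ?F ?F])
      (use assms(2) lin sep in \<open>auto simp: pair2_def\<close>)
qed

lemma tensor2_eqI: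
  assumes "t \<in> carr V2" "u \<in> carr V2"
    and "\<And>y z. y \<in> carr V \<Longrightarrow> z \<in> carr V \<Longrightarrow> t (pair2 \<omega> y z) = u (pair2 \<omega> y z)"
  shows "t = u"
  using tensor2_zeroI[of "t - u"] assms vspace_diff[OF tensor_vspace assms(1,2)] by simp

lemma tensor3_zeroI:
  assumes t: "t \<in> carr V3"
    and 0: "\<And>x y z. x \<in> carr V \<Longrightarrow> y \<in> carr V \<Longrightarrow> z \<in> carr V \<Longrightarrow> t (pair3 \<omega> x y z) = 0"
  shows "t = 0"
proof (rule tensor_separated[OF tensor_vspace vspace t])
  show "linear_map V2 ground \<phi>"
    if "\<phi> \<in> {\<lambda>t. t (pair2 \<omega> x y) | x y. x \<in> carr V \<and> y \<in> carr V}" for \<phi>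
    using that linear_map_apply_tensor by blast
  show "linear_map V ground \<phi>" if "\<phi> \<in> {\<lambda>x. \<omega> x y | y. y \<in> carr V}" for \<phi>
    using that linear_form_left by blast
  show "v = 0" if "v \<in> carr V" "\<And>\<phi>. \<phi> \<in> {\<lambda>x. \<omega> x y | y. y \<in> carr V} \<Longrightarrow> \<phi> v = 0" for v
    by (rule nondegenerate) (use that in auto)
  show "v = 0" if "v \<in> carr V2"
    "\<And>\<phi>. \<phi> \<in> {\<lambda>t. t (pair2 \<omega> x y) | x y. x \<in> carr V \<and> y \<in> carr V} \<Longrightarrow> \<phi> v = 0" for v
    by (rule tensor2_zeroI) (use that in auto)
qed (use 0 in \<open>auto simp: pair3_def\<close>)

lemma bilinear_flip: "bilinear_map V V V2 (\<lambda>x y. tensor V V y x)"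
  using bilinear_map_tensor[of V V] by (simp add: bilinear_map_def)

lemma linear_map_flip: "linear_map V2 V2 (flip V)"
  unfolding flip_def by (rule tensor_lift_linear[OF vspace vspace tensor_vspace bilinear_flip])

lemma flip_tensor: "x \<in> carr V \<Longrightarrow> y \<in> carr V \<Longrightarrow> flip V (tensor V V x y) = tensor V V y x"
  unfolding flip_def by (rule tensor_lift_tensor[OF tensor_vspace bilinear_flip])

lemma flip_apply:
  assumes "t \<in> carr V2" "y \<in> carr V" "z \<in> carr V"
  shows "flip V t (pair2 \<omega> y z) = t (pair2 \<omega> z y)"
  unfolding flip_def
    tensor_lift_apply[OF vspace vspace tensor_vspace smul_tensor_space bilinear_flip assms(1)]
  by (rule tensor_apply_cong[OF vspace vspace assms(1)])
    (simp add: tensor_pair2 assms, simp add: pair2_def)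

text \<open>If contracting the second leg of \<open>t\<close> against \<open>z\<close> gives a vector that is known through \<open>\<omega>\<close>, then by
  nondegeneracy it is known altogether, and any functional on the first leg can be evaluated.\<close>

lemma contract_right:
  assumes t: "t \<in> carr V2" and \<phi>: "linear_map V ground \<phi>"
    and z: "z \<in> carr V" and w: "w \<in> carr V"
    and eq: "\<And>y. y \<in> carr V \<Longrightarrow> t (pair2 \<omega> y z) = \<omega> w y"
  shows "t (\<lambda>u v. \<phi> u * \<omega> v z) = \<phi> w"
proof -
  note b = bilinear_map_scale_vector(2)[OF vspace linear_form_left[OF z]]
  let ?w = "tensor_lift V V (\<lambda>u v. smul V (\<omega> v z) u) t"
  have ev: "\<psi> ?w = t (\<lambda>u v. \<psi> u * \<omega> v z)" if "linear_map V ground \<psi>" for \<psi>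
    unfolding functional_tensor_lift[OF vspace vspace vspace b that t]
    by (rule tensor_apply_cong[OF vspace vspace t]) (simp add: linear_map_scale[OF that])
  have "?w = w"
    by (rule eq_if_form_eq[OF linear_map_mem[OF tensor_lift_linear[OF vspace vspace vspace b] t] w])
      (simp add: ev[OF linear_form_left] eq[unfolded pair2_def])
  then show ?thesis using ev[OF \<phi>] by simp
qed

lemma contract_left:
  assumes t: "t \<in> carr V2" and \<phi>: "linear_map V ground \<phi>"
    and y: "y \<in> carr V" and w: "w \<in> carr V"
    and eq: "\<And>z. z \<in> carr V \<Longrightarrow> t (pair2 \<omega> y z) = \<omega> w z"
  shows "t (\<lambda>u v. \<omega> u y * \<phi> v) = \<phi> w"
proof -
  note b = bilinear_map_scale_vector(1)[OF vspace linear_form_left[OF y]]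
  let ?w = "tensor_lift V V (\<lambda>u v. smul V (\<omega> u y) v) t"
  have ev: "\<psi> ?w = t (\<lambda>u v. \<omega> u y * \<psi> v)" if "linear_map V ground \<psi>" for \<psi>
    unfolding functional_tensor_lift[OF vspace vspace vspace b that t]
    by (rule tensor_apply_cong[OF vspace vspace t]) (simp add: linear_map_scale[OF that])
  have "?w = w"
    by (rule eq_if_form_eq[OF linear_map_mem[OF tensor_lift_linear[OF vspace vspace vspace b] t] w])
      (simp add: ev[OF linear_form_left] eq[unfolded pair2_def])
  then show ?thesis using ev[OF \<phi>] by simp
qed

end

section \<open>Graded skew forms and completed tensors\<close>

locale graded_skew_form = skew_form V \<omega>
  for V :: "('k::field, 'v::ab_group_add) vspace" and \<omega> :: "'v \<Rightarrow> 'v \<Rightarrow> 'k" +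
  fixes G :: "int \<Rightarrow> 'v set" and m :: int
  assumes graded: "graded V G"
    and orthogonal: "i + j + m \<noteq> 0 \<Longrightarrow> x \<in> G i \<Longrightarrow> y \<in> G j \<Longrightarrow> \<omega> x y = 0"
begin

abbreviation hc :: "int \<Rightarrow> 'v \<Rightarrow> 'v" where
  "hc i \<equiv> hom_comp G i"

text \<open>The degree that \<open>\<omega>\<close> pairs with the degree \<open>i\<close>.\<close>

abbreviation codeg :: "int \<Rightarrow> int" where
  "codeg i \<equiv> - m - i"

lemma hc_carr [simp]: "x \<in> carr V \<Longrightarrow> hc i x \<in> carr V"
  using hom_comp_carr[OF graded] .

lemma hc_hc: "x \<in> carr V \<Longrightarrow> hc i (hc j x) = (if i = j then hc j x else 0)"
  using hom_comp_hom_comp[OF graded] .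

lemma form_expand_right:
  assumes "x \<in> carr V" "y \<in> carr V" "finite F" "\<And>i. hc i y \<noteq> 0 \<Longrightarrow> i \<in> F"
  shows "\<omega> x y = (\<Sum>i\<in>F. \<omega> x (hc i y))"
  using linear_map_sum[OF vspace linear_form_right[OF assms(1)], of F "\<lambda>i. hc i y"]
    sum_hom_comp_superset[OF graded assms(2-4)] assms(2) by simp

lemma form_hc_left:
  assumes x: "x \<in> carr V" and y: "y \<in> carr V"
  shows "\<omega> (hc i x) y = \<omega> (hc i x) (hc (codeg i) y)"
proof -
  let ?F = "insert (codeg i) {j. hc j y \<noteq> 0}"
  have "\<omega> (hc i x) y = (\<Sum>j\<in>?F. \<omega> (hc i x) (hc j y))"
    by (rule form_expand_right) (use x y finite_hom_comp[OF graded y] in auto)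
  also have "\<dots> = (\<Sum>j\<in>{codeg i}. \<omega> (hc i x) (hc j y))"
  proof (rule sum.mono_neutral_right)
    show "\<forall>j\<in>?F - {codeg i}. \<omega> (hc i x) (hc j y) = 0"
      by (auto intro!: orthogonal[OF _ hom_comp_mem[OF graded x] hom_comp_mem[OF graded y]])
  qed (use finite_hom_comp[OF graded y] in auto)
  finally show ?thesis by simp
qed

lemma form_hc_right:
  assumes x: "x \<in> carr V" and y: "y \<in> carr V"
  shows "\<omega> x (hc i y) = \<omega> (hc (codeg i) x) (hc i y)"
  using form_hc_left[OF y x, of i] skew[OF x, of "hc i y"] skew[of "hc i y" "hc (codeg i) x"] x y
  by simp

text \<open>The projections of a graded space onto its components are adjoint in pairs.\<close>

lemma form_hc:
  assumes "x \<in> carr V" "y \<in> carr V"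
  shows "\<omega> (hc i x) y = \<omega> x (hc (codeg i) y)"
  using form_hc_left[OF assms, of i] form_hc_right[OF assms, of "codeg i"] by simp

lemma sub_tensor_subset: "sub_tensor V V (G i) (G j) \<subseteq> carr V2"
  unfolding tensor_space_def using graded_subset[OF graded]
  by (simp add: sub_tensor_mono subsetI)

lemma linear_map_comp2: "linear_map V2 V2 (comp2 V G d)"
  by (cases d) (simp add: comp2_def linear_map_tensor_map vspace linear_map_hom_comp graded)

lemma comp2_mem:
  "t \<in> carr V2 \<Longrightarrow> comp2 V G (i, j) t \<in> sub_tensor V V (G i) (G j)"
  unfolding comp2_def prod.case
  by (rule tensor_map_mem_sub_tensor)
    (simp_all add: vspace linear_map_hom_comp graded hom_comp_mem[OF graded])

lemma comp2_carr:
  "t \<in> carr V2 \<Longrightarrow> comp2 V G d t \<in> carr V2"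
  using linear_map_mem[OF linear_map_comp2] .

lemma comp2_apply:
  assumes "t \<in> carr V2" "y \<in> carr V" "z \<in> carr V"
  shows "comp2 V G (i, j) t (pair2 \<omega> y z) = t (pair2 \<omega> (hc (codeg i) y) (hc (codeg j) z))"
proof -
  note l = linear_map_hom_comp[OF graded]
  show ?thesis
    unfolding comp2_def prod.case tensor_map_apply[OF vspace vspace l l assms(1)]
    by (rule tensor_apply_cong[OF vspace vspace assms(1)])
      (simp add: tensor_pair2 assms, simp add: pair2_def form_hc assms)
qed

lemma comp3_carr:
  assumes "t \<in> carr V3"
  shows "comp3 V G (i, j, k) t \<in> carr V3"
  unfolding comp3_def prod.case
  by (rule linear_map_mem[OF linear_map_tensor_map[OF tensor_vspace vspace linear_map_comp2
        linear_map_hom_comp[OF graded]] assms])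

lemma comp3_apply:
  assumes t: "t \<in> carr V3"
    and x: "x \<in> carr V" "y \<in> carr V" "z \<in> carr V"
  shows "comp3 V G (i, j, k) t (pair3 \<omega> x y z) =
    t (pair3 \<omega> (hc (codeg i) x) (hc (codeg j) y) (hc (codeg k) z))"
  unfolding comp3_def prod.case
    tensor_map_apply[OF tensor_vspace vspace linear_map_comp2 linear_map_hom_comp[OF graded] t]
  by (rule tensor_apply_cong[OF tensor_vspace vspace t])
    (simp add: tensor_pair3 x, simp add: pair3_def form_hc x comp2_apply)

text \<open>The formal sums of the Yang-Baxter and co-Jacobi expressions run over pairs of bidegrees, but
  on arguments of fixed degrees all terms but one vanish; this gives local finiteness and the
  value of the sum at once.\<close>

lemma comp3_single_term:
  assumes t: "\<And>q. t q \<in> carr V3"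
    and 0: "\<And>q x y z. q \<noteq> p \<Longrightarrow> x \<in> carr V \<Longrightarrow> y \<in> carr V \<Longrightarrow> z \<in> carr V \<Longrightarrow>
      t q (pair3 \<omega> (hc (codeg i) x) (hc (codeg j) y) (hc (codeg k) z)) = 0"
  shows "finite {q \<in> UNIV. comp3 V G (i, j, k) (t q) \<noteq> 0}"
    and "formal_sum (comp3 V G) UNIV t (i, j, k) = comp3 V G (i, j, k) (t p)"
proof -
  have *: "comp3 V G (i, j, k) (t q) = 0" if "q \<in> UNIV - {p}" for q
    by (rule tensor3_zeroI[OF comp3_carr[OF t]]) (use that 0 in \<open>simp add: comp3_apply t\<close>)
  show "finite {q \<in> UNIV. comp3 V G (i, j, k) (t q) \<noteq> 0}"
    by (rule finite_formal_sum_terms[where F = "{p}"]) (use * in auto)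
  show "formal_sum (comp3 V G) UNIV t (i, j, k) = comp3 V G (i, j, k) (t p)"
    by (subst formal_sum_eq_sum[where F = "{p}"]) (use * in auto)
qed

text \<open>A completed tensor is determined by the bilinear form that it induces through \<open>\<omega>\<close>. The component
  of bidegree \<open>(i, j)\<close> pairs with the complementary degrees, whence the projections.\<close>

definition represents :: "('k, 'v) ctens2 \<Rightarrow> ('v \<Rightarrow> 'v \<Rightarrow> 'k) \<Rightarrow> bool" where
  "represents \<sigma> f \<longleftrightarrow> \<sigma> \<in> ctensor2 V G \<and>
     (\<forall>i j. \<forall>y\<in>carr V. \<forall>z\<in>carr V.
        \<sigma> (i, j) (pair2 \<omega> y z) = f (hc (codeg i) y) (hc (codeg j) z))"

lemma represents_ctensor2: "represents \<sigma> f \<Longrightarrow> \<sigma> \<in> ctensor2 V G"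
  and represents_apply: "represents \<sigma> f \<Longrightarrow> y \<in> carr V \<Longrightarrow> z \<in> carr V \<Longrightarrow>
    \<sigma> (i, j) (pair2 \<omega> y z) = f (hc (codeg i) y) (hc (codeg j) z)"
  by (simp_all add: represents_def)

lemma ctensor2_carr: "\<sigma> \<in> ctensor2 V G \<Longrightarrow> \<sigma> d \<in> carr V2"
  using subsetD[OF sub_tensor_subset] by (cases d) (fastforce simp: ctensor2_def)

lemma represents_carr: "represents \<sigma> f \<Longrightarrow> \<sigma> d \<in> carr V2"
  using ctensor2_carr[OF represents_ctensor2] .

lemma represents_cong:
  "represents \<sigma> f \<Longrightarrow> (\<And>y z. y \<in> carr V \<Longrightarrow> z \<in> carr V \<Longrightarrow> f y z = g y z) \<Longrightarrow> represents \<sigma> g"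
  by (simp add: represents_def)

lemma represents_eqI:
  assumes "represents \<sigma> f" "represents \<tau> g"
    and "\<And>y z. y \<in> carr V \<Longrightarrow> z \<in> carr V \<Longrightarrow> f y z = g y z"
  shows "\<sigma> = \<tau>"
proof
  fix d :: "int \<times> int"
  obtain i j where d: "d = (i, j)" by (cases d)
  show "\<sigma> d = \<tau> d"
    by (rule tensor2_eqI)
      (use assms in \<open>auto simp: d represents_carr represents_apply\<close>)
qed

lemma ctensor2_add: "\<sigma> \<in> ctensor2 V G \<Longrightarrow> \<tau> \<in> ctensor2 V G \<Longrightarrow> \<sigma> + \<tau> \<in> ctensor2 V G"
  and ctensor2_diff: "\<sigma> \<in> ctensor2 V G \<Longrightarrow> \<tau> \<in> ctensor2 V G \<Longrightarrow> \<sigma> - \<tau> \<in> ctensor2 V G"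
  and ctensor2_neg: "\<sigma> \<in> ctensor2 V G \<Longrightarrow> - \<sigma> \<in> ctensor2 V G"
  and ctensor2_scale: "\<sigma> \<in> ctensor2 V G \<Longrightarrow> (\<lambda>d. fun_scale c (\<sigma> d)) \<in> ctensor2 V G"
  using vspace_add[OF sub_tensor_vspace] vspace_diff[OF sub_tensor_vspace]
    vspace_neg[OF sub_tensor_vspace] vspace_scale[OF sub_tensor_vspace]
  by (fastforce simp: ctensor2_def)+

lemma represents_add:
  "represents \<sigma> f \<Longrightarrow> represents \<tau> g \<Longrightarrow> represents (\<sigma> + \<tau>) (\<lambda>y z. f y z + g y z)"
  by (simp add: represents_def ctensor2_add)

lemma represents_diff:
  "represents \<sigma> f \<Longrightarrow> represents \<tau> g \<Longrightarrow> represents (\<sigma> - \<tau>) (\<lambda>y z. f y z - g y z)"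
  by (simp add: represents_def ctensor2_diff)

lemma represents_neg: "represents \<sigma> f \<Longrightarrow> represents (- \<sigma>) (\<lambda>y z. - f y z)"
  by (simp add: represents_def ctensor2_neg)

lemma represents_scale:
  "represents \<sigma> f \<Longrightarrow> represents (\<lambda>d. fun_scale c (\<sigma> d)) (\<lambda>y z. c * f y z)"
  by (simp add: represents_def ctensor2_scale) (simp add: fun_scale_def)

lemma flip_mem_sub_tensor:
  assumes "t \<in> sub_tensor V V (G i) (G j)"
  shows "flip V t \<in> sub_tensor V V (G j) (G i)"
proof -
  have sub: "G k \<subseteq> carr V" for k using graded_subset[OF graded] by blast
  note vs = sub_tensor_vspace[of V V "G j" "G i"]
  from assms graded_piece_vspace[OF graded] graded_zero[OF graded] sub sub
  show ?thesis
  proof (induct t rule: sub_tensor_induct)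
    case (tensor v w)
    then show ?case
      using graded_subset[OF graded] by (simp add: flip_tensor tensor_mem_sub_tensor)
  next
    case (add t u)
    then have "flip V (t + u) = flip V t + flip V u"
      using linear_map_add[OF linear_map_flip] subsetD[OF sub_tensor_subset] by blast
    then have "flip V (t + u) \<in> sub_tensor V V (G j) (G i)"
      using vspace_add[OF vs] add by simp
    then show ?case .
  qed
qed

lemma represents_cflip:
  assumes "represents \<sigma> f"
  shows "represents (cflip V \<sigma>) (\<lambda>y z. f z y)"
proof -
  have "\<sigma> (i, j) \<in> sub_tensor V V (G i) (G j)" for i j
    using represents_ctensor2[OF assms] by (simp add: ctensor2_def)
  then have "cflip V \<sigma> \<in> ctensor2 V G"
    by (simp add: ctensor2_def cflip_def flip_mem_sub_tensor)
  then show ?thesis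
    by (simp add: represents_def cflip_def flip_apply represents_carr[OF assms] represents_apply[OF assms])
qed

text \<open>Acting with \<open>A \<otimes> B\<close> amounts to acting with the adjoints \<open>A'\<close> and \<open>B'\<close> on the arguments. That the
  adjoints spread a homogeneous element over finitely many degrees, uniformly in the element, is what
  makes the completed action well defined.\<close>

lemma represents_cmap:
  assumes \<sigma>: "represents \<sigma> f" and f: "bilinear_map V V ground f"
    and A: "linear_map V V A" "linear_map V V A'"
      "\<And>u y. u \<in> carr V \<Longrightarrow> y \<in> carr V \<Longrightarrow> \<omega> (A u) y = \<omega> u (A' y)"
    and B: "linear_map V V B" "linear_map V V B'"
      "\<And>u y. u \<in> carr V \<Longrightarrow> y \<in> carr V \<Longrightarrow> \<omega> (B u) y = \<omega> u (B' y)"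
    and finA: "\<And>i. \<exists>D. finite D \<and> (\<forall>y\<in>carr V. \<forall>k. hc k (A' (hc i y)) \<noteq> 0 \<longrightarrow> k \<in> D)"
    and finB: "\<And>i. \<exists>D. finite D \<and> (\<forall>y\<in>carr V. \<forall>k. hc k (B' (hc i y)) \<noteq> 0 \<longrightarrow> k \<in> D)"
  shows "cmap_defined V G A B \<sigma>"
    and "represents (cmap V G A B \<sigma>) (\<lambda>y z. f (A' y) (B' z))"
proof -
  let ?t = "\<lambda>d. tensor_map V V V V A B (\<sigma> d)"
  have t: "?t d \<in> carr V2" for d
    using linear_map_mem[OF linear_map_tensor_map[OF vspace vspace A(1) B(1)] represents_carr[OF \<sigma>]] .
  have A': "A' y \<in> carr V" and B': "B' y \<in> carr V" if "y \<in> carr V" for y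
    using linear_map_mem[OF A(2) that] linear_map_mem[OF B(2) that] .
  have ev: "?t (i, j) (pair2 \<omega> y z) = f (hc (codeg i) (A' y)) (hc (codeg j) (B' z))"
    if "y \<in> carr V" "z \<in> carr V" for i j y z
  proof -
    have "?t (i, j) (pair2 \<omega> y z) = \<sigma> (i, j) (pair2 \<omega> (A' y) (B' z))"
      unfolding tensor_map_apply[OF vspace vspace A(1) B(1) represents_carr[OF \<sigma>]]
      by (rule tensor_apply_cong[OF vspace vspace represents_carr[OF \<sigma>]])
        (simp add: tensor_pair2 that, simp add: pair2_def A(3) B(3) that)
    then show ?thesis using represents_apply[OF \<sigma> A' B'] that by simp
  qed
  have key: "\<exists>F. finite F \<and> (\<forall>q. q \<notin> F \<longrightarrow> comp2 V G (i, j) (?t q) = 0) \<and>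
      (\<forall>y\<in>carr V. \<forall>z\<in>carr V. (\<Sum>q\<in>F. comp2 V G (i, j) (?t q) (pair2 \<omega> y z)) =
        f (A' (hc (codeg i) y)) (B' (hc (codeg j) z)))" for i j
  proof -
    obtain D where D: "finite D" "\<And>y k. y \<in> carr V \<Longrightarrow> hc k (A' (hc (codeg i) y)) \<noteq> 0 \<Longrightarrow> k \<in> D"
      using finA[of "codeg i"] by blast
    obtain E where E: "finite E" "\<And>y k. y \<in> carr V \<Longrightarrow> hc k (B' (hc (codeg j) y)) \<noteq> 0 \<Longrightarrow> k \<in> E"
      using finB[of "codeg j"] by blast
    let ?F = "codeg ` D \<times> codeg ` E"
    have ev': "comp2 V G (i, j) (?t (k, l)) (pair2 \<omega> y z) =
        f (hc (codeg k) (A' (hc (codeg i) y))) (hc (codeg l) (B' (hc (codeg j) z)))"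
      if "y \<in> carr V" "z \<in> carr V" for y z k l
      using that by (simp add: comp2_apply t ev)
    have "comp2 V G (i, j) (?t (k, l)) = 0" if "(k, l) \<notin> ?F" for k l
    proof (rule tensor2_zeroI[OF comp2_carr[OF t]])
      fix y z assume yz: "y \<in> carr V" "z \<in> carr V"
      have "codeg k \<notin> D \<or> codeg l \<notin> E"
      proof (rule ccontr)
        assume "\<not> ?thesis"
        then have "codeg (codeg k) \<in> codeg ` D" "codeg (codeg l) \<in> codeg ` E" by blast+
        then show False using that by simp
      qed
      then have "hc (codeg k) (A' (hc (codeg i) y)) = 0 \<or> hc (codeg l) (B' (hc (codeg j) z)) = 0"
        using D(2)[OF yz(1)] E(2)[OF yz(2)] by blast
      then show "comp2 V G (i, j) (?t (k, l)) (pair2 \<omega> y z) = 0"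
        using ev'[OF yz] linear_map_zero[OF vspace bilinear_map_left[OF f]]
          linear_map_zero[OF vspace bilinear_map_right[OF f]] yz A' B' by auto
    qed
    moreover have "(\<Sum>q\<in>?F. comp2 V G (i, j) (?t q) (pair2 \<omega> y z)) =
        f (A' (hc (codeg i) y)) (B' (hc (codeg j) z))" if yz: "y \<in> carr V" "z \<in> carr V" for y z
    proof -
      let ?a = "A' (hc (codeg i) y)" and ?b = "B' (hc (codeg j) z)"
      have ab: "?a \<in> carr V" "?b \<in> carr V" using yz A' B' by auto
      have "(\<Sum>q\<in>?F. comp2 V G (i, j) (?t q) (pair2 \<omega> y z)) =
          (\<Sum>k\<in>codeg ` D. \<Sum>l\<in>codeg ` E. f (hc (codeg k) ?a) (hc (codeg l) ?b))"
        unfolding sum.cartesian_product by (rule sum.cong) (auto simp: ev' yz)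
      also have "\<dots> = (\<Sum>k\<in>D. \<Sum>l\<in>E. f (hc k ?a) (hc l ?b))"
        by (subst sum.reindex, simp add: inj_on_def)+ simp
      also have "\<dots> = (\<Sum>k\<in>D. f (hc k ?a) (\<Sum>l\<in>E. hc l ?b))"
        using linear_map_sum[OF vspace bilinear_map_right[OF f], of _ E "\<lambda>l. hc l ?b"] ab by simp
      also have "(\<Sum>l\<in>E. hc l ?b) = ?b"
        by (rule sum_hom_comp_superset[OF graded ab(2) E(1) E(2)[OF yz(2)]])
      also have "(\<Sum>k\<in>D. f (hc k ?a) ?b) = f (\<Sum>k\<in>D. hc k ?a) ?b"
        using linear_map_sum[OF vspace bilinear_map_left[OF f ab(2)], of D "\<lambda>k. hc k ?a"] ab by simp
      also have "(\<Sum>k\<in>D. hc k ?a) = ?a"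
        by (rule sum_hom_comp_superset[OF graded ab(1) D(1) D(2)[OF yz(1)]])
      finally show ?thesis .
    qed
    ultimately show ?thesis
      using D(1) E(1) by (intro exI[of _ ?F]) auto
  qed
  show "cmap_defined V G A B \<sigma>"
    unfolding cmap_defined_def locally_finite_def
  proof
    fix d :: "int \<times> int"
    obtain i j where d: "d = (i, j)" by (cases d)
    show "finite {q \<in> UNIV. comp2 V G d (?t q) \<noteq> 0}"
      using key[of i j] unfolding d by (auto intro: finite_subset[rotated])
  qed
  show "represents (cmap V G A B \<sigma>) (\<lambda>y z. f (A' y) (B' z))"
    unfolding represents_def ctensor2_def
  proof (intro conjI CollectI allI ballI)
    fix i j
    obtain F where fin: "finite F" "\<And>q. q \<notin> F \<Longrightarrow> comp2 V G (i, j) (?t q) = 0"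
      and v: "\<forall>y\<in>carr V. \<forall>z\<in>carr V. (\<Sum>q\<in>F. comp2 V G (i, j) (?t q) (pair2 \<omega> y z)) =
        f (A' (hc (codeg i) y)) (B' (hc (codeg j) z))" using key[of i j] by blast
    have F: "cmap V G A B \<sigma> (i, j) = (\<Sum>q\<in>F. comp2 V G (i, j) (?t q))"
      unfolding cmap_def by (rule formal_sum_eq_sum) (use fin in auto)
    show "cmap V G A B \<sigma> (i, j) \<in> sub_tensor V V (G i) (G j)"
      unfolding F
      using vspace_sum[OF sub_tensor_vspace, of F "\<lambda>q. comp2 V G (i, j) (?t q)" V V "G i" "G j"]
        comp2_mem[OF t] by simp
    fix y z assume "y \<in> carr V" "z \<in> carr V"
    then show "cmap V G A B \<sigma> (i, j) (pair2 \<omega> y z) = f (A' (hc (codeg i) y)) (B' (hc (codeg j) z))"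
      using v by (simp add: F sum_fun_apply)
  qed
qed

end

section \<open>Graded quasi-Frobenius Lie algebras\<close>

text \<open>A graded Lie algebra with a nondegenerate \<open>2\<close>-cocycle; \<open>s\<close> is the inverse of the form.\<close>

locale quasi_frobenius = graded_skew_form V \<omega> G m
  for V :: "('k::field, 'v::ab_group_add) vspace" and \<omega> :: "'v \<Rightarrow> 'v \<Rightarrow> 'k"
    and G :: "int \<Rightarrow> 'v set" and m :: int +
  fixes br :: "'v \<Rightarrow> 'v \<Rightarrow> 'v" and s :: "('k, 'v) ctens2"
  assumes lie: "lie_algebra V br"
    and br_graded: "x \<in> G i \<Longrightarrow> y \<in> G j \<Longrightarrow> br x y \<in> G (i + j)"
    and cocycle: "x \<in> carr V \<Longrightarrow> y \<in> carr V \<Longrightarrow> z \<in> carr V \<Longrightarrow>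
      \<omega> (br x y) z + \<omega> (br y z) x + \<omega> (br z x) y = 0"
    and canonical: "represents s (\<lambda>y z. \<omega> z y)"
begin

lemma bilinear_br: "bilinear_map V V V br"
  using lie by (simp add: lie_algebra_def)

lemma br_carr [simp]: "x \<in> carr V \<Longrightarrow> y \<in> carr V \<Longrightarrow> br x y \<in> carr V"
  by (rule bilinear_map_mem[OF bilinear_br])

lemma br_add_left: "x \<in> carr V \<Longrightarrow> x' \<in> carr V \<Longrightarrow> y \<in> carr V \<Longrightarrow> br (x + x') y = br x y + br x' y"
  and br_add_right: "x \<in> carr V \<Longrightarrow> y \<in> carr V \<Longrightarrow> y' \<in> carr V \<Longrightarrow> br x (y + y') = br x y + br x y'"
  and br_scale_left: "x \<in> carr V \<Longrightarrow> y \<in> carr V \<Longrightarrow> br (smul V c x) y = smul V c (br x y)"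
  and br_scale_right: "x \<in> carr V \<Longrightarrow> y \<in> carr V \<Longrightarrow> br x (smul V c y) = smul V c (br x y)"
  using bilinear_br by (simp_all add: bilinear_map_def linear_map_def)

lemma linear_br_left: "y \<in> carr V \<Longrightarrow> linear_map V V (\<lambda>x. br x y)"
  and linear_br_right: "x \<in> carr V \<Longrightarrow> linear_map V V (br x)"
  using bilinear_br by (simp_all add: bilinear_map_def)

lemma br_self: "x \<in> carr V \<Longrightarrow> br x x = 0"
  and jacobi: "x \<in> carr V \<Longrightarrow> y \<in> carr V \<Longrightarrow> z \<in> carr V \<Longrightarrow>
    br x (br y z) + br y (br z x) + br z (br x y) = 0"
  using lie by (simp_all add: lie_algebra_def)

lemma br_skew:
  assumes "x \<in> carr V" "y \<in> carr V"
  shows "br x y = - br y x"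
proof -
  have "br (x + y) (x + y) = br x y + br y x"
    using assms by (simp add: br_add_left br_add_right br_self[OF assms(1)] br_self[OF assms(2)])
  moreover have "br (x + y) (x + y) = 0" by (rule br_self) (use assms in simp)
  ultimately have "br x y + br y x = 0" by simp
  then show ?thesis by (simp add: eq_neg_iff_add_eq_0)
qed

lemma br_br:
  assumes "x \<in> carr V" "y \<in> carr V" "z \<in> carr V"
  shows "br (br x y) z = br x (br y z) - br y (br x z)"
proof -
  have "br y (br z x) = - br y (br x z)"
    using br_skew[of z x] linear_map_neg[OF vspace linear_br_right, of y "br x z"] assms by simp
  moreover have "br z (br x y) = - br (br x y) z"
    using br_skew[of "br x y" z] assms by simp
  ultimately have "(br x (br y z) - br y (br x z)) - br (br x y) z = 0"
    using jacobi[OF assms] by simp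
  then show ?thesis by (metis right_minus_eq)
qed

lemma cocycle':
  assumes "x \<in> carr V" "y \<in> carr V" "z \<in> carr V"
  shows "\<omega> (br y z) x = \<omega> (br x z) y - \<omega> (br x y) z"
  using cocycle[OF assms] br_skew[of z x] assms by (simp add: form_simps algebra_simps)

lemma hc_br:
  assumes a: "a \<in> carr V" and x: "x \<in> carr V"
  shows "hc l (br a (hc p x)) = br (hc (l - p) a) (hc p x)"
proof -
  let ?F = "insert (l - p) {i. hc i a \<noteq> 0}"
  have F: "finite ?F" using finite_hom_comp[OF graded a] by simp
  have xp: "hc p x \<in> carr V" using x by simp
  have "br a (hc p x) = br (\<Sum>i\<in>?F. hc i a) (hc p x)"
    using sum_hom_comp_superset[OF graded a F] by simp
  also have "\<dots> = (\<Sum>i\<in>?F. br (hc i a) (hc p x))"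
    using linear_map_sum[OF vspace linear_br_left[OF xp], of ?F "\<lambda>i. hc i a"] a by simp
  finally have "hc l (br a (hc p x)) = hc l (\<Sum>i\<in>?F. br (hc i a) (hc p x))" by simp
  also have "\<dots> = (\<Sum>i\<in>?F. hc l (br (hc i a) (hc p x)))"
    using linear_map_sum[OF vspace linear_map_hom_comp[OF graded], of ?F "\<lambda>i. br (hc i a) (hc p x)" l] a x
    by simp
  also have "\<dots> = (\<Sum>i\<in>{l - p}. hc l (br (hc i a) (hc p x)))"
  proof (rule sum.mono_neutral_right)
    show "\<forall>i\<in>?F - {l - p}. hc l (br (hc i a) (hc p x)) = 0"
      using hom_comp_homogeneous[OF graded br_graded[OF hom_comp_mem[OF graded a] hom_comp_mem[OF graded x]]]
      by auto
  qed (use F in auto)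
  also have "\<dots> = br (hc (l - p) a) (hc p x)"
    using hom_comp_homogeneous[OF graded br_graded[OF hom_comp_mem[OF graded a] hom_comp_mem[OF graded x]],
        of l "l - p" p] by simp
  finally show ?thesis .
qed

lemma canonical_carr: "s d \<in> carr V2"
  by (rule represents_carr[OF canonical])

lemma canonical_apply:
  "y \<in> carr V \<Longrightarrow> z \<in> carr V \<Longrightarrow> s (i, j) (pair2 \<omega> y z) = \<omega> (hc (codeg j) z) (hc (codeg i) y)"
  by (rule represents_apply[OF canonical])

lemma canonical_contract_right:
  assumes \<phi>: "linear_map V ground \<phi>" and z: "z \<in> carr V"
  shows "s (i, j) (\<lambda>u v. \<phi> u * \<omega> v z) = \<phi> (hc i (hc (codeg j) z))"
  by (rule contract_right[OF canonical_carr \<phi> z])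
    (simp_all add: z canonical_apply form_hc[of "hc (codeg j) z"])

lemma canonical_contract_left:
  assumes \<phi>: "linear_map V ground \<phi>" and y: "y \<in> carr V"
  shows "s (i, j) (\<lambda>u v. \<omega> u y * \<phi> v) = - \<phi> (hc j (hc (codeg i) y))"
proof -
  have "s (i, j) (\<lambda>u v. \<omega> u y * \<phi> v) = \<phi> (- hc j (hc (codeg i) y))"
  proof (rule contract_left[OF canonical_carr \<phi> y])
    fix z assume z: "z \<in> carr V"
    show "s (i, j) (pair2 \<omega> y z) = \<omega> (- hc j (hc (codeg i) y)) z"
      using skew[of "hc (codeg j) z" "hc (codeg i) y"] y z
      by (simp add: canonical_apply form_hc[of "hc (codeg i) y"] form_simps)
  qed (use y in simp)
  then show ?thesis using linear_map_neg[OF vspace \<phi>] y by simp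
qed

lemma canonical_cflip: "cflip V s = - s"
  by (rule represents_eqI[OF represents_cflip[OF canonical] represents_neg[OF canonical]])
    (rule skew)

text \<open>Graded Riesz representation: contracting the components of \<open>s\<close> with \<open>\<psi>\<close> gives representing vectors
  degree by degree, and only finitely many degrees matter.\<close>

lemma riesz:
  assumes \<psi>: "linear_map V ground \<psi>"
    and F: "finite F" "\<And>i u. u \<in> carr V \<Longrightarrow> \<psi> (hc i u) \<noteq> 0 \<Longrightarrow> i \<in> F"
  shows "\<exists>w\<in>carr V. \<forall>u\<in>carr V. \<omega> u w = \<psi> u"
proof -
  let ?g = "\<lambda>u v. smul V (\<psi> v) u"
  note b = bilinear_map_scale_vector(2)[OF vspace \<psi>]
  let ?w = "\<lambda>j. tensor_lift V V ?g (s (codeg j, j))"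
  have w: "?w j \<in> carr V" for j
    using linear_map_mem[OF tensor_lift_linear[OF vspace vspace vspace b] canonical_carr] .
  have ev: "\<omega> u (?w j) = \<psi> (hc j u)" if u: "u \<in> carr V" for u j
  proof -
    have "\<omega> (?w j) u = s (codeg j, j) (\<lambda>v' v. \<omega> v' u * \<psi> v)"
      unfolding functional_tensor_lift[OF vspace vspace vspace b linear_form_left[OF u] canonical_carr]
      by (rule tensor_apply_cong[OF vspace vspace canonical_carr]) (simp add: form_simps u)
    also have "\<dots> = - \<psi> (hc j u)"
      using u by (simp add: canonical_contract_left[OF \<psi> u] hc_hc)
    finally show ?thesis using skew[OF u w[of j]] by simp
  qed
  have "\<omega> u (\<Sum>j\<in>F. ?w j) = \<psi> u" if u: "u \<in> carr V" for u
  proof -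
    let ?F = "F \<union> {i. hc i u \<noteq> 0}"
    have F': "finite ?F" using F(1) finite_hom_comp[OF graded u] by simp
    have "\<psi> u = (\<Sum>j\<in>?F. \<psi> (hc j u))"
      using linear_map_sum[OF vspace \<psi>, of ?F "\<lambda>j. hc j u"] sum_hom_comp_superset[OF graded u F'] u
      by simp
    also have "\<dots> = (\<Sum>j\<in>F. \<psi> (hc j u))"
      by (rule sum.mono_neutral_right) (use F' F(2)[OF u] in auto)
    also have "\<dots> = \<omega> u (\<Sum>j\<in>F. ?w j)"
      using linear_map_sum[OF vspace linear_form_right[OF u], of F ?w] w by (simp add: ev u)
    finally show ?thesis by simp
  qed
  then show ?thesis using vspace_sum[OF vspace, of F ?w] w by blast
qed

lemma ex_adjoint:
  assumes a: "a \<in> carr V" and y: "y \<in> carr V"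
  shows "\<exists>w\<in>carr V. \<forall>u\<in>carr V. \<omega> u w = \<omega> (br a u) y"
proof (rule riesz)
  show "linear_map V ground (\<lambda>u. \<omega> (br a u) y)"
    by (rule linear_map_comp[OF linear_br_right[OF a] linear_form_left[OF y]])
  let ?A = "{i. hc i a \<noteq> 0}" and ?Y = "{l. hc l y \<noteq> 0}"
  show "finite ((\<lambda>(k, l). codeg l - k) ` (?A \<times> ?Y))"
    using finite_hom_comp[OF graded] a y by simp
  fix i u assume u: "u \<in> carr V" and ne: "\<omega> (br a (hc i u)) y \<noteq> 0"
  have "\<omega> (br a (hc i u)) y = (\<Sum>l\<in>?Y. \<omega> (br a (hc i u)) (hc l y))"
    by (rule form_expand_right) (use finite_hom_comp[OF graded] a y u in auto)
  with ne have "(\<Sum>l\<in>?Y. \<omega> (br a (hc i u)) (hc l y)) \<noteq> 0" by simp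
  then obtain l where l: "hc l y \<noteq> 0" and "\<omega> (br a (hc i u)) (hc l y) \<noteq> 0"
    using sum.not_neutral_contains_not_neutral by blast
  moreover have "\<omega> (br a (hc i u)) (hc l y) = \<omega> (br (hc (codeg l - i) a) (hc i u)) y"
    using form_hc[of "br a (hc i u)" y "codeg l"] hc_br[OF a u] a u y by simp
  ultimately have "hc (codeg l - i) a \<noteq> 0"
    using linear_map_zero[OF vspace linear_br_left, of "hc i u"] u y by (auto simp: form_zero_left)
  then show "i \<in> (\<lambda>(k, l). codeg l - k) ` (?A \<times> ?Y)"
    using l by (intro image_eqI[of _ _ "(codeg l - i, l)"]) auto
qed

text \<open>Up to sign, \<open>adjoint a y\<close> is the left-symmetric product \<open>a \<cdot> y\<close> that every quasi-Frobenius Lie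
  algebra carries.\<close>

definition adjoint :: "'v \<Rightarrow> 'v \<Rightarrow> 'v" where
  "adjoint a y = (SOME w. w \<in> carr V \<and> (\<forall>u\<in>carr V. \<omega> u w = \<omega> (br a u) y))"

lemma adjoint_carr [simp]: "a \<in> carr V \<Longrightarrow> y \<in> carr V \<Longrightarrow> adjoint a y \<in> carr V"
  and form_adjoint: "a \<in> carr V \<Longrightarrow> y \<in> carr V \<Longrightarrow> u \<in> carr V \<Longrightarrow> \<omega> u (adjoint a y) = \<omega> (br a u) y"
  using someI_ex[OF ex_adjoint[of a y, unfolded Bex_def]] by (simp_all add: adjoint_def)

lemma eq_if_form_eq_right:
  assumes "x \<in> carr V" "x' \<in> carr V" "\<And>y. y \<in> carr V \<Longrightarrow> \<omega> y x = \<omega> y x'"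
  shows "x = x'"
proof (rule eq_if_form_eq[OF assms(1,2)])
  fix y assume y: "y \<in> carr V"
  show "\<omega> x y = \<omega> x' y"
    using skew[OF assms(1) y] skew[OF assms(2) y] assms(3)[OF y] by simp
qed

lemma linear_adjoint: "a \<in> carr V \<Longrightarrow> linear_map V V (adjoint a)"
  by (rule linear_mapI; (rule eq_if_form_eq_right)?) (auto simp: form_adjoint form_simps)

lemma adjoint_degrees:
  assumes a: "a \<in> carr V"
  shows "\<exists>D. finite D \<and> (\<forall>y\<in>carr V. \<forall>k. hc k (adjoint a (hc l y)) \<noteq> 0 \<longrightarrow> k \<in> D)"
proof (intro exI conjI ballI allI impI)
  let ?A = "{i. hc i a \<noteq> 0}"
  show "finite ((\<lambda>i. i + l) ` ?A)" using finite_hom_comp[OF graded a] by simp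
  fix y k assume y: "y \<in> carr V" and ne: "hc k (adjoint a (hc l y)) \<noteq> 0"
  obtain u where u: "u \<in> carr V" and "\<omega> u (hc k (adjoint a (hc l y))) \<noteq> 0"
    using ne eq_if_form_eq_right[of "hc k (adjoint a (hc l y))" 0] a y by (auto simp: form_simps)
  moreover have "\<omega> u (hc k (adjoint a (hc l y))) = \<omega> (br (hc (k - l) a) (hc (codeg k) u)) y"
    using form_hc[of u "adjoint a (hc l y)" "codeg k"] form_adjoint[of a "hc l y" "hc (codeg k) u"]
      form_hc[of "br a (hc (codeg k) u)" y "codeg l"] hc_br[OF a u, of "codeg l" "codeg k"] a y u
    by simp
  ultimately have "hc (k - l) a \<noteq> 0"
    using linear_map_zero[OF vspace linear_br_left, of "hc (codeg k) u"] y by (auto simp: form_zero_left)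
  then show "k \<in> (\<lambda>i. i + l) ` ?A" by (intro image_eqI[of _ _ "k - l"]) auto
qed

lemma represents_ad_hat:
  assumes \<sigma>: "represents \<sigma> f" and f: "bilinear_map V V ground f" and a: "a \<in> carr V"
  shows "ad_hat_defined V G br a \<sigma>"
    and "represents (ad_hat V G br a \<sigma>) (\<lambda>y z. f (adjoint a y) z + f y (adjoint a z))"
proof -
  have id_deg: "\<exists>D. finite D \<and> (\<forall>y\<in>carr V. \<forall>k. hc k (id (hc i y)) \<noteq> 0 \<longrightarrow> k \<in> D)" for i
    by (rule exI[of _ "{i}"]) (auto simp: hc_hc split: if_splits)
  have adj: "\<omega> (br a u) y = \<omega> u (adjoint a y)" if "u \<in> carr V" "y \<in> carr V" for u y
    using form_adjoint that a by simp
  note l = represents_cmap[OF \<sigma> f linear_br_right[OF a] linear_adjoint[OF a] adj linear_map_id(2)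
      linear_map_id(2) _ adjoint_degrees[OF a] id_deg]
  note r = represents_cmap[OF \<sigma> f linear_map_id(2) linear_map_id(2) _ linear_br_right[OF a]
      linear_adjoint[OF a] adj id_deg adjoint_degrees[OF a]]
  show "ad_hat_defined V G br a \<sigma>"
    unfolding ad_hat_defined_def using l(1) r(1) by simp
  have "represents (cmap V G (br a) id \<sigma>) (\<lambda>y z. f (adjoint a y) z)"
    "represents (cmap V G id (br a) \<sigma>) (\<lambda>y z. f y (adjoint a z))"
    using l(2) r(2) by simp_all
  then show "represents (ad_hat V G br a \<sigma>) (\<lambda>y z. f (adjoint a y) z + f y (adjoint a z))"
    unfolding ad_hat_def by (rule represents_add)
qed

definition cobracket :: "'v \<Rightarrow> ('k, 'v) ctens2" where
  "cobracket x = ad_hat V G br x s"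

lemma bilinear_opposite_form: "bilinear_map V V ground (\<lambda>y z. \<omega> z y)"
  using bilinear by (simp add: bilinear_map_def)

lemma cobracket_defined: "x \<in> carr V \<Longrightarrow> ad_hat_defined V G br x s"
  by (rule represents_ad_hat(1)[OF canonical bilinear_opposite_form])

text \<open>The two halves of \<open>ad\<^sub>x s\<close> pair to \<open>\<omega>([x, z], y)\<close> and \<open>- \<omega>([x, y], z)\<close>, which the
  cocycle identity adds up.\<close>

lemma represents_cobracket:
  assumes x: "x \<in> carr V"
  shows "represents (cobracket x) (\<lambda>y z. \<omega> (br y z) x)"
proof (rule represents_cong)
  show "represents (cobracket x) (\<lambda>y z. \<omega> z (adjoint x y) + \<omega> (adjoint x z) y)"
    unfolding cobracket_def by (rule represents_ad_hat(2)[OF canonical bilinear_opposite_form x])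
  fix y z assume "y \<in> carr V" "z \<in> carr V"
  then show "\<omega> z (adjoint x y) + \<omega> (adjoint x z) y = \<omega> (br y z) x"
    using cocycle'[OF x, of y z] skew[of "adjoint x z" y] x by (simp add: form_adjoint)
qed

lemma bilinear_cobracket_form:
  "x \<in> carr V \<Longrightarrow> bilinear_map V V ground (\<lambda>y z. \<omega> (br y z) x)"
  by (rule bilinear_map_compose_linear[OF bilinear_br linear_form_left])

text \<open>Once adjoints are taken out of brackets there remain pairings of two adjoints, which cancel by
  skewness, and iterated brackets, which add up by the Jacobi identity.\<close>

lemma cobracket_derivation:
  assumes a: "a \<in> carr V" and b: "b \<in> carr V"
  shows "cobracket (br a b) = ad_hat V G br a (cobracket b) - ad_hat V G br b (cobracket a)"
proof (rule represents_eqI[OF represents_cobracket represents_diff])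
  note r = represents_ad_hat(2)[OF represents_cobracket bilinear_cobracket_form]
  show "represents (ad_hat V G br a (cobracket b))
      (\<lambda>y z. \<omega> (br (adjoint a y) z) b + \<omega> (br y (adjoint a z)) b)" by (rule r[OF b b a])
  show "represents (ad_hat V G br b (cobracket a))
      (\<lambda>y z. \<omega> (br (adjoint b y) z) a + \<omega> (br y (adjoint b z)) a)" by (rule r[OF a a b])
  fix y z assume y: "y \<in> carr V" and z: "z \<in> carr V"
  \<comment> \<open>The cocycle identity takes adjoints out of brackets.\<close>
  have *: "\<omega> (br (adjoint c p) q) d = \<omega> (br c (br d q)) p - \<omega> (adjoint c p) (adjoint d q)"
    if "c \<in> carr V" "d \<in> carr V" "p \<in> carr V" "q \<in> carr V" for c d p q
    using cocycle'[of d "adjoint c p" q] form_adjoint[of c p "br d q"] form_adjoint[of d q "adjoint c p"] that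
    by simp
  have **: "\<omega> (br p (adjoint c q)) d = - \<omega> (br c (br d p)) q + \<omega> (adjoint c q) (adjoint d p)"
    if "c \<in> carr V" "d \<in> carr V" "p \<in> carr V" "q \<in> carr V" for c d p q
    using *[of c d q p] br_skew[of p "adjoint c q"] that by (simp add: form_simps)
  have "\<omega> (br y z) (br a b) = \<omega> (br (br a b) z) y - \<omega> (br (br a b) y) z"
    by (rule cocycle') (use a b y z in auto)
  also have "\<dots> = (\<omega> (br a (br b z)) y - \<omega> (br b (br a z)) y) - (\<omega> (br a (br b y)) z - \<omega> (br b (br a y)) z)"
    by (simp add: br_br[OF a b z] br_br[OF a b y] form_simps a b y z)
  finally show "\<omega> (br y z) (br a b) =
      (\<omega> (br (adjoint a y) z) b + \<omega> (br y (adjoint a z)) b) -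
      (\<omega> (br (adjoint b y) z) a + \<omega> (br y (adjoint b z)) a)"
    using a b y z skew[of "adjoint b z" "adjoint a y"] skew[of "adjoint b y" "adjoint a z"]
    by (simp add: * **)
qed (use a b in auto)

end

context graded_skew_form
begin

lemma hc_zero [simp]: "hc i 0 = 0"
  by (rule linear_map_zero[OF vspace linear_map_hom_comp[OF graded]])

lemma flip12_carr:
  "t \<in> carr V3 \<Longrightarrow> flip12 V t \<in> carr V3"
  unfolding flip12_def
  by (rule linear_map_mem[OF linear_map_tensor_map[OF tensor_vspace vspace linear_map_flip
        linear_map_id(2)]])

lemma flip12_apply:
  assumes t: "t \<in> carr V3"
    and [simp]: "x \<in> carr V" "y \<in> carr V" "z \<in> carr V"
  shows "flip12 V t (pair3 \<omega> x y z) = t (pair3 \<omega> y x z)"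
  unfolding flip12_def
    tensor_map_apply[OF tensor_vspace vspace linear_map_flip linear_map_id(2) t]
  by (rule tensor_apply_cong[OF tensor_vspace vspace t])
    (simp add: tensor_pair3, simp add: pair3_def flip_apply)

end

context quasi_frobenius
begin

subsection \<open>The classical Yang-Baxter equation\<close>

lemma cybe_terms_carr:
  assumes "quadrilinear_map V V V V V3 h"
  shows "cybe_terms V h s q \<in> carr V3"
  using bilinear_map_mem[OF bilinear_map_double_lift[OF vspace vspace vspace vspace tensor_vspace assms]
      canonical_carr canonical_carr]
  by (cases q) (simp add: cybe_terms_def)

lemma cybe_terms_apply:
  assumes "quadrilinear_map V V V V V3 h"
  shows "cybe_terms V h s (d, d') \<beta> = s d (\<lambda>a b. s d' (\<lambda>a' b'. h a b a' b' \<beta>))"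
  unfolding cybe_terms_def prod.case
  by (rule double_tensor_lift_apply[OF vspace vspace vspace vspace tensor_vspace smul_tensor_space
        assms canonical_carr canonical_carr])

lemma cybe_quadrilinear:
  "quadrilinear_map V V V V V3 (\<lambda>a b a' b'. tensor3 V (br a a') b b')"
  "quadrilinear_map V V V V V3 (\<lambda>a b a' b'. tensor3 V a (br b a') b')"
  "quadrilinear_map V V V V V3 (\<lambda>a b a' b'. tensor3 V a a' (br b b'))"
  by (auto simp: quadrilinear_map_def tensor3_mem tensor3_add tensor3_scale
      br_add_left br_add_right br_scale_left br_scale_right intro!: bilinear_mapI)

lemma linear_form_br:
  "y \<in> carr V \<Longrightarrow> x \<in> carr V \<Longrightarrow> linear_map V ground (\<lambda>a. \<omega> (br a y) x)"
  "y \<in> carr V \<Longrightarrow> x \<in> carr V \<Longrightarrow> linear_map V ground (\<lambda>a. \<omega> (br y a) x)"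
  using linear_map_comp[OF linear_br_left linear_form_left] linear_map_comp[OF linear_br_right linear_form_left]
  by blast+

lemma linear_map_mult_const:
  "linear_map V ground \<phi> \<Longrightarrow> linear_map V ground (\<lambda>a. c * \<phi> a :: 'k)"
  "linear_map V ground \<phi> \<Longrightarrow> linear_map V ground (\<lambda>a. \<phi> a * c :: 'k)"
  by (simp_all add: linear_map_def algebra_simps)

text \<open>Each of the three expressions contracts one leg of either copy of \<open>s\<close>, which replaces it by the
  matching homogeneous component of an argument; what remains is \<open>\<omega>\<close> of a bracket.\<close>

lemma cybe_term1:
  assumes [simp]: "x \<in> carr V" "y \<in> carr V" "z \<in> carr V"
  shows "cybe_terms V (\<lambda>a b a' b'. tensor3 V (br a a') b b') s ((i, j), (i', j')) (pair3 \<omega> x y z) =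
    \<omega> (br (hc i (hc (codeg j) y)) (hc i' (hc (codeg j') z))) x"
proof -
  let ?Z = "hc i' (hc (codeg j') z)"
  have "cybe_terms V (\<lambda>a b a' b'. tensor3 V (br a a') b b') s ((i, j), (i', j')) (pair3 \<omega> x y z) =
    s (i, j) (\<lambda>a b. s (i', j') (\<lambda>a' b'. (\<omega> (br a a') x * \<omega> b y) * \<omega> b' z))"
    unfolding cybe_terms_apply[OF cybe_quadrilinear(1)] by (simp add: tensor3_pair3)
  also have "\<dots> = s (i, j) (\<lambda>a b. \<omega> (br a ?Z) x * \<omega> b y)"
    by (rule tensor_apply_cong[OF vspace vspace canonical_carr])
      (simp add: canonical_contract_right linear_map_mult_const linear_form_br)
  also have "\<dots> = \<omega> (br (hc i (hc (codeg j) y)) ?Z) x"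
    by (simp add: canonical_contract_right linear_form_br)
  finally show ?thesis .
qed

lemma cybe_term2:
  assumes [simp]: "x \<in> carr V" "y \<in> carr V" "z \<in> carr V"
  shows "cybe_terms V (\<lambda>a b a' b'. tensor3 V a (br b a') b') s ((i, j), (i', j')) (pair3 \<omega> x y z) =
    - \<omega> (br (hc j (hc (codeg i) x)) (hc i' (hc (codeg j') z))) y"
proof -
  let ?Z = "hc i' (hc (codeg j') z)"
  have "cybe_terms V (\<lambda>a b a' b'. tensor3 V a (br b a') b') s ((i, j), (i', j')) (pair3 \<omega> x y z) =
    s (i, j) (\<lambda>a b. s (i', j') (\<lambda>a' b'. (\<omega> a x * \<omega> (br b a') y) * \<omega> b' z))"
    unfolding cybe_terms_apply[OF cybe_quadrilinear(2)] by (simp add: tensor3_pair3)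
  also have "\<dots> = s (i, j) (\<lambda>a b. \<omega> a x * \<omega> (br b ?Z) y)"
    by (rule tensor_apply_cong[OF vspace vspace canonical_carr])
      (simp add: canonical_contract_right linear_map_mult_const linear_form_br)
  also have "\<dots> = - \<omega> (br (hc j (hc (codeg i) x)) ?Z) y"
    by (simp add: canonical_contract_left linear_form_br)
  finally show ?thesis .
qed

lemma cybe_term3:
  assumes [simp]: "x \<in> carr V" "y \<in> carr V" "z \<in> carr V"
  shows "cybe_terms V (\<lambda>a b a' b'. tensor3 V a a' (br b b')) s ((i, j), (i', j')) (pair3 \<omega> x y z) =
    \<omega> (br (hc j (hc (codeg i) x)) (hc j' (hc (codeg i') y))) z"
proof -
  let ?Y = "hc j' (hc (codeg i') y)"
  have lin: "linear_map V ground (\<lambda>b. - \<omega> (br b ?Y) z)"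
    using linear_map_mult_const(1)[OF linear_form_br(1)[of ?Y z], of "-1"] by simp
  have "cybe_terms V (\<lambda>a b a' b'. tensor3 V a a' (br b b')) s ((i, j), (i', j')) (pair3 \<omega> x y z) =
    s (i, j) (\<lambda>a b. s (i', j') (\<lambda>a' b'. \<omega> a' y * (\<omega> a x * \<omega> (br b b') z)))"
    unfolding cybe_terms_apply[OF cybe_quadrilinear(3)] by (simp add: tensor3_pair3 mult_ac)
  also have "\<dots> = s (i, j) (\<lambda>a b. \<omega> a x * - \<omega> (br b ?Y) z)"
    by (rule tensor_apply_cong[OF vspace vspace canonical_carr])
      (simp add: canonical_contract_left linear_map_mult_const linear_form_br)
  also have "\<dots> = \<omega> (br (hc j (hc (codeg i) x)) ?Y) z"
    using canonical_contract_left[OF lin, of x] by simp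
  finally show ?thesis .
qed

lemma br_zero: "y \<in> carr V \<Longrightarrow> br 0 y = 0" "y \<in> carr V \<Longrightarrow> br y 0 = 0"
  using linear_map_zero[OF vspace linear_br_left] linear_map_zero[OF vspace linear_br_right] by blast+

text \<open>The three surviving terms are the three summands of the cocycle identity.\<close>

theorem skew_completed_cybe_solution_canonical: "skew_completed_cybe_solution V G br s"
proof -
  let ?t1 = "cybe_terms V (\<lambda>a b a' b'. tensor3 V (br a a') b b') s"
  let ?t2 = "cybe_terms V (\<lambda>a b a' b'. tensor3 V a (br b a') b') s"
  let ?t3 = "cybe_terms V (\<lambda>a b a' b'. tensor3 V a a' (br b b')) s"
  let ?p1 = "\<lambda>i j k. ((codeg j, j), (codeg k, k))"
  let ?p2 = "\<lambda>i j k. ((i, codeg i), (codeg k, k))"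
  let ?p3 = "\<lambda>i j k. ((i, codeg i), (j, codeg j))"
  note carr = cybe_terms_carr[OF cybe_quadrilinear(1)] cybe_terms_carr[OF cybe_quadrilinear(2)]
    cybe_terms_carr[OF cybe_quadrilinear(3)]
  have z1: "?t1 q (pair3 \<omega> (hc (codeg i) x) (hc (codeg j) y) (hc (codeg k) z)) = 0"
    if "q \<noteq> ?p1 i j k" "x \<in> carr V" "y \<in> carr V" "z \<in> carr V" for q i j k x y z
  proof -
    obtain a b c d where q: "q = ((a, b), (c, d))" by (metis prod.exhaust)
    show ?thesis using that unfolding q
      by (auto simp: cybe_term1 hc_hc br_zero form_zero_left split: if_splits)
  qed
  have z2: "?t2 q (pair3 \<omega> (hc (codeg i) x) (hc (codeg j) y) (hc (codeg k) z)) = 0"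
    if "q \<noteq> ?p2 i j k" "x \<in> carr V" "y \<in> carr V" "z \<in> carr V" for q i j k x y z
  proof -
    obtain a b c d where q: "q = ((a, b), (c, d))" by (metis prod.exhaust)
    show ?thesis using that unfolding q
      by (auto simp: cybe_term2 hc_hc br_zero form_zero_left split: if_splits)
  qed
  have z3: "?t3 q (pair3 \<omega> (hc (codeg i) x) (hc (codeg j) y) (hc (codeg k) z)) = 0"
    if "q \<noteq> ?p3 i j k" "x \<in> carr V" "y \<in> carr V" "z \<in> carr V" for q i j k x y z
  proof -
    obtain a b c d where q: "q = ((a, b), (c, d))" by (metis prod.exhaust)
    show ?thesis using that unfolding q
      by (auto simp: cybe_term3 hc_hc br_zero form_zero_left split: if_splits)
  qed
  note single1 = comp3_single_term[OF carr(1) z1] and single2 = comp3_single_term[OF carr(2) z2]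
    and single3 = comp3_single_term[OF carr(3) z3]
  have fin: "locally_finite (comp3 V G) UNIV ?t1" "locally_finite (comp3 V G) UNIV ?t2"
    "locally_finite (comp3 V G) UNIV ?t3"
    unfolding locally_finite_def using single1(1) single2(1) single3(1) by auto
  have "comp3 V G (i, j, k) (?t1 (?p1 i j k)) + comp3 V G (i, j, k) (?t2 (?p2 i j k)) +
      comp3 V G (i, j, k) (?t3 (?p3 i j k)) = 0" (is "?c1 + ?c2 + ?c3 = 0") for i j k
  proof (rule tensor3_zeroI)
    show "?c1 + ?c2 + ?c3 \<in> carr V3"
      by (intro vspace_add[OF tensor_vspace] comp3_carr carr)
    fix x y z assume [simp]: "x \<in> carr V" "y \<in> carr V" "z \<in> carr V"
    show "(?c1 + ?c2 + ?c3) (pair3 \<omega> x y z) = 0"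
      using cocycle'[of "hc (codeg i) x" "hc (codeg j) y" "hc (codeg k) z"]
      by (simp add: comp3_apply carr cybe_term1 cybe_term2 cybe_term3 hc_hc)
  qed
  then have "formal_sum (comp3 V G) UNIV ?t1 + formal_sum (comp3 V G) UNIV ?t2 +
      formal_sum (comp3 V G) UNIV ?t3 = 0"
    by (auto simp: fun_eq_iff single1(2) single2(2) single3(2))
  with fin show ?thesis
    unfolding skew_completed_cybe_solution_def Let_def
    using represents_ctensor2[OF canonical] canonical_cflip by blast
qed

subsection \<open>The completed Lie bialgebra\<close>

lemma cobracket_carr: "x \<in> carr V \<Longrightarrow> cobracket x d \<in> carr V2"
  by (rule represents_carr[OF represents_cobracket])

lemma cobracket_apply:
  "x \<in> carr V \<Longrightarrow> y \<in> carr V \<Longrightarrow> z \<in> carr V \<Longrightarrow>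
   cobracket x (i, j) (pair2 \<omega> y z) = \<omega> (br (hc (codeg i) y) (hc (codeg j) z)) x"
  by (rule represents_apply[OF represents_cobracket])

lemma cobracket_add:
  assumes "x \<in> carr V" "y \<in> carr V"
  shows "cobracket (x + y) = cobracket x + cobracket y"
  by (rule represents_eqI[OF represents_cobracket represents_add[OF represents_cobracket represents_cobracket]])
    (use assms in \<open>auto simp: form_simps\<close>)

lemma cobracket_scale:
  assumes "x \<in> carr V"
  shows "cobracket (smul V c x) = (\<lambda>d. fun_scale c (cobracket x d))"
  by (rule represents_eqI[OF represents_cobracket represents_scale[OF represents_cobracket]])
    (use assms in \<open>auto simp: form_simps\<close>)

lemma cobracket_skew:
  assumes x: "x \<in> carr V"
  shows "cobracket x = - cflip V (cobracket x)"
proof (rule represents_eqI)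
  show "represents (cobracket x) (\<lambda>y z. \<omega> (br y z) x)" by (rule represents_cobracket[OF x])
  show "represents (- cflip V (cobracket x)) (\<lambda>y z. - \<omega> (br z y) x)"
    by (rule represents_neg[OF represents_cflip[OF represents_cobracket[OF x]]])
  fix y z assume "y \<in> carr V" "z \<in> carr V"
  then show "\<omega> (br y z) x = - \<omega> (br z y) x" using br_skew[of y z] x by (simp add: form_simps)
qed

lemma linear_cobracket: "linear_map V V2 (\<lambda>x. cobracket x d)"
  by (rule linear_mapI) (simp_all add: cobracket_carr cobracket_add cobracket_scale)

lemma id_delta_bilinear:
  "bilinear_map V V V3 (\<lambda>x y. tensor_lift V V (\<lambda>y1 y2. tensor3 V x y1 y2) (cobracket y d))"
proof (rule bilinear_map_precompose[OF _ linear_map_id(1) linear_cobracket])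
  show "bilinear_map V V2 V3 (\<lambda>x t. tensor_lift V V (\<lambda>y1 y2. tensor3 V x y1 y2) t)"
    by (rule bilinear_map_param_lift[OF vspace vspace vspace tensor_vspace])
      (auto intro!: bilinear_mapI linear_mapI simp: tensor3_mem tensor3_add tensor3_scale)
qed

lemma delta_id_bilinear:
  "bilinear_map V V V3 (\<lambda>x y. tensor_lift V V (\<lambda>x1 x2. tensor3 V x1 x2 y) (cobracket x d))"
proof -
  have "bilinear_map V V2 V3 (\<lambda>y t. tensor_lift V V (\<lambda>x1 x2. tensor3 V x1 x2 y) t)"
    by (rule bilinear_map_param_lift[OF vspace vspace vspace tensor_vspace])
      (auto intro!: bilinear_mapI linear_mapI simp: tensor3_mem tensor3_add tensor3_scale)
  from bilinear_map_precompose[OF this linear_map_id(1) linear_cobracket[of d]]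
  show ?thesis by (simp add: bilinear_map_def)
qed

lemma id_delta_terms_carr: "x \<in> carr V \<Longrightarrow> id_delta_terms V cobracket (cobracket x) q \<in> carr V3"
  using linear_map_mem[OF tensor_lift_linear[OF vspace vspace tensor_vspace id_delta_bilinear]
      cobracket_carr]
  by (cases q) (simp add: id_delta_terms_def)

lemma delta_id_terms_carr: "x \<in> carr V \<Longrightarrow> delta_id_terms V cobracket (cobracket x) q \<in> carr V3"
  using linear_map_mem[OF tensor_lift_linear[OF vspace vspace tensor_vspace delta_id_bilinear]
      cobracket_carr]
  by (cases q) (simp add: delta_id_terms_def)

text \<open>Applying \<open>\<delta>\<close> to a leg of \<open>\<delta>(w)\<close> replaces two arguments by their bracket, so the iterated
  cobracket of \<open>w\<close> pairs to \<open>\<omega>\<close> of an iterated bracket with \<open>w\<close>.\<close>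

lemma id_delta_terms_apply:
  assumes [simp]: "w \<in> carr V" "x \<in> carr V" "y \<in> carr V" "z \<in> carr V"
  shows "id_delta_terms V cobracket (cobracket w) ((i, j), (k, l)) (pair3 \<omega> x y z) =
    - \<omega> (br (hc (codeg i) x) (hc (codeg j) (br (hc (codeg k) y) (hc (codeg l) z)))) w"
proof -
  let ?B = "br (hc (codeg k) y) (hc (codeg l) z)"
  have tri: "bilinear_map V V V3 (tensor3 V a)" if "a \<in> carr V" for a
    using that by (auto intro!: bilinear_mapI simp: tensor3_mem tensor3_add tensor3_scale)
  have "id_delta_terms V cobracket (cobracket w) ((i, j), (k, l)) (pair3 \<omega> x y z) =
      cobracket w (i, j) (\<lambda>a b. tensor_lift V V (tensor3 V a) (cobracket b (k, l)) (pair3 \<omega> x y z))"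
    unfolding id_delta_terms_def prod.case
    by (rule tensor_lift_apply[OF vspace vspace tensor_vspace smul_tensor_space id_delta_bilinear])
      (simp add: cobracket_carr)
  also have "\<dots> = cobracket w (i, j) (\<lambda>a b. -1 * pair2 \<omega> x ?B a b)"
  proof (rule tensor_apply_cong[OF vspace vspace cobracket_carr])
    fix a b assume [simp]: "a \<in> carr V" "b \<in> carr V"
    have "tensor_lift V V (tensor3 V a) (cobracket b (k, l)) (pair3 \<omega> x y z) =
        cobracket b (k, l) (\<lambda>u v. tensor3 V a u v (pair3 \<omega> x y z))"
      by (rule tensor_lift_apply[OF vspace vspace tensor_vspace smul_tensor_space tri])
        (simp_all add: cobracket_carr)
    also have "\<dots> = cobracket b (k, l) (\<lambda>u v. \<omega> a x * pair2 \<omega> y z u v)"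
      by (simp add: tensor3_pair3 pair2_def mult.assoc)
    also have "\<dots> = \<omega> a x * \<omega> ?B b"
      using tensor_apply_scale[OF vspace vspace cobracket_carr bilinear_pair2]
      by (simp add: cobracket_apply)
    finally show "tensor_lift V V (tensor3 V a) (cobracket b (k, l)) (pair3 \<omega> x y z) =
        -1 * pair2 \<omega> x ?B a b"
      using skew[of ?B b] by (simp add: pair2_def)
  qed simp
  also have "\<dots> = -1 * \<omega> (br (hc (codeg i) x) (hc (codeg j) ?B)) w"
    by (subst tensor_apply_scale[OF vspace vspace cobracket_carr bilinear_pair2])
      (simp_all add: cobracket_apply)
  finally show ?thesis by simp
qed

lemma delta_id_terms_apply:
  assumes [simp]: "w \<in> carr V" "x \<in> carr V" "y \<in> carr V" "z \<in> carr V"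
  shows "delta_id_terms V cobracket (cobracket w) ((i, j), (k, l)) (pair3 \<omega> x y z) =
    - \<omega> (br (hc (codeg i) (br (hc (codeg k) x) (hc (codeg l) y))) (hc (codeg j) z)) w"
proof -
  let ?B = "br (hc (codeg k) x) (hc (codeg l) y)"
  have tri: "bilinear_map V V V3 (\<lambda>u v. tensor3 V u v b)" if "b \<in> carr V" for b
    using that by (auto intro!: bilinear_mapI simp: tensor3_mem tensor3_add tensor3_scale)
  have "delta_id_terms V cobracket (cobracket w) ((i, j), (k, l)) (pair3 \<omega> x y z) =
      cobracket w (i, j) (\<lambda>a b. tensor_lift V V (\<lambda>u v. tensor3 V u v b) (cobracket a (k, l)) (pair3 \<omega> x y z))"
    unfolding delta_id_terms_def prod.case
    by (rule tensor_lift_apply[OF vspace vspace tensor_vspace smul_tensor_space delta_id_bilinear])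
      (simp add: cobracket_carr)
  also have "\<dots> = cobracket w (i, j) (\<lambda>a b. -1 * pair2 \<omega> ?B z a b)"
  proof (rule tensor_apply_cong[OF vspace vspace cobracket_carr])
    fix a b assume [simp]: "a \<in> carr V" "b \<in> carr V"
    have "tensor_lift V V (\<lambda>u v. tensor3 V u v b) (cobracket a (k, l)) (pair3 \<omega> x y z) =
        cobracket a (k, l) (\<lambda>u v. tensor3 V u v b (pair3 \<omega> x y z))"
      by (rule tensor_lift_apply[OF vspace vspace tensor_vspace smul_tensor_space tri])
        (simp_all add: cobracket_carr)
    also have "\<dots> = cobracket a (k, l) (\<lambda>u v. \<omega> b z * pair2 \<omega> x y u v)"
      by (simp add: tensor3_pair3 pair2_def mult_ac)
    also have "\<dots> = \<omega> b z * \<omega> ?B a"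
      using tensor_apply_scale[OF vspace vspace cobracket_carr bilinear_pair2]
      by (simp add: cobracket_apply)
    finally show "tensor_lift V V (\<lambda>u v. tensor3 V u v b) (cobracket a (k, l)) (pair3 \<omega> x y z) =
        -1 * pair2 \<omega> ?B z a b"
      using skew[of ?B a] by (simp add: pair2_def)
  qed simp
  also have "\<dots> = -1 * \<omega> (br (hc (codeg i) ?B) (hc (codeg j) z)) w"
    by (subst tensor_apply_scale[OF vspace vspace cobracket_carr bilinear_pair2])
      (simp_all add: cobracket_apply)
  finally show ?thesis by simp
qed

lemma hc_br_homogeneous:
  assumes "x \<in> carr V" "y \<in> carr V"
  shows "hc k (br (hc i x) (hc j y)) = (if k = i + j then br (hc i x) (hc j y) else 0)"
  by (rule hom_comp_homogeneous[OF graded br_graded]) (simp_all add: hom_comp_mem[OF graded] assms)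

text \<open>The bracket of arguments of degrees \<open>- m - j\<close> and \<open>- m - k\<close> has degree \<open>- m - (m + j + k)\<close>; this
  determines the only contributing term.\<close>

lemma cojacobi:
  assumes [simp]: "w \<in> carr V"
  defines "t \<equiv> id_delta_terms V cobracket (cobracket w)"
    and "u \<equiv> delta_id_terms V cobracket (cobracket w)"
  shows "locally_finite (comp3 V G) UNIV t" "locally_finite (comp3 V G) UNIV u"
    "formal_sum (comp3 V G) UNIV t - cflip12 V (formal_sum (comp3 V G) UNIV t) = formal_sum (comp3 V G) UNIV u"
proof -
  let ?p = "\<lambda>i j k. ((i, m + j + k), (j, k))" and ?q = "\<lambda>i j k. ((m + i + j, k), (i, j))"
  have t_carr: "t q \<in> carr V3" and u_carr: "u q \<in> carr V3" for q
    by (simp_all add: t_def u_def id_delta_terms_carr delta_id_terms_carr)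
  have zt: "t q (pair3 \<omega> (hc (codeg i) x) (hc (codeg j) y) (hc (codeg k) z)) = 0"
    if "q \<noteq> ?p i j k" "x \<in> carr V" "y \<in> carr V" "z \<in> carr V" for q i j k x y z
  proof -
    obtain a b c d where q: "q = ((a, b), (c, d))" by (metis prod.exhaust)
    show ?thesis using that unfolding q
      by (auto simp: t_def id_delta_terms_apply hc_hc hc_br_homogeneous br_zero form_zero_left split: if_splits)
  qed
  have zu: "u q (pair3 \<omega> (hc (codeg i) x) (hc (codeg j) y) (hc (codeg k) z)) = 0"
    if "q \<noteq> ?q i j k" "x \<in> carr V" "y \<in> carr V" "z \<in> carr V" for q i j k x y z
  proof -
    obtain a b c d where q: "q = ((a, b), (c, d))" by (metis prod.exhaust)
    show ?thesis using that unfolding q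
      by (auto simp: u_def delta_id_terms_apply hc_hc hc_br_homogeneous br_zero form_zero_left split: if_splits)
  qed
  note single_t = comp3_single_term[OF t_carr zt] and single_u = comp3_single_term[OF u_carr zu]
  show "locally_finite (comp3 V G) UNIV t" "locally_finite (comp3 V G) UNIV u"
    unfolding locally_finite_def using single_t(1) single_u(1) by auto
  have "comp3 V G (i, j, k) (t (?p i j k)) - flip12 V (comp3 V G (j, i, k) (t (?p j i k))) -
      comp3 V G (i, j, k) (u (?q i j k)) = 0" (is "?a - ?b - ?c = 0") for i j k
  proof (rule tensor3_zeroI)
    show "?a - ?b - ?c \<in> carr V3"
      by (intro vspace_diff[OF tensor_vspace] flip12_carr comp3_carr t_carr u_carr)
    fix x y z assume [simp]: "x \<in> carr V" "y \<in> carr V" "z \<in> carr V"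
    show "(?a - ?b - ?c) (pair3 \<omega> x y z) = 0"
      by (simp add: flip12_apply comp3_carr comp3_apply t_carr u_carr)
        (simp add: t_def u_def id_delta_terms_apply delta_id_terms_apply hc_hc hc_br_homogeneous
          br_br form_simps)
  qed
  then show "formal_sum (comp3 V G) UNIV t - cflip12 V (formal_sum (comp3 V G) UNIV t) =
      formal_sum (comp3 V G) UNIV u"
    by (auto simp: fun_eq_iff cflip12_def single_t(2) single_u(2))
qed

theorem completed_lie_bialgebra_cobracket: "completed_lie_bialgebra V G br cobracket"
  unfolding completed_lie_bialgebra_def Let_def
  using graded lie represents_ctensor2[OF represents_cobracket] cobracket_add cobracket_scale
    cobracket_skew cojacobi cobracket_derivation
    represents_ad_hat(1)[OF represents_cobracket bilinear_cobracket_form]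
  by blast

end

section \<open>Linear maps on tensor products\<close>

lemma linear_map_tensor_eqI:
  assumes V: "is_vspace V" and W: "is_vspace W"
    and f: "linear_map (tensor_space V W) X f" and g: "linear_map (tensor_space V W) X g"
    and eq: "\<And>v w. v \<in> carr V \<Longrightarrow> w \<in> carr W \<Longrightarrow> f (tensor V W v w) = g (tensor V W v w)"
    and t: "t \<in> carr (tensor_space V W)"
  shows "f t = g t"
  using V W t
proof (induct t rule: tensor_induct)
  case (add t u)
  then have "f (t + u) = g (t + u)" using linear_map_add[OF f] linear_map_add[OF g] by simp
  then show ?case .
qed (rule eq)

lemma double_tensor_lift_tensor:
  assumes V: "is_vspace V" and W: "is_vspace W"
    and V': "is_vspace V'" and W': "is_vspace W'" and X: "is_vspace X"
    and g: "quadrilinear_map V W V' W' X g"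
    and c: "a \<in> carr V" "b \<in> carr W" "a' \<in> carr V'" "b' \<in> carr W'"
  shows "tensor_lift V W (\<lambda>a b. tensor_lift V' W' (g a b) (tensor V' W' a' b')) (tensor V W a b) = g a b a' b'"
proof -
  have g1: "bilinear_map V' W' X (g a b)" using g c by (simp add: quadrilinear_map_def)
  show ?thesis
    using tensor_lift_tensor[OF X bilinear_map_partial_lift[OF V W V' W' X g tensor_mem[OF c(3,4)]] c(1,2)]
      tensor_lift_tensor[OF X g1 c(3,4)] by simp
qed

lemma linear_map_plus:
  assumes "is_vspace X" "linear_map V X f" "linear_map V X g"
  shows "linear_map V X (\<lambda>x. f x + g x)"
proof -
  interpret vector_space "smul X" using assms(1) by (rule vspace_vector_space)
  show ?thesis
    using assms by (simp add: linear_map_def vspace_add scale_right_distrib algebra_simps)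
qed

lemma bilinear_map_plus:
  "is_vspace X \<Longrightarrow> bilinear_map V W X g \<Longrightarrow> bilinear_map V W X h \<Longrightarrow>
   bilinear_map V W X (\<lambda>v w. g v w + h v w)"
  by (simp add: bilinear_map_def linear_map_plus)

text \<open>A grading recognised from its projections, which are thereby the homogeneous components.\<close>

lemma graded_by_projections:
  assumes V: "is_vspace V" and sub: "\<And>i. module.subspace (smul V) (G i)" "\<And>i. G i \<subseteq> carr V"
    and \<pi>: "\<And>i. linear_map V V (\<pi> i)" "\<And>i x. x \<in> carr V \<Longrightarrow> \<pi> i x \<in> G i"
    and hom: "\<And>i j x. x \<in> G i \<Longrightarrow> \<pi> j x = (if j = i then x else 0)"
    and fin: "\<And>x. x \<in> carr V \<Longrightarrow> \<exists>F. finite F \<and> (\<forall>i. i \<notin> F \<longrightarrow> \<pi> i x = 0) \<and> x = (\<Sum>i\<in>F. \<pi> i x)"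
  shows "graded V G" and "\<And>x. x \<in> carr V \<Longrightarrow> hom_comp G i x = \<pi> i x"
proof -
  let ?P = "\<lambda>x f. (\<forall>i. f i \<in> G i) \<and> finite {i. f i \<noteq> 0} \<and> x = (\<Sum>i | f i \<noteq> 0. f i)"
  have ex: "?P x (\<lambda>i. \<pi> i x)" if x: "x \<in> carr V" for x
  proof -
    obtain F where F: "finite F" "\<And>i. i \<notin> F \<Longrightarrow> \<pi> i x = 0" "x = (\<Sum>i\<in>F. \<pi> i x)"
      using fin[OF x] by blast
    have sub: "{i. \<pi> i x \<noteq> 0} \<subseteq> F" using F(2) by blast
    have "(\<Sum>i\<in>F. \<pi> i x) = (\<Sum>i | \<pi> i x \<noteq> 0. \<pi> i x)"
      by (rule sum.mono_neutral_right) (use F(1) sub in auto)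
    then show ?thesis using \<pi>(2)[OF x] F(1,3) finite_subset[OF sub] by simp
  qed
  have uniq: "f = (\<lambda>i. \<pi> i x)" if x: "x \<in> carr V" and f: "?P x f" for x f
  proof
    fix j
    have "\<pi> j x = \<pi> j (\<Sum>i | f i \<noteq> 0. f i)" using f by simp
    also have "\<dots> = (\<Sum>i | f i \<noteq> 0. \<pi> j (f i))"
      by (rule linear_map_sum[OF V \<pi>(1)]) (use f sub(2) in blast)
    also have "\<dots> = (\<Sum>i | f i \<noteq> 0. if j = i then f i else 0)"
      using hom f by (intro sum.cong) auto
    also have "\<dots> = f j" using f by (auto simp: sum.delta)
    finally show "f j = \<pi> j x" by simp
  qed
  show gr: "graded V G"
    unfolding graded_def using V sub ex uniq by (intro conjI allI ballI ex1I) blast+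
  show "hom_comp G i x = \<pi> i x" if x: "x \<in> carr V" for x i
    using uniq[OF x, of "\<lambda>i. hom_comp G i x"] hom_comp_mem[OF gr x] finite_hom_comp[OF gr x]
      sum_hom_comp[OF gr x] by (metis (no_types, lifting))
qed

section \<open>Tensor products of quasi-Frobenius Novikov algebras with quadratic right Novikov algebras\<close>

text \<open>The Novikov analogue of a quasi-Frobenius Lie algebra: the identity is the Novikov
  Yang-Baxter equation for the inverse of \<open>\<omega>\<close>, read through \<open>\<omega>\<close>.\<close>

locale quasi_frobenius_novikov = skew_form V \<omega>
  for V :: "('k::field, 'v::ab_group_add) vspace" and \<omega> :: "'v \<Rightarrow> 'v \<Rightarrow> 'k" +
  fixes circ :: "'v \<Rightarrow> 'v \<Rightarrow> 'v"
  assumes novikov: "novikov V circ"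
    and novikov_cocycle: "x \<in> carr V \<Longrightarrow> y \<in> carr V \<Longrightarrow> z \<in> carr V \<Longrightarrow>
      \<omega> (circ x y) z + \<omega> (circ z y) x = \<omega> (circ x z + circ z x) y"
begin

lemma bilinear_circ: "bilinear_map V V V circ"
  using novikov by (simp add: novikov_def)

lemma circ_carr [simp]: "x \<in> carr V \<Longrightarrow> y \<in> carr V \<Longrightarrow> circ x y \<in> carr V"
  by (rule bilinear_map_mem[OF bilinear_circ])

lemma circ_linear:
  "x \<in> carr V \<Longrightarrow> x' \<in> carr V \<Longrightarrow> y \<in> carr V \<Longrightarrow> circ (x + x') y = circ x y + circ x' y"
  "x \<in> carr V \<Longrightarrow> y \<in> carr V \<Longrightarrow> y' \<in> carr V \<Longrightarrow> circ x (y + y') = circ x y + circ x y'"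
  "x \<in> carr V \<Longrightarrow> y \<in> carr V \<Longrightarrow> circ (smul V c x) y = smul V c (circ x y)"
  "x \<in> carr V \<Longrightarrow> y \<in> carr V \<Longrightarrow> circ x (smul V c y) = smul V c (circ x y)"
  using bilinear_circ by (simp_all add: bilinear_map_def linear_map_def)

lemma novikov_left_symmetric:
  "a \<in> carr V \<Longrightarrow> b \<in> carr V \<Longrightarrow> c \<in> carr V \<Longrightarrow>
   circ (circ a b) c - circ a (circ b c) = circ (circ b a) c - circ b (circ a c)"
  and novikov_right_commutative:
  "a \<in> carr V \<Longrightarrow> b \<in> carr V \<Longrightarrow> c \<in> carr V \<Longrightarrow> circ (circ a b) c = circ (circ a c) b"
  using novikov unfolding novikov_def by blast+

abbreviation "nybe_summand x y x' y' \<equiv>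
  tensor3 V x x' (circ y y') + tensor3 V x (circ y x' + circ x' y) y' + tensor3 V (circ x x') y' y"

lemma nybe_quadrilinear:
  "quadrilinear_map V V V V V3 nybe_summand"
proof -
  interpret K: vector_space "fun_scale :: 'k \<Rightarrow> ('k, 'v) tens3 \<Rightarrow> _"
    by (rule vector_space_fun_scale)
  note vs = tensor_vspace[of "tensor_space V V" V]
  interpret VV: vector_space "smul V" using vspace by (rule vspace_vector_space)
  show ?thesis
    unfolding quadrilinear_map_def
    by (intro conjI ballI bilinear_mapI vspace_add[OF vs] tensor3_mem circ_carr closed; assumption?)
      (simp_all add: tensor3_add tensor3_scale circ_linear K.scale_right_distrib add_ac
        VV.scale_right_distrib[symmetric])
qed

text \<open>Contracting both copies of \<open>r\<close> leaves \<open>\<omega>(x \<circ> y, z)\<close>, \<open>- \<omega>(x \<circ> z + z \<circ> x, y)\<close> and \<open>\<omega>(z \<circ> y, x)\<close>.\<close>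

lemma skew_nybe_solutionI:
  assumes r: "r \<in> carr V2"
    and inv: "\<And>y z. y \<in> carr V \<Longrightarrow> z \<in> carr V \<Longrightarrow> r (pair2 \<omega> y z) = \<omega> z y"
  shows "skew_nybe_solution V circ r"
proof -
  note vs = tensor_vspace[of "tensor_space V V" V]
  have right: "r (\<lambda>u v. \<phi> u * \<omega> v z) = \<phi> z" if "linear_map V ground \<phi>" "z \<in> carr V" for \<phi> z
    by (rule contract_right[OF r that that(2) inv[OF _ that(2)]])
  have left: "r (\<lambda>u v. \<omega> u y * \<phi> v) = - \<phi> y" if "linear_map V ground \<phi>" "y \<in> carr V" for \<phi> y
    using contract_left[OF r that(1,2) vspace_neg[OF vspace that(2)]] inv[OF that(2)]
      skew[OF that(2)] linear_map_neg[OF vspace that] that(2) by (simp add: form_simps)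
  have lin: "linear_map V ground (\<lambda>u. c * \<omega> (circ u w) z)"
    "linear_map V ground (\<lambda>u. c * \<omega> (circ w u) z)"
    "linear_map V ground (\<lambda>u. c * \<omega> (circ w u + circ u w) z)" if "w \<in> carr V" "z \<in> carr V" for w z c
    using that by (auto intro!: linear_mapI simp: circ_linear form_simps algebra_simps)
  have sk: "flip V r = - r"
  proof (rule tensor2_eqI[OF linear_map_mem[OF linear_map_flip r] vspace_neg[OF tensor_vspace r]])
    fix y z assume "y \<in> carr V" "z \<in> carr V"
    then show "flip V r (pair2 \<omega> y z) = (- r) (pair2 \<omega> y z)"
      using skew[of y z] by (simp add: flip_apply r inv)
  qed
  have "nybe_expr V circ r = 0"
  proof (rule tensor3_zeroI)
    show "nybe_expr V circ r \<in> carr V3"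
      unfolding nybe_expr_def
      by (rule bilinear_map_mem[OF bilinear_map_double_lift[OF vspace vspace vspace vspace vs nybe_quadrilinear] r r])
    fix x y z assume [simp]: "x \<in> carr V" "y \<in> carr V" "z \<in> carr V"
    have inner: "r (\<lambda>a' b'. \<omega> a x * \<omega> a' y * \<omega> (circ b b') z + \<omega> a x * \<omega> (circ b a' + circ a' b) y * \<omega> b' z
        + \<omega> (circ a a') x * \<omega> b' y * \<omega> b z) =
      \<omega> a x * (\<omega> (circ b z + circ z b) y - \<omega> (circ b y) z) + \<omega> (circ a y) x * \<omega> b z"
      if [simp]: "a \<in> carr V" "b \<in> carr V" for a b
    proof -
      have b1: "bilinear_map V V ground (\<lambda>a' b'. \<omega> a' y * (\<omega> a x * \<omega> (circ b b') z))"
        and b2: "bilinear_map V V ground (\<lambda>a' b'. (\<omega> a x * \<omega> (circ b a' + circ a' b) y) * \<omega> b' z)"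
        and b3: "bilinear_map V V ground (\<lambda>a' b'. (\<omega> b z * \<omega> (circ a a') x) * \<omega> b' y)"
        by (intro bilinear_map_mult linear_form_left lin; simp)+
      have b12: "bilinear_map V V ground (\<lambda>a' b'. \<omega> a' y * (\<omega> a x * \<omega> (circ b b') z) +
          (\<omega> a x * \<omega> (circ b a' + circ a' b) y) * \<omega> b' z)"
        by (rule bilinear_map_plus[OF is_vspace_ground b1 b2])
      have "r (\<lambda>a' b'. \<omega> a x * \<omega> a' y * \<omega> (circ b b') z + \<omega> a x * \<omega> (circ b a' + circ a' b) y * \<omega> b' z
        + \<omega> (circ a a') x * \<omega> b' y * \<omega> b z) =
        r (\<lambda>a' b'. \<omega> a' y * (\<omega> a x * \<omega> (circ b b') z) + (\<omega> a x * \<omega> (circ b a' + circ a' b) y) * \<omega> b' z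
        + (\<omega> b z * \<omega> (circ a a') x) * \<omega> b' y)"
        by (rule arg_cong[of _ _ r]) (simp add: fun_eq_iff mult_ac)
      also have "\<dots> = - (\<omega> a x * \<omega> (circ b y) z) + \<omega> a x * \<omega> (circ b z + circ z b) y + \<omega> b z * \<omega> (circ a y) x"
        unfolding tensor_apply_add[OF vspace vspace r b12 b3] tensor_apply_add[OF vspace vspace r b1 b2]
        by (simp add: left right lin)
      finally show ?thesis by (simp add: algebra_simps)
    qed
    have lin': "linear_map V ground (\<lambda>b. \<omega> (circ b z + circ z b) y - \<omega> (circ b y) z)"
      by (auto intro!: linear_mapI simp: circ_linear form_simps algebra_simps)
    have lin'': "linear_map V ground (\<lambda>b. \<omega> (circ b y) x)"
      using lin(1)[of y x 1] by simp
    have "nybe_expr V circ r (pair3 \<omega> x y z) = r (\<lambda>a b. r (\<lambda>a' b'. nybe_summand a b a' b' (pair3 \<omega> x y z)))"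
      unfolding nybe_expr_def
      by (rule double_tensor_lift_apply[OF vspace vspace vspace vspace vs smul_tensor_space nybe_quadrilinear r r])
    also have "\<dots> = r (\<lambda>a b. \<omega> a x * (\<omega> (circ b z + circ z b) y - \<omega> (circ b y) z) + \<omega> (circ a y) x * \<omega> b z)"
      by (rule tensor_apply_cong[OF vspace vspace r]) (simp add: tensor3_pair3 inner)
    also have "\<dots> = - (\<omega> (circ x z + circ z x) y - \<omega> (circ x y) z) + \<omega> (circ z y) x"
      by (subst tensor_apply_add[OF vspace vspace r])
        (simp_all add: bilinear_map_mult linear_form_left lin' lin'' left right)
    also have "\<dots> = 0" using novikov_cocycle[of x y z] by (simp add: algebra_simps)
    finally show "nybe_expr V circ r (pair3 \<omega> x y z) = 0" .
  qed
  with r sk show ?thesis by (simp add: skew_nybe_solution_def)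
qed

end

lemma tensor_diff_left:
  "is_vspace V \<Longrightarrow> v \<in> carr V \<Longrightarrow> v' \<in> carr V \<Longrightarrow> w \<in> carr W \<Longrightarrow>
   tensor V W (v - v') w = tensor V W v w - tensor V W v' w"
  using linear_map_diff[OF _ bilinear_map_left[OF bilinear_map_tensor]] by blast

lemma tensor_diff_right:
  "is_vspace W \<Longrightarrow> v \<in> carr V \<Longrightarrow> w \<in> carr W \<Longrightarrow> w' \<in> carr W \<Longrightarrow>
   tensor V W v (w - w') = tensor V W v w - tensor V W v w'"
  using linear_map_diff[OF _ bilinear_map_right[OF bilinear_map_tensor]] by blast

locale novikov_tensor_product = quasi_frobenius_novikov V \<omega> circ
  for V :: "('k::field_char_0, 'v::ab_group_add) vspace" and \<omega> :: "'v \<Rightarrow> 'v \<Rightarrow> 'k"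
    and circ :: "'v \<Rightarrow> 'v \<Rightarrow> 'v" +
  fixes W :: "('k, 'w::ab_group_add) vspace" and GB :: "int \<Rightarrow> 'w set"
    and dia :: "'w \<Rightarrow> 'w \<Rightarrow> 'w" and form :: "'w \<Rightarrow> 'w \<Rightarrow> 'k" and m :: int
  assumes right_novikov: "right_novikov W dia"
    and W_graded: "graded W GB"
    and dia_graded: "b \<in> GB i \<Longrightarrow> b' \<in> GB j \<Longrightarrow> dia b b' \<in> GB (i + j)"
    and bilinear_form: "bilinear_map W W ground form"
    and form_sym: "b \<in> carr W \<Longrightarrow> b' \<in> carr W \<Longrightarrow> form b b' = form b' b"
    and form_nondegenerate: "b \<in> carr W \<Longrightarrow> (\<And>b'. b' \<in> carr W \<Longrightarrow> form b b' = 0) \<Longrightarrow> b = 0"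
    and form_orthogonal: "i + j + m \<noteq> 0 \<Longrightarrow> b \<in> GB i \<Longrightarrow> b' \<in> GB j \<Longrightarrow> form b b' = 0"
    and form_invariant: "a \<in> carr W \<Longrightarrow> b \<in> carr W \<Longrightarrow> c \<in> carr W \<Longrightarrow>
      form (dia a b) c = - form a (dia b c + dia c b)"
begin

lemma W_vspace: "is_vspace W"
  using graded_vspace[OF W_graded] .

lemmas W_closed [simp] =
  vspace_zero[OF W_vspace] vspace_add[OF W_vspace] vspace_scale[OF W_vspace] vspace_neg[OF W_vspace]
  vspace_diff[OF W_vspace]

lemma bilinear_dia: "bilinear_map W W W dia"
  using right_novikov by (simp add: right_novikov_def)

lemma dia_carr [simp]: "b \<in> carr W \<Longrightarrow> b' \<in> carr W \<Longrightarrow> dia b b' \<in> carr W"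
  by (rule bilinear_map_mem[OF bilinear_dia])

lemma dia_linear:
  "x \<in> carr W \<Longrightarrow> x' \<in> carr W \<Longrightarrow> y \<in> carr W \<Longrightarrow> dia (x + x') y = dia x y + dia x' y"
  "x \<in> carr W \<Longrightarrow> y \<in> carr W \<Longrightarrow> y' \<in> carr W \<Longrightarrow> dia x (y + y') = dia x y + dia x y'"
  "x \<in> carr W \<Longrightarrow> y \<in> carr W \<Longrightarrow> dia (smul W c x) y = smul W c (dia x y)"
  "x \<in> carr W \<Longrightarrow> y \<in> carr W \<Longrightarrow> dia x (smul W c y) = smul W c (dia x y)"
  using bilinear_dia by (simp_all add: bilinear_map_def linear_map_def)

lemma form_linear:
  "x \<in> carr W \<Longrightarrow> x' \<in> carr W \<Longrightarrow> y \<in> carr W \<Longrightarrow> form (x + x') y = form x y + form x' y"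
  "x \<in> carr W \<Longrightarrow> y \<in> carr W \<Longrightarrow> y' \<in> carr W \<Longrightarrow> form x (y + y') = form x y + form x y'"
  "x \<in> carr W \<Longrightarrow> y \<in> carr W \<Longrightarrow> form (smul W c x) y = c * form x y"
  "x \<in> carr W \<Longrightarrow> y \<in> carr W \<Longrightarrow> form x (smul W c y) = c * form x y"
  using bilinear_form by (simp_all add: bilinear_map_def linear_map_def)

lemma dia_right_symmetric:
  "a \<in> carr W \<Longrightarrow> b \<in> carr W \<Longrightarrow> c \<in> carr W \<Longrightarrow>
   dia (dia a b) c - dia a (dia b c) = dia (dia a c) b - dia a (dia c b)"
  and dia_left_commutative:
  "a \<in> carr W \<Longrightarrow> b \<in> carr W \<Longrightarrow> c \<in> carr W \<Longrightarrow> dia a (dia b c) = dia b (dia a c)"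
  using right_novikov unfolding right_novikov_def by blast+

lemma form_dia_swap:
  "a \<in> carr W \<Longrightarrow> b \<in> carr W \<Longrightarrow> c \<in> carr W \<Longrightarrow> form (dia a b) c = form (dia a c) b"
  by (simp add: form_invariant add.commute)

lemma form_dia_cyclic:
  assumes "a \<in> carr W" "b \<in> carr W" "c \<in> carr W"
  shows "form (dia a b) c + form (dia b c) a + form (dia c a) b = 0"
  using form_invariant[of a b c] assms form_sym[of a "dia b c"] form_sym[of a "dia c b"] form_dia_swap[of c b a]
  by (simp add: form_linear)

abbreviation "L \<equiv> tensor_space V W"
abbreviation "G \<equiv> induced_grading V W GB"
abbreviation "br \<equiv> induced_bracket V W circ dia"

lemma L_vspace: "is_vspace L"
  by (rule tensor_vspace)

lemmas L_closed [simp] =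
  vspace_zero[OF L_vspace] vspace_add[OF L_vspace] vspace_neg[OF L_vspace] vspace_diff[OF L_vspace]

lemma L_scale [simp]: "x \<in> carr L \<Longrightarrow> fun_scale c x \<in> carr L"
  using vspace_scale[OF L_vspace, of x c] by simp

subsection \<open>The skew form\<close>

text \<open>The form \<open>\<omega> \<otimes> (\<cdot>, \<cdot>)\<close>. It is skew because exactly one of its factors is.\<close>

definition tensor_form where
  "tensor_form t t' =
     tensor_lift V W (\<lambda>a b. tensor_lift V W (\<lambda>a' b'. \<omega> a a' * form b b') t') t"

lemma form_quadrilinear: "quadrilinear_map V W V W ground (\<lambda>a b a' b'. \<omega> a a' * form b b')"
  unfolding quadrilinear_map_def
  by (auto intro!: bilinear_mapI simp: form_linear form_simps algebra_simps)

lemma bilinear_tensor_form: "bilinear_map L L ground tensor_form"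
  unfolding tensor_form_def
  by (rule bilinear_map_double_lift[OF vspace W_vspace vspace W_vspace is_vspace_ground form_quadrilinear])

lemma tensor_form_tensor:
  "a \<in> carr V \<Longrightarrow> b \<in> carr W \<Longrightarrow> a' \<in> carr V \<Longrightarrow> b' \<in> carr W \<Longrightarrow>
   tensor_form (tensor V W a b) (tensor V W a' b') = \<omega> a a' * form b b'"
  unfolding tensor_form_def
  by (rule double_tensor_lift_tensor[OF vspace W_vspace vspace W_vspace is_vspace_ground form_quadrilinear])

lemma tensor_form_tensor_left:
  assumes "a \<in> carr V" "b \<in> carr W" "t \<in> carr L"
  shows "tensor_form (tensor V W a b) t = t (\<lambda>a' b'. \<omega> a a' * form b b')"
  by (rule linear_map_tensor_eqI[OF vspace W_vspace
        bilinear_map_right[OF bilinear_tensor_form tensor_mem[OF assms(1,2)]] linear_map_apply_tensor _ assms(3)])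
    (simp add: assms tensor_form_tensor tensor_apply bilinear_map_mult linear_form_right
       bilinear_map_right[OF bilinear_form])

lemma tensor_form_skew:
  assumes x: "x \<in> carr L" and y: "y \<in> carr L"
  shows "tensor_form x y = - tensor_form y x"
proof -
  have neg: "linear_map L ground (\<lambda>x. - f x)" if "linear_map L ground f" for f
    using that by (simp add: linear_map_def)
  note left = bilinear_map_left[OF bilinear_tensor_form] and right = bilinear_map_right[OF bilinear_tensor_form]
  have "tensor_form (tensor V W a b) y = - tensor_form y (tensor V W a b)"
    if ab: "a \<in> carr V" "b \<in> carr W" for a b
  proof (rule linear_map_tensor_eqI[OF vspace W_vspace right neg[OF left] _ y])
    fix a' b' assume "a' \<in> carr V" "b' \<in> carr W"
    then show "tensor_form (tensor V W a b) (tensor V W a' b') = - tensor_form (tensor V W a' b') (tensor V W a b)"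
      using ab skew[of a a'] form_sym[of b b'] by (simp add: tensor_form_tensor)
  qed (simp_all add: ab tensor_mem)
  from linear_map_tensor_eqI[OF vspace W_vspace left[OF y] neg[OF right[OF y]] this x]
  show ?thesis .
qed

lemma tensor_form_nondegenerate:
  assumes t: "t \<in> carr L" and 0: "\<And>u. u \<in> carr L \<Longrightarrow> tensor_form t u = 0"
  shows "t = 0"
proof (rule tensor_separated[OF vspace W_vspace t])
  show "linear_map V ground \<phi>" if "\<phi> \<in> \<omega> ` carr V" for \<phi>
    using that linear_form_right by blast
  show "linear_map W ground \<psi>" if "\<psi> \<in> form ` carr W" for \<psi>
    using that bilinear_map_right[OF bilinear_form] by blast
  show "v = 0" if "v \<in> carr V" "\<And>\<phi>. \<phi> \<in> \<omega> ` carr V \<Longrightarrow> \<phi> v = 0" for v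
  proof (rule nondegenerate[OF that(1)])
    fix y assume y: "y \<in> carr V"
    then show "\<omega> v y = 0" using skew[OF that(1) y] that(2)[of "\<omega> y"] by simp
  qed
  show "w = 0" if "w \<in> carr W" "\<And>\<psi>. \<psi> \<in> form ` carr W \<Longrightarrow> \<psi> w = 0" for w
  proof (rule form_nondegenerate[OF that(1)])
    fix y assume y: "y \<in> carr W"
    then show "form w y = 0" using form_sym[OF that(1) y] that(2)[of "form y"] by simp
  qed
  fix \<phi> \<psi> assume "\<phi> \<in> \<omega> ` carr V" "\<psi> \<in> form ` carr W"
  then obtain a b where ab: "a \<in> carr V" "b \<in> carr W" "\<phi> = \<omega> a" "\<psi> = form b" by blast
  then show "t (\<lambda>v w. \<phi> v * \<psi> w) = 0"
    using tensor_form_tensor_left[OF ab(1,2) t] tensor_form_skew[OF t tensor_mem[OF ab(1,2)]]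
      0[OF tensor_mem[OF ab(1,2)]] by simp
qed

subsection \<open>The grading\<close>

definition hcB :: "int \<Rightarrow> 'w \<Rightarrow> 'w" where "hcB = hom_comp GB"

lemma hcB_carr [simp]: "b \<in> carr W \<Longrightarrow> hcB i b \<in> carr W"
  unfolding hcB_def by (rule hom_comp_carr[OF W_graded])

lemma linear_hcB: "linear_map W W (hcB i)"
  unfolding hcB_def by (rule linear_map_hom_comp[OF W_graded])

text \<open>The candidates \<open>id \<otimes> \<pi>\<^sub>i\<close> for the homogeneous components of \<open>V \<otimes> W\<close>.\<close>

definition proj :: "int \<Rightarrow> (('v \<Rightarrow> 'w \<Rightarrow> 'k) \<Rightarrow> 'k) \<Rightarrow> (('v \<Rightarrow> 'w \<Rightarrow> 'k) \<Rightarrow> 'k)" where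
  "proj i = tensor_map V W V W id (hcB i)"

lemma linear_proj: "linear_map L L (proj i)"
  unfolding proj_def by (rule linear_map_tensor_map[OF vspace W_vspace linear_map_id(2) linear_hcB])

lemma proj_tensor: "a \<in> carr V \<Longrightarrow> b \<in> carr W \<Longrightarrow> proj i (tensor V W a b) = tensor V W a (hcB i b)"
  unfolding proj_def using tensor_map_tensor[OF linear_map_id(2) linear_hcB] by simp

lemma proj_mem: "t \<in> carr L \<Longrightarrow> proj i t \<in> G i"
  unfolding proj_def induced_grading_def
  by (rule tensor_map_mem_sub_tensor[OF vspace W_vspace linear_map_id(2) linear_hcB])
    (simp_all add: hcB_def hom_comp_mem[OF W_graded])

lemma GB_subset: "GB i \<subseteq> carr W"
  using graded_subset[OF W_graded] by blast

lemma GB_carr: "b \<in> GB i \<Longrightarrow> b \<in> carr W"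
  using GB_subset by blast

lemma G_subset: "G i \<subseteq> carr L"
  unfolding induced_grading_def tensor_space_def
  using sub_tensor_mono[OF order.refl GB_subset] by simp

lemma G_vspace: "is_vspace \<lparr>carr = G i, smul = fun_scale\<rparr>"
  unfolding induced_grading_def by (rule sub_tensor_vspace)

lemma G_add: "x \<in> G i \<Longrightarrow> y \<in> G i \<Longrightarrow> x + y \<in> G i"
  using vspace_add[OF G_vspace, of x i y] by simp

lemma V_carr_vspace: "is_vspace \<lparr>carr = carr V, smul = smul V\<rparr>"
  using vspace by (simp add: is_vspace_def)

lemma G_induct [consumes 1, case_names tensor add]:
  assumes "t \<in> G i" "\<And>a b. a \<in> carr V \<Longrightarrow> b \<in> GB i \<Longrightarrow> P (tensor V W a b)"
    "\<And>t u. t \<in> G i \<Longrightarrow> u \<in> G i \<Longrightarrow> P t \<Longrightarrow> P u \<Longrightarrow> P (t + u)"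
  shows "P t"
  by (rule sub_tensor_induct[of t V W "carr V" "GB i" P])
    (use assms GB_subset V_carr_vspace graded_zero[OF W_graded] in \<open>simp_all add: induced_grading_def\<close>)

lemma tensor_zero_right: "a \<in> carr V \<Longrightarrow> tensor V W a 0 = 0"
  by (rule linear_map_zero[OF W_vspace bilinear_map_right[OF bilinear_map_tensor]])

lemma proj_homogeneous:
  assumes "x \<in> G i"
  shows "proj j x = (if j = i then x else 0)"
  using assms
proof (induct x rule: G_induct)
  case (tensor a b)
  have "proj j (tensor V W a b) = (if j = i then tensor V W a b else 0)"
    using tensor GB_carr[OF tensor(2)] hom_comp_homogeneous[OF W_graded tensor(2), of j]
    by (simp add: proj_tensor hcB_def tensor_zero_right)
  then show ?case .
next
  case (add t u)
  have "proj j (t + u) = (if j = i then t + u else 0)"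
    using linear_map_add[OF linear_proj subsetD[OF G_subset add(1)] subsetD[OF G_subset add(2)]] add(3,4)
    by (simp add: fun_eq_iff)
  then show ?case .
qed

lemma proj_sum:
  assumes "x \<in> carr L"
  shows "\<exists>F. finite F \<and> (\<forall>i. i \<notin> F \<longrightarrow> proj i x = 0) \<and> x = (\<Sum>i\<in>F. proj i x)"
  using vspace W_vspace assms
proof (induct x rule: tensor_induct)
  case (tensor a b)
  let ?F = "{i. hcB i b \<noteq> 0}"
  have "finite ?F" unfolding hcB_def by (rule finite_hom_comp[OF W_graded tensor(2)])
  moreover have "proj i (tensor V W a b) = 0" if "i \<notin> ?F" for i
    using that tensor by (simp add: proj_tensor tensor_zero_right)
  moreover have "tensor V W a (\<Sum>i\<in>?F. hcB i b) = (\<Sum>i\<in>?F. proj i (tensor V W a b))"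
    using linear_map_sum[OF W_vspace bilinear_map_right[OF bilinear_map_tensor[of V W] tensor(1)], of ?F "\<lambda>i. hcB i b"]
      tensor by (simp add: proj_tensor)
  then have "tensor V W a b = (\<Sum>i\<in>?F. proj i (tensor V W a b))"
    by (simp only: sum_hom_comp[OF W_graded tensor(2), folded hcB_def])
  ultimately show ?case by blast
next
  case (add t u)
  then obtain F F' where F: "finite F" "\<And>i. i \<notin> F \<Longrightarrow> proj i t = 0" "t = (\<Sum>i\<in>F. proj i t)"
    and F': "finite F'" "\<And>i. i \<notin> F' \<Longrightarrow> proj i u = 0" "u = (\<Sum>i\<in>F'. proj i u)" by blast
  have p: "proj i (t + u) = proj i t + proj i u" for i
    using linear_map_add[OF linear_proj add(1,2)] .
  have "(\<Sum>i\<in>F. proj i t) = (\<Sum>i\<in>F \<union> F'. proj i t)" "(\<Sum>i\<in>F'. proj i u) = (\<Sum>i\<in>F \<union> F'. proj i u)"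
    by (rule sum.mono_neutral_left; use F F' in auto)+
  then have "t + u = (\<Sum>i\<in>F \<union> F'. proj i (t + u))"
    using F(3) F'(3) by (simp only: p sum.distrib)
  moreover have "finite (F \<union> F')" using F(1) F'(1) by simp
  moreover have "\<forall>i. i \<notin> F \<union> F' \<longrightarrow> proj i (t + u) = 0" using F(2) F'(2) by (simp add: p)
  ultimately have "finite (F \<union> F') \<and> (\<forall>i. i \<notin> F \<union> F' \<longrightarrow> proj i (t + u) = 0) \<and> t + u = (\<Sum>i\<in>F \<union> F'. proj i (t + u))"
    by blast
  then show ?case by (rule exI)
qed

lemma L_graded: "graded L G" and hom_comp_L: "x \<in> carr L \<Longrightarrow> hom_comp G i x = proj i x"
proof -
  have sub: "module.subspace (smul L) (G i)" for i
    using G_vspace[of i] by (simp add: is_vspace_def)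
  show "graded L G"
    by (rule graded_by_projections(1)[OF L_vspace sub G_subset linear_proj proj_mem proj_homogeneous proj_sum])
  show "x \<in> carr L \<Longrightarrow> hom_comp G i x = proj i x"
    by (rule graded_by_projections(2)[OF L_vspace sub G_subset linear_proj proj_mem proj_homogeneous proj_sum])
qed

lemma tensor_form_orthogonal:
  assumes ij: "i + j + m \<noteq> 0" and x: "x \<in> G i" and y: "y \<in> G j"
  shows "tensor_form x y = 0"
  using x
proof (induct x rule: G_induct)
  case (tensor a b)
  from y show ?case
  proof (induct y rule: G_induct)
    case (tensor a' b')
    then show ?case
      using \<open>a \<in> carr V\<close> \<open>b \<in> GB i\<close> form_orthogonal[OF ij, of b b'] GB_carr[of b] GB_carr[of b']
      by (simp add: tensor_form_tensor)
  next
    case (add t u)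
    have "tensor V W a b \<in> carr L"
      using \<open>a \<in> carr V\<close> GB_carr[OF \<open>b \<in> GB i\<close>] by (rule tensor_mem)
    then have "tensor_form (tensor V W a b) (t + u) = 0"
      using linear_map_add[OF bilinear_map_right[OF bilinear_tensor_form] subsetD[OF G_subset add(1)] subsetD[OF G_subset add(2)]]
        add(3,4) by simp
    then show ?case .
  qed
next
  case (add t u)
  have "tensor_form (t + u) y = 0"
    using linear_map_add[OF bilinear_map_left[OF bilinear_tensor_form subsetD[OF G_subset y]]
        subsetD[OF G_subset add(1)] subsetD[OF G_subset add(2)]] add(3,4) by simp
  then show ?case .
qed

lemma graded_skew_form_tensor: "graded_skew_form L tensor_form G m"
  by unfold_locales
    (fact tensor_vspace bilinear_tensor_form tensor_form_skew tensor_form_nondegenerate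
      L_graded tensor_form_orthogonal)+

subsection \<open>The Lie bracket\<close>

lemma bracket_quadrilinear:
  "quadrilinear_map V W V W L (\<lambda>a b a' b'. tensor V W (circ a a') (dia b b') - tensor V W (circ a' a) (dia b' b))"
proof -
  interpret K: vector_space "fun_scale :: 'k \<Rightarrow> (('v \<Rightarrow> 'w \<Rightarrow> 'k) \<Rightarrow> 'k) \<Rightarrow> _"
    by (rule vector_space_fun_scale)
  show ?thesis
    unfolding quadrilinear_map_def
    by (intro conjI ballI bilinear_mapI)
      (simp_all add: tensor_mem circ_linear dia_linear tensor_add_left tensor_add_right tensor_scale_left
        tensor_scale_right K.scale_right_diff_distrib)
qed

lemma bilinear_br: "bilinear_map L L L br"
  unfolding induced_bracket_def
  by (rule bilinear_map_double_lift[OF vspace W_vspace vspace W_vspace L_vspace bracket_quadrilinear])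

lemma br_tensor:
  "a \<in> carr V \<Longrightarrow> b \<in> carr W \<Longrightarrow> a' \<in> carr V \<Longrightarrow> b' \<in> carr W \<Longrightarrow>
   br (tensor V W a b) (tensor V W a' b') =
     tensor V W (circ a a') (dia b b') - tensor V W (circ a' a) (dia b' b)"
  unfolding induced_bracket_def
  by (rule double_tensor_lift_tensor[OF vspace W_vspace vspace W_vspace L_vspace bracket_quadrilinear])

lemma br_carr [simp]: "x \<in> carr L \<Longrightarrow> y \<in> carr L \<Longrightarrow> br x y \<in> carr L"
  by (rule bilinear_map_mem[OF bilinear_br])

lemmas br_left = bilinear_map_left[OF bilinear_br]
lemmas br_right = bilinear_map_right[OF bilinear_br]

lemma linear_map_uminus: "linear_map L L f \<Longrightarrow> linear_map L L (\<lambda>x. - f x)"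
  by (simp add: linear_map_def) (simp add: fun_scale_def fun_eq_iff)

lemma br_anticommutative:
  assumes x: "x \<in> carr L" and y: "y \<in> carr L"
  shows "br x y = - br y x"
proof -
  have "br (tensor V W a b) y = - br y (tensor V W a b)" if ab: "a \<in> carr V" "b \<in> carr W" for a b
    by (rule linear_map_tensor_eqI[OF vspace W_vspace br_right linear_map_uminus[OF br_left] _ y])
      (simp_all add: ab tensor_mem br_tensor)
  from linear_map_tensor_eqI[OF vspace W_vspace br_left[OF y] linear_map_uminus[OF br_right[OF y]] this x]
  show ?thesis .
qed

text \<open>Here the characteristic enters: anticommutativity only says that twice the bracket is zero.\<close>

lemma br_self:
  assumes "x \<in> carr L"
  shows "br x x = 0"
proof
  fix \<beta>
  have "br x x \<beta> = - br x x \<beta>" using br_anticommutative[OF assms assms] by (metis uminus_apply)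
  then show "br x x \<beta> = 0 \<beta>" by simp
qed

text \<open>The identities of the second factor are those of the opposite of a Novikov algebra; this makes
  the twelve products of monomials cancel.\<close>

lemma jacobi_tensor:
  assumes [simp]: "a\<^sub>1 \<in> carr V" "a\<^sub>2 \<in> carr V" "a\<^sub>3 \<in> carr V" "b\<^sub>1 \<in> carr W" "b\<^sub>2 \<in> carr W" "b\<^sub>3 \<in> carr W"
  defines "x \<equiv> tensor V W a\<^sub>1 b\<^sub>1" and "y \<equiv> tensor V W a\<^sub>2 b\<^sub>2" and "z \<equiv> tensor V W a\<^sub>3 b\<^sub>3"
  shows "br x (br y z) + br y (br z x) + br z (br x y) = 0"
proof -
  let ?T = "tensor V W"
  have diff: "br (?T a b) (?T c d - ?T c' d') = br (?T a b) (?T c d) - br (?T a b) (?T c' d')"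
    if "a \<in> carr V" "b \<in> carr W" "c \<in> carr V" "d \<in> carr W" "c' \<in> carr V" "d' \<in> carr W" for a b c d c' d'
    by (rule linear_map_diff[OF L_vspace br_right]) (simp_all add: that tensor_mem)
  have A: "?T (circ a (circ b c)) w = ?T (circ b (circ a c)) w + ?T (circ (circ a b) c) w - ?T (circ (circ b a) c) w"
    if [simp]: "a \<in> carr V" "b \<in> carr V" "c \<in> carr V" "w \<in> carr W" for a b c w
  proof -
    have "circ a (circ b c) = circ b (circ a c) + circ (circ a b) c - circ (circ b a) c"
      using novikov_left_symmetric[of a b c] by (simp add: algebra_simps)
    then show ?thesis
      by (simp add: tensor_add_left tensor_diff_left[OF vspace])
  qed
  have B: "?T v (dia (dia a b) c) = ?T v (dia (dia a c) b) + ?T v (dia a (dia b c)) - ?T v (dia a (dia c b))"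
    if [simp]: "a \<in> carr W" "b \<in> carr W" "c \<in> carr W" "v \<in> carr V" for a b c v
  proof -
    have "dia (dia a b) c = dia (dia a c) b + dia a (dia b c) - dia a (dia c b)"
      using dia_right_symmetric[of a b c] by (simp add: algebra_simps)
    then show ?thesis
      by (simp add: tensor_add_right tensor_diff_right[OF W_vspace])
  qed
  show ?thesis
    unfolding x_def y_def z_def
    apply (simp add: br_tensor diff)
    \<comment> \<open>Used in the even orderings only, \<open>A\<close> and \<open>B\<close> trade even products for odd ones; then all
      terms cancel in pairs.\<close>
    apply (simp add: A[of a\<^sub>1 a\<^sub>2 a\<^sub>3] A[of a\<^sub>2 a\<^sub>3 a\<^sub>1] A[of a\<^sub>3 a\<^sub>1 a\<^sub>2]
      novikov_right_commutative[of a\<^sub>1 a\<^sub>3 a\<^sub>2] novikov_right_commutative[of a\<^sub>2 a\<^sub>1 a\<^sub>3]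
      novikov_right_commutative[of a\<^sub>3 a\<^sub>2 a\<^sub>1]
      B[of b\<^sub>1 b\<^sub>2 b\<^sub>3] B[of b\<^sub>2 b\<^sub>3 b\<^sub>1] B[of b\<^sub>3 b\<^sub>1 b\<^sub>2]
      dia_left_commutative[of b\<^sub>1 b\<^sub>2 b\<^sub>3] dia_left_commutative[of b\<^sub>2 b\<^sub>3 b\<^sub>1] dia_left_commutative[of b\<^sub>3 b\<^sub>1 b\<^sub>2])
    done
qed

lemma jacobi:
  assumes x: "x \<in> carr L" and y: "y \<in> carr L" and z: "z \<in> carr L"
  shows "br x (br y z) + br y (br z x) + br z (br x y) = 0"
proof -
  let ?J = "\<lambda>x y z. br x (br y z) + br y (br z x) + br z (br x y)"
  note plus = linear_map_plus[OF L_vspace] and comp = linear_map_comp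
  have zero: "linear_map L L (\<lambda>_. 0)"
    by (simp add: linear_map_def fun_scale_def fun_eq_iff)
  have l1: "linear_map L L (\<lambda>x. ?J x y z)" if "y \<in> carr L" "z \<in> carr L" for y z
    by (intro plus br_left comp[OF br_right br_right] comp[OF br_left br_right] br_carr that)
  have l2: "linear_map L L (\<lambda>y. ?J x y z)" if "x \<in> carr L" "z \<in> carr L" for x z
    by (intro plus br_left comp[OF br_left br_right] comp[OF br_right br_right] br_carr that)
  have l3: "linear_map L L (\<lambda>z. ?J x y z)" if "x \<in> carr L" "y \<in> carr L" for x y
    by (intro plus br_left comp[OF br_left br_right] comp[OF br_right br_right] br_carr that)
  have 1: "?J (tensor V W a b) (tensor V W a' b') z = 0"
    if ab: "a \<in> carr V" "b \<in> carr W" "a' \<in> carr V" "b' \<in> carr W" for a b a' b'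
    by (rule linear_map_tensor_eqI[OF vspace W_vspace l3 zero _ z])
      (simp_all add: tensor_mem ab jacobi_tensor)
  have 2: "?J (tensor V W a b) y z = 0" if ab: "a \<in> carr V" "b \<in> carr W" for a b
    by (rule linear_map_tensor_eqI[OF vspace W_vspace l2[OF _ z] zero 1[OF ab] y]) (simp add: tensor_mem ab)
  show ?thesis
    by (rule linear_map_tensor_eqI[OF vspace W_vspace l1[OF y z] zero 2 x])
qed

lemma L_lie: "lie_algebra L br"
  unfolding lie_algebra_def using L_vspace bilinear_br br_self jacobi by blast

lemma br_graded:
  assumes x: "x \<in> G i" and y: "y \<in> G j"
  shows "br x y \<in> G (i + j)"
  using x
proof (induct x rule: G_induct)
  case (tensor a b)
  note ab = tensor GB_carr[OF tensor(2)]
  have mem: "tensor V W a b \<in> carr L" using ab by (simp add: tensor_mem)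
  from y show ?case
  proof (induct y rule: G_induct)
    case (tensor a' b')
    have "tensor V W (circ a a') (dia b b') \<in> G (i + j)" "tensor V W (circ a' a) (dia b' b) \<in> G (i + j)"
      unfolding induced_grading_def
      using ab tensor dia_graded[of b i b' j] dia_graded[of b' j b i]
      by (auto intro!: tensor_mem_sub_tensor simp: add.commute)
    then have "tensor V W (circ a a') (dia b b') - tensor V W (circ a' a) (dia b' b) \<in> G (i + j)"
      using vspace_diff[OF G_vspace, of _ "i + j"] by simp
    then show ?case
      using ab tensor GB_carr[OF tensor(2)] by (simp only: br_tensor)
  next
    case (add t u)
    have "br (tensor V W a b) (t + u) \<in> G (i + j)"
      using linear_map_add[OF br_right[OF mem] subsetD[OF G_subset add(1)] subsetD[OF G_subset add(2)]]
        add(3,4) by (simp add: G_add)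
    then show ?case .
  qed
next
  case (add t u)
  have "br (t + u) y \<in> G (i + j)"
    using linear_map_add[OF br_left[OF subsetD[OF G_subset y]] subsetD[OF G_subset add(1)] subsetD[OF G_subset add(2)]]
      add(3,4) by (simp add: G_add)
  then show ?case .
qed

text \<open>With \<open>T\<^sub>i\<close> the common value of \<open>(b\<^sub>i \<diamondop> b\<^sub>j, b\<^sub>k)\<close> and \<open>(b\<^sub>i \<diamondop> b\<^sub>k, b\<^sub>j)\<close>, and \<open>D\<close> the cyclically invariant
  difference on the other factor, the sum is \<open>D (T\<^sub>1 + T\<^sub>2 + T\<^sub>3) = 0\<close>.\<close>

lemma cocycle_tensor:
  assumes [simp]: "a\<^sub>1 \<in> carr V" "a\<^sub>2 \<in> carr V" "a\<^sub>3 \<in> carr V" "b\<^sub>1 \<in> carr W" "b\<^sub>2 \<in> carr W" "b\<^sub>3 \<in> carr W"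
  defines "x \<equiv> tensor V W a\<^sub>1 b\<^sub>1" and "y \<equiv> tensor V W a\<^sub>2 b\<^sub>2" and "z \<equiv> tensor V W a\<^sub>3 b\<^sub>3"
  shows "tensor_form (br x y) z + tensor_form (br y z) x + tensor_form (br z x) y = 0"
proof -
  let ?T = "tensor V W"
  let ?D = "\<omega> (circ a\<^sub>1 a\<^sub>2) a\<^sub>3 - \<omega> (circ a\<^sub>1 a\<^sub>3) a\<^sub>2"
  have diff: "tensor_form (?T c d - ?T c' d') (?T a b) = \<omega> c a * form d b - \<omega> c' a * form d' b"
    if "a \<in> carr V" "b \<in> carr W" "c \<in> carr V" "d \<in> carr W" "c' \<in> carr V" "d' \<in> carr W" for a b c d c' d'
    using linear_map_diff[OF L_vspace bilinear_map_left[OF bilinear_tensor_form], of "?T a b" "?T c d" "?T c' d'"]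
    by (simp add: that tensor_mem tensor_form_tensor)
  have W: "\<omega> (circ a\<^sub>1 a\<^sub>2) a\<^sub>3 = \<omega> (circ a\<^sub>1 a\<^sub>3) a\<^sub>2 + ?D"
    "\<omega> (circ a\<^sub>2 a\<^sub>3) a\<^sub>1 = \<omega> (circ a\<^sub>2 a\<^sub>1) a\<^sub>3 + ?D"
    "\<omega> (circ a\<^sub>3 a\<^sub>1) a\<^sub>2 = \<omega> (circ a\<^sub>3 a\<^sub>2) a\<^sub>1 + ?D"
    using novikov_cocycle[of a\<^sub>1 a\<^sub>2 a\<^sub>3] novikov_cocycle[of a\<^sub>2 a\<^sub>3 a\<^sub>1] novikov_cocycle[of a\<^sub>3 a\<^sub>1 a\<^sub>2]
    by (simp_all add: form_simps algebra_simps)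
  have "tensor_form (br x y) z + tensor_form (br y z) x + tensor_form (br z x) y =
      ?D * (form (dia b\<^sub>1 b\<^sub>2) b\<^sub>3 + form (dia b\<^sub>2 b\<^sub>3) b\<^sub>1 + form (dia b\<^sub>3 b\<^sub>1) b\<^sub>2)"
    unfolding x_def y_def z_def
    apply (simp add: br_tensor diff form_dia_swap[of b\<^sub>1 b\<^sub>3 b\<^sub>2] form_dia_swap[of b\<^sub>2 b\<^sub>1 b\<^sub>3]
      form_dia_swap[of b\<^sub>3 b\<^sub>2 b\<^sub>1])
    apply (subst W(2), subst W(3))
    apply (simp add: algebra_simps)
    done
  then show ?thesis using form_dia_cyclic[of b\<^sub>1 b\<^sub>2 b\<^sub>3] by simp
qed

lemma tensor_form_cocycle:
  assumes x: "x \<in> carr L" and y: "y \<in> carr L" and z: "z \<in> carr L"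
  shows "tensor_form (br x y) z + tensor_form (br y z) x + tensor_form (br z x) y = 0"
proof -
  let ?C = "\<lambda>x y z. tensor_form (br x y) z + tensor_form (br y z) x + tensor_form (br z x) y"
  note plus = linear_map_plus[OF is_vspace_ground] and comp = linear_map_comp
  note left = bilinear_map_left[OF bilinear_tensor_form] and right = bilinear_map_right[OF bilinear_tensor_form]
  have zero: "linear_map L ground (\<lambda>_. 0)" by (simp add: linear_map_def)
  have l1: "linear_map L ground (\<lambda>x. ?C x y z)" if "y \<in> carr L" "z \<in> carr L" for y z
    by (intro plus right comp[OF br_left left] comp[OF br_right left] br_carr that)
  have l2: "linear_map L ground (\<lambda>y. ?C x y z)" if "x \<in> carr L" "z \<in> carr L" for x z
    by (intro plus right comp[OF br_left left] comp[OF br_right left] br_carr that)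
  have l3: "linear_map L ground (\<lambda>z. ?C x y z)" if "x \<in> carr L" "y \<in> carr L" for x y
    by (intro plus right comp[OF br_left left] comp[OF br_right left] br_carr that)
  have 1: "?C (tensor V W a b) (tensor V W a' b') z = 0"
    if ab: "a \<in> carr V" "b \<in> carr W" "a' \<in> carr V" "b' \<in> carr W" for a b a' b'
    by (rule linear_map_tensor_eqI[OF vspace W_vspace l3 zero _ z])
      (simp_all add: tensor_mem ab cocycle_tensor)
  have 2: "?C (tensor V W a b) y z = 0" if ab: "a \<in> carr V" "b \<in> carr W" for a b
    by (rule linear_map_tensor_eqI[OF vspace W_vspace l2[OF _ z] zero 1[OF ab] y]) (simp add: tensor_mem ab)
  show ?thesis
    by (rule linear_map_tensor_eqI[OF vspace W_vspace l1[OF y z] zero 2 x])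
qed

end

section \<open>The canonical tensor of dual bases\<close>

lemma linear_functional_sum:
  "(\<And>i. i \<in> I \<Longrightarrow> linear_map V ground (f i)) \<Longrightarrow> linear_map V ground (\<lambda>x. \<Sum>i\<in>I. f i x)"
  by (simp add: linear_map_def sum.distrib sum_distrib_left)

lemma linear_functional_combination:
  "linear_map V ground f \<Longrightarrow> linear_map V ground g \<Longrightarrow> linear_map V ground (\<lambda>x. f x * c - g x * d)"
  by (simp add: linear_map_def algebra_simps)

lemma linear_functional_combination':
  "linear_map V ground f \<Longrightarrow> linear_map V ground g \<Longrightarrow> linear_map V ground (\<lambda>x. c * f x - d * g x)"
  by (simp add: linear_map_def algebra_simps)

context novikov_tensor_product
begin

lemma finite_basis_degree:
  assumes b: "homogeneous_basis W GB \<Pi> b" and fin: "\<exists>F. finite F \<and> module.span (smul W) F = GB i"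
  shows "finite {p \<in> \<Pi>. b p \<in> GB i}"
proof -
  interpret W: vector_space "smul W" using W_vspace by (rule vspace_vector_space)
  obtain F where F: "finite F" "W.span F = GB i" using fin by blast
  let ?P = "{p \<in> \<Pi>. b p \<in> GB i}"
  have "W.independent (b ` \<Pi>)" and inj: "inj_on b \<Pi>"
    using b by (auto simp: homogeneous_basis_def is_basis_def)
  then have "W.independent (b ` ?P)" by (rule_tac W.independent_mono) auto
  then have "finite (b ` ?P)" using W.independent_span_bound[OF F(1)] F(2) by blast
  then show ?thesis using inj_on_subset[OF inj, of ?P] by (simp add: finite_image_iff)
qed

text \<open>Only basis vectors of degree \<open>i\<close> pair nontrivially with \<open>u\<close>, so the completeness relation of
  the dual bases holds already for the finite sum over that degree.\<close>

lemma sum_dual_bases: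
  assumes b: "homogeneous_basis W GB \<Pi> b" and c: "\<And>p. p \<in> \<Pi> \<Longrightarrow> c p \<in> carr W"
    and dual: "\<And>p q. p \<in> \<Pi> \<Longrightarrow> q \<in> \<Pi> \<Longrightarrow> form (b p) (c q) = (if p = q then 1 else 0)"
    and fin: "finite {p \<in> \<Pi>. b p \<in> GB i}"
    and u: "u \<in> GB (- m - i)" and v: "v \<in> carr W"
  shows "(\<Sum>p | p \<in> \<Pi> \<and> b p \<in> GB i. form (b p) u * form (c p) v) = form u v"
proof -
  interpret W: vector_space "smul W" using W_vspace by (rule vspace_vector_space)
  let ?P = "{p \<in> \<Pi>. b p \<in> GB i}"
  have inj: "inj_on b \<Pi>" and span: "W.span (b ` \<Pi>) = carr W" and hom: "\<And>p. p \<in> \<Pi> \<Longrightarrow> \<exists>i. b p \<in> GB i"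
    using b by (auto simp: homogeneous_basis_def is_basis_def)
  have bW: "b p \<in> carr W" if "p \<in> \<Pi>" for p using hom[OF that] GB_carr by blast
  note uW = GB_carr[OF u]
  have "v \<in> W.span (b ` \<Pi>)" using v span by simp
  then obtain T k where T: "finite T" "T \<subseteq> b ` \<Pi>" "v = (\<Sum>x\<in>T. smul W (k x) x)"
    by (auto simp: W.span_explicit)
  define Q where "Q = {p \<in> \<Pi>. b p \<in> T}"
  have Q: "finite Q" "Q \<subseteq> \<Pi>"
    unfolding Q_def using T(1) inj by (auto intro!: finite_inverse_image_gen)
  have bQ: "b ` Q = T" using T(2) by (auto simp: Q_def)
  have v_eq: "v = (\<Sum>p\<in>Q. smul W (k (b p)) (b p))"
    unfolding T(3) bQ[symmetric] using inj_on_subset[OF inj Q(2)] by (simp add: sum.reindex)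
  have expand: "form x v = (\<Sum>p\<in>Q. k (b p) * form x (b p))" if x: "x \<in> carr W" for x
  proof -
    have "form x v = (\<Sum>p\<in>Q. form x (smul W (k (b p)) (b p)))"
      unfolding v_eq
      by (rule linear_map_sum[OF W_vspace bilinear_map_right[OF bilinear_form x]]) (use Q bW in auto)
    also have "\<dots> = (\<Sum>p\<in>Q. k (b p) * form x (b p))"
      using Q(2) x bW by (intro sum.cong) (auto simp: form_linear)
    finally show ?thesis .
  qed
  have coeff: "form (c q) v = (if q \<in> Q then k (b q) else 0)" if q: "q \<in> \<Pi>" for q
  proof -
    have "form (c q) v = (\<Sum>p\<in>Q. if p = q then k (b p) else 0)"
      unfolding expand[OF c[OF q]]
      using Q(2) bW c q by (intro sum.cong) (auto simp: form_sym[of "c q"] dual)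
    then show ?thesis using Q(1) by (simp add: sum.delta')
  qed
  have "form u v = (\<Sum>p\<in>Q. k (b p) * form u (b p))" by (rule expand[OF uW])
  also have "\<dots> = (\<Sum>p\<in>Q. form (b p) u * form (c p) v)"
    using Q(2) bW uW by (intro sum.cong) (auto simp: coeff form_sym[of u])
  also have "\<dots> = (\<Sum>p\<in>?P \<union> Q. form (b p) u * form (c p) v)"
    by (rule sum.mono_neutral_left) (use fin Q coeff in auto)
  also have "\<dots> = (\<Sum>p\<in>?P. form (b p) u * form (c p) v)"
  proof (rule sum.mono_neutral_right)
    show "\<forall>p\<in>?P \<union> Q - ?P. form (b p) u * form (c p) v = 0"
    proof
      fix p assume p: "p \<in> ?P \<union> Q - ?P"
      then have "p \<in> \<Pi>" using Q(2) by blast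
      then obtain j where "b p \<in> GB j" "j \<noteq> i" using hom p by blast
      then show "form (b p) u * form (c p) v = 0" using form_orthogonal[of j "- m - i" "b p" u] u by simp
    qed
  qed (use fin Q(1) in auto)
  finally show ?thesis by simp
qed

text \<open>On pure tensors the pairing splits into a factor from \<open>V\<close>, where \<open>inv\<close> says that
  \<open>\<Sum> (e\<^sub>\<alpha> \<otimes> f\<^sub>\<alpha> - f\<^sub>\<alpha> \<otimes> e\<^sub>\<alpha>)\<close> inverts \<open>\<omega>\<close>, and a factor from \<open>W\<close>, which is a sum over dual bases.\<close>

lemma
  fixes n :: nat and e f :: "nat \<Rightarrow> 'v" and b c :: "'p \<Rightarrow> 'w"
  assumes b: "homogeneous_basis W GB \<Pi> b" and c: "\<And>p. p \<in> \<Pi> \<Longrightarrow> c p \<in> carr W"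
    and dual: "\<And>p q. p \<in> \<Pi> \<Longrightarrow> q \<in> \<Pi> \<Longrightarrow> form (b p) (c q) = (if p = q then 1 else 0)"
    and fin: "\<And>i. \<exists>F. finite F \<and> module.span (smul W) F = GB i"
    and e: "\<And>\<alpha>. \<alpha> \<in> {1..n} \<Longrightarrow> e \<alpha> \<in> carr V" and f: "\<And>\<alpha>. \<alpha> \<in> {1..n} \<Longrightarrow> f \<alpha> \<in> carr V"
    and inv: "\<And>y z. y \<in> carr V \<Longrightarrow> z \<in> carr V \<Longrightarrow>
      (\<Sum>\<alpha>=1..n. \<omega> (e \<alpha>) y * \<omega> (f \<alpha>) z - \<omega> (f \<alpha>) y * \<omega> (e \<alpha>) z) = \<omega> z y"
  defines "r_terms \<equiv> \<lambda>p. \<Sum>\<alpha>=1..n. tensor2 L (tensor V W (e \<alpha>) (b p)) (tensor V W (f \<alpha>) (c p))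
               - tensor2 L (tensor V W (f \<alpha>) (b p)) (tensor V W (e \<alpha>) (c p))"
  shows locally_finite_canonical: "locally_finite (comp2 L G) \<Pi> r_terms"
    and represents_canonical: "graded_skew_form.represents L tensor_form G m
      (formal_sum (comp2 L G) \<Pi> r_terms) (\<lambda>y z. tensor_form z y)"
proof -
  interpret S: graded_skew_form L tensor_form G m by (rule graded_skew_form_tensor)
  let ?P = "\<lambda>i. {p \<in> \<Pi>. b p \<in> GB i}"
  have finP: "finite (?P i)" for i by (rule finite_basis_degree[OF b fin])
  have hom: "\<exists>i. b p \<in> GB i" if "p \<in> \<Pi>" for p using b that by (auto simp: homogeneous_basis_def)
  have bW: "b p \<in> carr W" if "p \<in> \<Pi>" for p using hom[OF that] GB_carr by blast
  have carr: "r_terms p \<in> carr (tensor_space L L)" if "p \<in> \<Pi>" for p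
    unfolding r_terms_def
    by (intro vspace_sum[OF tensor_vspace] vspace_diff[OF tensor_vspace] tensor_mem e f bW c that)
  have ev: "r_terms p (pair2 tensor_form y z) = (\<Sum>\<alpha>=1..n.
      tensor_form (tensor V W (e \<alpha>) (b p)) y * tensor_form (tensor V W (f \<alpha>) (c p)) z
      - tensor_form (tensor V W (f \<alpha>) (b p)) y * tensor_form (tensor V W (e \<alpha>) (c p)) z)"
    if "y \<in> carr L" "z \<in> carr L" for p y z
    using that by (simp add: r_terms_def sum_fun_apply S.tensor_pair2)
  have hc_tensor: "tensor_form (tensor V W a w) (S.hc (- m - i) y) = tensor_form (tensor V W a (hcB i w)) y"
    if "a \<in> carr V" "w \<in> carr W" "y \<in> carr L" for a w i y
    using S.form_hc[OF tensor_mem[OF that(1,2)] that(3), of i] that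
    by (simp add: hom_comp_L tensor_mem proj_tensor)
  have zero: "comp2 L G (i, j) (r_terms p) = 0" if p: "p \<in> \<Pi> - ?P i" for i j p
  proof (rule S.tensor2_zeroI)
    show "comp2 L G (i, j) (r_terms p) \<in> carr (tensor_space L L)"
      using p by (intro S.comp2_carr carr) simp
    fix y z assume yz: "y \<in> carr L" "z \<in> carr L"
    obtain k where k: "b p \<in> GB k" using hom p by blast
    then have "k \<noteq> i" using p by blast
    then have 0: "hcB i (b p) = 0" using hom_comp_homogeneous[OF W_graded k, of i] by (simp add: hcB_def)
    have "tensor_form (tensor V W a (b p)) (S.hc (- m - i) y) = 0" if "a \<in> carr V" for a
      using that p bW yz by (simp add: hc_tensor 0 tensor_zero_right S.form_zero_left)
    then show "comp2 L G (i, j) (r_terms p) (pair2 tensor_form y z) = 0"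
      using p yz e f by (simp add: S.comp2_apply carr ev)
  qed
  show "locally_finite (comp2 L G) \<Pi> r_terms"
    unfolding locally_finite_def
  proof
    fix d :: "int \<times> int"
    obtain i j where "d = (i, j)" by (cases d)
    then show "finite {p \<in> \<Pi>. comp2 L G d (r_terms p) \<noteq> 0}"
      using finite_formal_sum_terms[OF finP[of i], of \<Pi> "comp2 L G" d r_terms] zero by simp
  qed
  have rL: "formal_sum (comp2 L G) \<Pi> r_terms (i, j) = (\<Sum>p\<in>?P i. comp2 L G (i, j) (r_terms p))" for i j
    by (rule formal_sum_eq_sum) (use finP zero in auto)
  let ?S = "\<lambda>i j y z. \<Sum>p\<in>?P i. \<Sum>\<alpha>=1..n.
      tensor_form (tensor V W (e \<alpha>) (b p)) (S.hc (- m - i) y) * tensor_form (tensor V W (f \<alpha>) (c p)) (S.hc (- m - j) z)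
      - tensor_form (tensor V W (f \<alpha>) (b p)) (S.hc (- m - i) y) * tensor_form (tensor V W (e \<alpha>) (c p)) (S.hc (- m - j) z)"
  have pure: "?S i j (tensor V W a w) (tensor V W a' w') =
      tensor_form (S.hc (- m - j) (tensor V W a' w')) (S.hc (- m - i) (tensor V W a w))"
    if a: "a \<in> carr V" "w \<in> carr W" "a' \<in> carr V" "w' \<in> carr W" for i j a w a' w'
  proof -
    let ?u = "hcB (- m - i) w" and ?v = "hcB (- m - j) w'"
    have "?S i j (tensor V W a w) (tensor V W a' w') =
      (\<Sum>p\<in>?P i. \<Sum>\<alpha>=1..n. (\<omega> (e \<alpha>) a * \<omega> (f \<alpha>) a' - \<omega> (f \<alpha>) a * \<omega> (e \<alpha>) a') * (form (b p) ?u * form (c p) ?v))"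
      using a bW c e f
      by (intro sum.cong refl) (simp add: hom_comp_L tensor_mem proj_tensor tensor_form_tensor algebra_simps)
    also have "\<dots> = (\<Sum>p\<in>?P i. \<omega> a' a * (form (b p) ?u * form (c p) ?v))"
      by (simp only: sum_distrib_right[symmetric] inv[OF a(1,3)])
    also have "\<dots> = \<omega> a' a * form ?u ?v"
      using sum_dual_bases[OF b c dual finP[of i], of ?u ?v] a hom_comp_mem[OF W_graded a(2)]
      by (simp add: sum_distrib_left[symmetric] hcB_def[symmetric])
    finally show ?thesis
      using a form_sym[of ?u ?v] by (simp add: hom_comp_L tensor_mem proj_tensor tensor_form_tensor)
  qed
  have lin: "linear_map L ground (\<lambda>y. tensor_form t (S.hc i y))"
    and lin': "linear_map L ground (\<lambda>y. tensor_form (S.hc i y) t)" if "t \<in> carr L" for t i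
    using linear_map_comp[OF linear_map_hom_comp[OF L_graded]] S.linear_form_right[OF that] S.linear_form_left[OF that]
    by auto
  have linl: "linear_map L ground (\<lambda>y. ?S i j y z)" if "z \<in> carr L" for i j z
    by (intro linear_functional_sum linear_functional_combination lin tensor_mem e f bW c) auto
  have linr: "linear_map L ground (\<lambda>z. ?S i j y z)" if "y \<in> carr L" for i j y
    by (intro linear_functional_sum linear_functional_combination' lin tensor_mem e f bW c) auto
  have linl': "linear_map L ground (\<lambda>y. tensor_form (S.hc (- m - j) z) (S.hc (- m - i) y))"
    and linr': "linear_map L ground (\<lambda>y. tensor_form (S.hc (- m - j) y) (S.hc (- m - i) z))"
    if "z \<in> carr L" for i j z
    using that by (auto intro!: lin lin')
  have 1: "?S i j (tensor V W a w) z = tensor_form (S.hc (- m - j) z) (S.hc (- m - i) (tensor V W a w))"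
    if a: "a \<in> carr V" "w \<in> carr W" and z: "z \<in> carr L" for i j a w z
    by (rule linear_map_tensor_eqI[OF vspace W_vspace linr linr' pure z]) (simp_all add: a tensor_mem)
  have 2: "?S i j y z = tensor_form (S.hc (- m - j) z) (S.hc (- m - i) y)"
    if y: "y \<in> carr L" and z: "z \<in> carr L" for i j y z
    by (rule linear_map_tensor_eqI[OF vspace W_vspace linl[OF z] linl'[OF z] 1[OF _ _ z] y])
  show "S.represents (formal_sum (comp2 L G) \<Pi> r_terms) (\<lambda>y z. tensor_form z y)"
    unfolding S.represents_def ctensor2_def
  proof (intro conjI CollectI allI ballI)
    fix i j
    show "formal_sum (comp2 L G) \<Pi> r_terms (i, j) \<in> sub_tensor L L (G i) (G j)"
      unfolding rL
      using vspace_sum[OF sub_tensor_vspace, of "?P i" "\<lambda>p. comp2 L G (i, j) (r_terms p)" L L "G i" "G j"]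
        S.comp2_mem[OF carr] by simp
    fix y z assume yz: "y \<in> carr L" "z \<in> carr L"
    have "formal_sum (comp2 L G) \<Pi> r_terms (i, j) (pair2 tensor_form y z) = ?S i j y z"
      unfolding rL sum_fun_apply using yz by (intro sum.cong refl) (simp add: S.comp2_apply carr ev)
    also have "\<dots> = tensor_form (S.hc (- m - j) z) (S.hc (- m - i) y)" by (rule 2[OF yz])
    finally show "formal_sum (comp2 L G) \<Pi> r_terms (i, j) (pair2 tensor_form y z) =
      tensor_form (S.hc (- m - j) z) (S.hc (- m - i) y)" .
  qed
qed

lemma quasi_frobenius_tensor:
  assumes "graded_skew_form.represents L tensor_form G m s (\<lambda>y z. tensor_form z y)"
  shows "quasi_frobenius L tensor_form G m br s"
proof -
  interpret S: graded_skew_form L tensor_form G m by (rule graded_skew_form_tensor)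
  show ?thesis
    by unfold_locales (fact L_lie br_graded tensor_form_cocycle assms)+
qed

end

section \<open>The semidirect product of a pre-Novikov algebra with its dual\<close>

lemma mem_dual_space:
  fixes s :: "'k::field \<Rightarrow> 'v::ab_group_add \<Rightarrow> 'v"
  assumes "vector_space s"
  shows "f \<in> carr (dual_space s) \<longleftrightarrow> (\<forall>x y. f (x + y) = f x + f y) \<and> (\<forall>c x. f (s c x) = c * f x)"
proof -
  have "vector_space ((*) :: 'k \<Rightarrow> 'k \<Rightarrow> 'k)"
    using is_vspace_ground[where 'k = 'k] by (simp add: is_vspace_def)
  then show ?thesis
    using assms by (simp add: dual_space_def Vector_Spaces.linear_iff)
qed

lemma is_vspace_dual_space:
  fixes s :: "'k::field \<Rightarrow> 'v::ab_group_add \<Rightarrow> 'v"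
  assumes "vector_space s"
  shows "is_vspace (dual_space s)"
proof -
  interpret F: vector_space "fun_scale :: 'k \<Rightarrow> ('v \<Rightarrow> 'k) \<Rightarrow> _" by (rule vector_space_fun_scale)
  have "smul (dual_space s) = fun_scale" by (simp add: dual_space_def)
  moreover have "F.subspace (carr (dual_space s))"
    unfolding F.subspace_def
    by (auto simp: mem_dual_space[OF assms] fun_scale_def algebra_simps)
  ultimately show ?thesis by (simp add: is_vspace_def F.vector_space_axioms)
qed

lemma is_vspace_direct_sum:
  fixes V :: "('k::field, 'v::ab_group_add) vspace" and W :: "('k, 'w::ab_group_add) vspace"
  assumes V: "is_vspace V" and W: "is_vspace W"
  shows "is_vspace (direct_sum V W)"
proof -
  interpret V: vector_space "smul V" using V by (rule vspace_vector_space)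
  interpret W: vector_space "smul W" using W by (rule vspace_vector_space)
  have vs: "vector_space (smul (direct_sum V W))"
    by unfold_locales
      (auto simp: direct_sum_def prod_eq_iff V.scale_right_distrib W.scale_right_distrib
        V.scale_left_distrib W.scale_left_distrib)
  interpret D: vector_space "smul (direct_sum V W)" by (rule vs)
  have "D.subspace (carr (direct_sum V W))"
    unfolding D.subspace_def
    by (auto simp: direct_sum_def zero_prod_def vspace_zero V W vspace_add vspace_scale)
  with vs show ?thesis by (simp add: is_vspace_def)
qed

text \<open>The natural symplectic form on \<open>A \<oplus> A\<^sup>*\<close>.\<close>

definition tilde_form :: "'v \<times> ('v \<Rightarrow> 'k) \<Rightarrow> 'v \<times> ('v \<Rightarrow> 'k) \<Rightarrow> 'k::field" where
  "tilde_form x y = snd x (fst y) - snd y (fst x)"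

locale pre_novikov_with_basis =
  fixes sA :: "'k::field \<Rightarrow> 'a::ab_group_add \<Rightarrow> 'a" and lhd rhd :: "'a \<Rightarrow> 'a \<Rightarrow> 'a"
    and n :: nat and e :: "nat \<Rightarrow> 'a" and e_star :: "nat \<Rightarrow> 'a \<Rightarrow> 'k"
  assumes pre_novikov: "pre_novikov (whole sA) lhd rhd"
    and basis: "is_basis (whole sA) {1..n} e"
    and e_star: "\<alpha> \<in> {1..n} \<Longrightarrow> e_star \<alpha> \<in> carr (dual_space sA)"
    and dual_basis: "\<alpha> \<in> {1..n} \<Longrightarrow> \<beta> \<in> {1..n} \<Longrightarrow> e_star \<alpha> (e \<beta>) = (if \<alpha> = \<beta> then 1 else 0)"
begin

lemma A_vector_space: "vector_space sA"
  using pre_novikov by (simp add: pre_novikov_def is_vspace_def)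

sublocale A: vector_space sA
  by (rule A_vector_space)

lemma dual_add: "f \<in> carr (dual_space sA) \<Longrightarrow> f (x + y) = f x + f y"
  and dual_scale: "f \<in> carr (dual_space sA) \<Longrightarrow> f (sA c x) = c * f x"
  by (auto simp: mem_dual_space[OF A_vector_space])

lemma dual_linear_map: "f \<in> carr (dual_space sA) \<Longrightarrow> linear_map (whole sA) ground f"
  by (simp add: linear_map_def dual_add dual_scale)

lemma dual_diff: "f \<in> carr (dual_space sA) \<Longrightarrow> f (x - y) = f x - f y"
  and dual_zero: "f \<in> carr (dual_space sA) \<Longrightarrow> f 0 = 0"
  using linear_map_diff[OF is_vspace_whole[OF A_vector_space] dual_linear_map, of f x y]
    linear_map_zero[OF is_vspace_whole[OF A_vector_space] dual_linear_map, of f] by simp_all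

lemma A_bilinear:
  "lhd (x + x') y = lhd x y + lhd x' y" "lhd x (y + y') = lhd x y + lhd x y'"
  "lhd (sA k x) y = sA k (lhd x y)" "lhd x (sA k y) = sA k (lhd x y)"
  "rhd (x + x') y = rhd x y + rhd x' y" "rhd x (y + y') = rhd x y + rhd x y'"
  "rhd (sA k x) y = sA k (rhd x y)" "rhd x (sA k y) = sA k (rhd x y)"
  using pre_novikov by (simp_all add: pre_novikov_def bilinear_map_def linear_map_def)

text \<open>The axioms with all sums expanded, in the form in which they serve as rewrite rules.\<close>

lemma pre_novikov_rhd_rhd: "rhd x (rhd y z) = rhd (rhd x y) z + rhd (lhd x y) z + rhd y (rhd x z) - rhd (rhd y x) z - rhd (lhd y x) z"
  and pre_novikov_rhd_lhd: "rhd x (lhd y z) = lhd (rhd x y) z + lhd y (lhd x z) + lhd y (rhd x z) - lhd (lhd y x) z"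
  and pre_novikov_prod_rhd: "rhd (rhd x y) z = lhd (rhd x z) y - rhd (lhd x y) z"
  and pre_novikov_lhd_lhd: "lhd (lhd x y) z = lhd (lhd x z) y"
proof -
  have 1: "rhd x (rhd y z) = rhd (rhd x y + lhd x y) z + rhd y (rhd x z) - rhd (rhd y x + lhd y x) z"
    and 2: "rhd x (lhd y z) = lhd (rhd x y) z + lhd y (lhd x z + rhd x z) - lhd (lhd y x) z"
    and 3: "rhd (lhd x y + rhd x y) z = lhd (rhd x z) y" and 4: "lhd (lhd x y) z = lhd (lhd x z) y"
    using pre_novikov unfolding pre_novikov_def whole_sel by blast+
  show "rhd x (rhd y z) = rhd (rhd x y) z + rhd (lhd x y) z + rhd y (rhd x z) - rhd (rhd y x) z - rhd (lhd y x) z"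
    unfolding 1 by (simp add: A_bilinear algebra_simps)
  show "rhd x (lhd y z) = lhd (rhd x y) z + lhd y (lhd x z) + lhd y (rhd x z) - lhd (lhd y x) z"
    unfolding 2 by (simp add: A_bilinear algebra_simps)
  show "rhd (rhd x y) z = lhd (rhd x z) y - rhd (lhd x y) z"
    unfolding 3[symmetric] by (simp add: A_bilinear)
  show "lhd (lhd x y) z = lhd (lhd x z) y" by (rule 4)
qed

lemma basis_expansion: "x = (\<Sum>\<alpha>=1..n. sA (e_star \<alpha> x) (e \<alpha>))"
proof -
  have inj: "inj_on e {1..n}" and span: "A.span (e ` {1..n}) = UNIV"
    using basis by (auto simp: is_basis_def)
  have "x \<in> A.span (e ` {1..n})" using span by simp
  then obtain u where "x = (\<Sum>v\<in>e ` {1..n}. sA (u v) v)"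
    by (auto simp: A.span_finite)
  then have x: "x = (\<Sum>\<alpha>=1..n. sA (u (e \<alpha>)) (e \<alpha>))"
    using inj by (simp add: sum.reindex)
  have "e_star \<beta> x = u (e \<beta>)" if \<beta>: "\<beta> \<in> {1..n}" for \<beta>
  proof -
    have "e_star \<beta> x = e_star \<beta> (\<Sum>\<alpha>=1..n. sA (u (e \<alpha>)) (e \<alpha>))"
      by (rule arg_cong[OF x])
    also have "\<dots> = (\<Sum>\<alpha>=1..n. e_star \<beta> (sA (u (e \<alpha>)) (e \<alpha>)))"
      by (rule linear_map_sum[OF is_vspace_whole[OF A_vector_space] dual_linear_map[OF e_star[OF \<beta>]]]) simp
    also have "\<dots> = (\<Sum>\<alpha>=1..n. if \<beta> = \<alpha> then u (e \<alpha>) else 0)"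
      using \<beta> by (intro sum.cong refl) (simp add: dual_scale[OF e_star[OF \<beta>]] dual_basis)
    finally show ?thesis using \<beta> by simp
  qed
  then have "(\<Sum>\<alpha>=1..n. sA (e_star \<alpha> x) (e \<alpha>)) = (\<Sum>\<alpha>=1..n. sA (u (e \<alpha>)) (e \<alpha>))"
    by (intro sum.cong refl) simp
  also have "\<dots> = x" by (rule x[symmetric])
  finally show ?thesis by (rule sym)
qed

lemma dual_expansion:
  assumes f: "f \<in> carr (dual_space sA)"
  shows "(\<Sum>\<alpha>=1..n. f (e \<alpha>) * e_star \<alpha> x) = f x"
proof -
  have "f x = f (\<Sum>\<alpha>=1..n. sA (e_star \<alpha> x) (e \<alpha>))"
    by (rule arg_cong[OF basis_expansion])
  also have "\<dots> = (\<Sum>\<alpha>=1..n. f (sA (e_star \<alpha> x) (e \<alpha>)))"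
    by (rule linear_map_sum[OF is_vspace_whole[OF A_vector_space] dual_linear_map[OF f]]) simp
  finally show ?thesis by (simp add: dual_scale[OF f] mult.commute)
qed

abbreviation "At \<equiv> tilde_space sA"
abbreviation "circ \<equiv> tilde_prod lhd rhd"

lemma At_vspace: "is_vspace At"
  unfolding tilde_space_def
  by (rule is_vspace_direct_sum[OF is_vspace_whole[OF A_vector_space] is_vspace_dual_space[OF A_vector_space]])

lemma mem_At: "x \<in> carr At \<longleftrightarrow> snd x \<in> carr (dual_space sA)"
  by (cases x) (simp add: tilde_space_def direct_sum_def)

lemma smul_At: "smul At k x = (sA k (fst x), fun_scale k (snd x))"
  by (simp add: tilde_space_def direct_sum_def dual_space_def)

lemma fst_circ: "fst (circ x y) = lhd (fst x) (fst y) + rhd (fst x) (fst y)"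
  and snd_circ: "snd (circ x y) z =
    - snd y (rhd (fst x) z) - snd y (lhd z (fst x)) + snd x (lhd z (fst y))"
  by (simp_all add: tilde_prod_def split_beta assoc_prod_def dual_act_def Let_def)

lemma circ_mem:
  assumes "x \<in> carr At" "y \<in> carr At"
  shows "circ x y \<in> carr At"
  using assms unfolding mem_At mem_dual_space[OF A_vector_space] snd_circ
  by (simp add: A_bilinear algebra_simps)

lemma bilinear_circ: "bilinear_map At At At circ"
  by (rule bilinear_mapI)
    (simp_all add: circ_mem, simp_all add: prod_eq_iff fst_circ fun_eq_iff snd_circ smul_At A_bilinear
      mem_At dual_add dual_scale fun_scale_def A.scale_right_distrib algebra_simps)

text \<open>Evaluating the dual component at \<open>t\<close> and collecting the terms of each functional turns
  the identities into instances of the pre-Novikov axioms in which \<open>t\<close> is one of the variables.\<close>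

lemma novikov_tilde: "novikov At circ"
  unfolding novikov_def
proof (intro conjI ballI)
  show "is_vspace At" by (rule At_vspace)
  show "bilinear_map At At At circ" by (rule bilinear_circ)
  fix x y z assume "x \<in> carr At" "y \<in> carr At" "z \<in> carr At"
  then have d: "snd x \<in> carr (dual_space sA)" "snd y \<in> carr (dual_space sA)" "snd z \<in> carr (dual_space sA)"
    by (simp_all add: mem_At)
  note lin = dual_add[OF d(1)] dual_add[OF d(2)] dual_add[OF d(3)]
    dual_diff[OF d(1)] dual_diff[OF d(2)] dual_diff[OF d(3)]
  obtain a f b g c h where xyz: "x = (a, f)" "y = (b, g)" "z = (c, h)"
    by (cases x, cases y, cases z) blast
  show "circ (circ x y) z - circ x (circ y z) = circ (circ y x) z - circ y (circ x z)"
    unfolding xyz prod_eq_iff fun_eq_iff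
  proof (intro conjI allI)
    show "fst (circ (circ (a, f) (b, g)) (c, h) - circ (a, f) (circ (b, g) (c, h))) =
      fst (circ (circ (b, g) (a, f)) (c, h) - circ (b, g) (circ (a, f) (c, h)))"
      by (simp add: fst_circ A_bilinear pre_novikov_rhd_lhd[of a b c] pre_novikov_rhd_lhd[of b a c]
          pre_novikov_rhd_rhd[of a b c] algebra_simps)
    show "snd (circ (circ (a, f) (b, g)) (c, h) - circ (a, f) (circ (b, g) (c, h))) t =
      snd (circ (circ (b, g) (a, f)) (c, h) - circ (b, g) (circ (a, f) (c, h))) t" for t
      using lin unfolding xyz
      by (simp add: fst_circ snd_circ A_bilinear pre_novikov_rhd_lhd[of b t a] pre_novikov_rhd_lhd[of a t b]
          pre_novikov_rhd_lhd[of b t c] pre_novikov_rhd_lhd[of a t c] pre_novikov_rhd_rhd[of a b t]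
          pre_novikov_lhd_lhd)
  qed
  show "circ (circ x y) z = circ (circ x z) y"
    unfolding xyz prod_eq_iff fun_eq_iff
  proof (intro conjI allI)
    show "fst (circ (circ (a, f) (b, g)) (c, h)) = fst (circ (circ (a, f) (c, h)) (b, g))"
      by (simp add: fst_circ A_bilinear pre_novikov_prod_rhd[of a b c] pre_novikov_prod_rhd[of a c b]
          pre_novikov_lhd_lhd algebra_simps)
    show "snd (circ (circ (a, f) (b, g)) (c, h)) t = snd (circ (circ (a, f) (c, h)) (b, g)) t" for t
      using lin unfolding xyz
      by (simp add: fst_circ snd_circ A_bilinear pre_novikov_rhd_lhd[of a t b] pre_novikov_rhd_lhd[of a t c]
          pre_novikov_prod_rhd[of a b t] pre_novikov_prod_rhd[of a c t] pre_novikov_lhd_lhd)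
  qed
qed

lemma bilinear_tilde_form: "bilinear_map At At ground tilde_form"
  by (rule bilinear_mapI)
    (auto simp: tilde_form_def mem_At smul_At dual_add dual_scale fun_scale_def algebra_simps)

lemma quasi_frobenius_novikov_tilde: "quasi_frobenius_novikov At tilde_form circ"
proof
  show "is_vspace At" by (rule At_vspace)
  show "bilinear_map At At ground tilde_form" by (rule bilinear_tilde_form)
  show "tilde_form x y = - tilde_form y x" for x y :: "'a \<times> ('a \<Rightarrow> 'k)"
    by (simp add: tilde_form_def)
  show "x = 0" if x: "x \<in> carr At" and 0: "\<And>y. y \<in> carr At \<Longrightarrow> tilde_form x y = 0" for x
  proof -
    have zero: "0 \<in> carr (dual_space sA)" by (simp add: mem_dual_space[OF A_vector_space])
    have "snd x b = 0" for b
      using 0[of "(b, 0)"] zero by (simp add: mem_At tilde_form_def)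
    moreover have "e_star \<alpha> (fst x) = 0" if "\<alpha> \<in> {1..n}" for \<alpha>
      using 0[of "(0, e_star \<alpha>)"] e_star[OF that] x by (simp add: mem_At tilde_form_def dual_zero)
    then have "(\<Sum>\<alpha>=1..n. sA (e_star \<alpha> (fst x)) (e \<alpha>)) = 0" by (intro sum.neutral) simp
    then have "fst x = 0" by (rule trans[OF basis_expansion])
    ultimately show "x = 0" by (simp add: prod_eq_iff fun_eq_iff)
  qed
  show "novikov At circ" by (rule novikov_tilde)
  show "tilde_form (circ x y) z + tilde_form (circ z y) x = tilde_form (circ x z + circ z x) y"
    if "x \<in> carr At" "y \<in> carr At" "z \<in> carr At" for x y z
    using that by (simp add: mem_At tilde_form_def fst_circ snd_circ dual_add algebra_simps)
qed

lemma e_mem: "(e \<alpha>, 0) \<in> carr At" and e_star_mem: "\<alpha> \<in> {1..n} \<Longrightarrow> (0, e_star \<alpha>) \<in> carr At"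
  using e_star by (auto simp: mem_At mem_dual_space[OF A_vector_space])

lemma tilde_form_inverse:
  assumes "y \<in> carr At" "z \<in> carr At"
  shows "(\<Sum>\<alpha>=1..n. tilde_form (e \<alpha>, 0) y * tilde_form (0, e_star \<alpha>) z
    - tilde_form (0, e_star \<alpha>) y * tilde_form (e \<alpha>, 0) z) = tilde_form z y"
proof -
  have d: "snd y \<in> carr (dual_space sA)" "snd z \<in> carr (dual_space sA)" using assms by (simp_all add: mem_At)
  have "(\<Sum>\<alpha>=1..n. tilde_form (e \<alpha>, 0) y * tilde_form (0, e_star \<alpha>) z
      - tilde_form (0, e_star \<alpha>) y * tilde_form (e \<alpha>, 0) z) =
      (\<Sum>\<alpha>=1..n. snd z (e \<alpha>) * e_star \<alpha> (fst y) - snd y (e \<alpha>) * e_star \<alpha> (fst z))"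
    using d by (intro sum.cong refl) (simp add: tilde_form_def dual_zero)
  also have "\<dots> = snd z (fst y) - snd y (fst z)"
    by (simp only: sum_subtractf dual_expansion[OF d(1)] dual_expansion[OF d(2)])
  finally show ?thesis by (simp add: tilde_form_def)
qed

end

section \<open>The completed Lie bialgebra of a pre-Novikov algebra\<close>

theorem theorem4p6:
  fixes sA :: "'k::field_char_0 \<Rightarrow> 'a::ab_group_add \<Rightarrow> 'a"
    and lhd rhd :: "'a \<Rightarrow> 'a \<Rightarrow> 'a"
    and n :: nat and e :: "nat \<Rightarrow> 'a" and e_star :: "nat \<Rightarrow> 'a \<Rightarrow> 'k"
    and sB :: "'k \<Rightarrow> 'b::ab_group_add \<Rightarrow> 'b"
    and GB :: "int \<Rightarrow> 'b set" and dia :: "'b \<Rightarrow> 'b \<Rightarrow> 'b" and form :: "'b \<Rightarrow> 'b \<Rightarrow> 'k"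
    and \<Pi> :: "'p set" and b c :: "'p \<Rightarrow> 'b"
  assumes "pre_novikov (whole sA) lhd rhd"
    and "is_basis (whole sA) {1..n} e"
    and "\<forall>\<alpha>\<in>{1..n}. e_star \<alpha> \<in> carr (dual_space sA)"
    and "\<forall>\<alpha>\<in>{1..n}. \<forall>\<beta>\<in>{1..n}. e_star \<alpha> (e \<beta>) = (if \<alpha> = \<beta> then 1 else 0)"
    and "quadratic_graded_right_novikov (whole sB) GB dia form"
    and "homogeneous_basis (whole sB) GB \<Pi> b"
    and "homogeneous_basis (whole sB) GB \<Pi> c"
    and "\<forall>p\<in>\<Pi>. \<forall>q\<in>\<Pi>. form (b p) (c q) = (if p = q then 1 else 0)"
  shows "let At = tilde_space sA;
             circ = tilde_prod lhd rhd;
             r = (\<Sum>\<alpha>=1..n. tensor2 At (e \<alpha>, 0) (0, e_star \<alpha>) - tensor2 At (0, e_star \<alpha>) (e \<alpha>, 0));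
             B = whole sB;
             L = tensor_space At B;
             G = induced_grading At B GB;
             br = induced_bracket At B circ dia;
             r_terms = (\<lambda>p. \<Sum>\<alpha>=1..n.
                 tensor2 L (tensor At B (e \<alpha>, 0) (b p)) (tensor At B (0, e_star \<alpha>) (c p))
               - tensor2 L (tensor At B (0, e_star \<alpha>) (b p)) (tensor At B (e \<alpha>, 0) (c p)));
             r_L = formal_sum (comp2 L G) \<Pi> r_terms
         in novikov At circ \<and>
            skew_nybe_solution At circ r \<and>
            locally_finite (comp2 L G) \<Pi> r_terms \<and>
            skew_completed_cybe_solution L G br r_L \<and>
            (\<exists>\<delta>. completed_lie_bialgebra L G br \<delta> \<and>
                 (\<forall>x\<in>carr L. ad_hat_defined L G br x r_L \<and> \<delta> x = ad_hat L G br x r_L))"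
proof -
  let ?At = "tilde_space sA" and ?circ = "tilde_prod lhd rhd :: 'a \<times> ('a \<Rightarrow> 'k) \<Rightarrow> _" and ?B = "whole sB"
  let ?L = "tensor_space ?At ?B" and ?G = "induced_grading ?At ?B GB"
  let ?br = "induced_bracket ?At ?B ?circ dia"
  let ?r = "\<Sum>\<alpha>=1..n. tensor2 ?At (e \<alpha>, 0) (0, e_star \<alpha>) - tensor2 ?At (0, e_star \<alpha>) (e \<alpha>, 0)"
  let ?r_terms = "\<lambda>p. \<Sum>\<alpha>=1..n.
       tensor2 ?L (tensor ?At ?B (e \<alpha>, 0) (b p)) (tensor ?At ?B (0, e_star \<alpha>) (c p))
     - tensor2 ?L (tensor ?At ?B (0, e_star \<alpha>) (b p)) (tensor ?At ?B (e \<alpha>, 0) (c p))"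
  let ?r_L = "formal_sum (comp2 ?L ?G) \<Pi> ?r_terms"
  interpret P: pre_novikov_with_basis sA lhd rhd n e e_star
    by unfold_locales (use assms(1-4) in auto)
  interpret N: quasi_frobenius_novikov ?At tilde_form ?circ
    by (rule P.quasi_frobenius_novikov_tilde)
  note q = assms(5)[unfolded quadratic_graded_right_novikov_def]
  have q1: "right_novikov ?B dia" and q2: "graded ?B GB"
    and q3: "\<forall>i. \<exists>F. finite F \<and> module.span (smul ?B) F = GB i"
    and q4: "\<forall>i j. \<forall>a\<in>GB i. \<forall>b\<in>GB j. dia a b \<in> GB (i + j)"
    and q5: "bilinear_map ?B ?B ground form"
    and q6: "\<forall>a\<in>carr ?B. \<forall>b\<in>carr ?B. form a b = form b a"
    and q7: "\<forall>a\<in>carr ?B. (\<forall>b\<in>carr ?B. form a b = 0) \<longrightarrow> a = 0"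
    and q8: "\<exists>d. \<forall>i j. i + j + d \<noteq> 0 \<longrightarrow> (\<forall>a\<in>GB i. \<forall>b\<in>GB j. form a b = 0)"
    and q9: "\<forall>a\<in>carr ?B. \<forall>b\<in>carr ?B. \<forall>c\<in>carr ?B. form (dia a b) c = - form a (dia b c + dia c b)"
    by (insert q, (elim conjE, assumption)+)
  from q8 obtain m where m: "\<forall>i j. i + j + m \<noteq> 0 \<longrightarrow> (\<forall>a\<in>GB i. \<forall>b\<in>GB j. form a b = 0)" ..
  interpret T: novikov_tensor_product ?At tilde_form ?circ ?B GB dia form m
  proof
    show "right_novikov ?B dia" "graded ?B GB" "bilinear_map ?B ?B ground form" by (fact q1 q2 q5)+
    show "dia a b \<in> GB (i + j)" if "a \<in> GB i" "b \<in> GB j" for a b i j using q4 that by blast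
    show "form a b = form b a" if "a \<in> carr ?B" "b \<in> carr ?B" for a b by (rule q6[rule_format, OF that])
    show "a = 0" if "a \<in> carr ?B" "\<And>b. b \<in> carr ?B \<Longrightarrow> form a b = 0" for a using q7 that by blast
    show "form a b = 0" if "i + j + m \<noteq> 0" "a \<in> GB i" "b \<in> GB j" for i j a b using m that by blast
    show "form (dia a b) c = - form a (dia b c + dia c b)"
      if "a \<in> carr ?B" "b \<in> carr ?B" "c \<in> carr ?B" for a b c by (rule q9[rule_format, OF that])
  qed
  have r_carr: "?r \<in> carr (tensor_space ?At ?At)"
    by (intro vspace_sum[OF tensor_vspace] vspace_diff[OF tensor_vspace] tensor_mem
        P.e_mem P.e_star_mem)
  have nybe: "skew_nybe_solution ?At ?circ ?r"
  proof (rule N.skew_nybe_solutionI[OF r_carr])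
    fix y z assume yz: "y \<in> carr ?At" "z \<in> carr ?At"
    show "?r (pair2 tilde_form y z) = tilde_form z y"
      unfolding P.tilde_form_inverse[OF yz, symmetric] sum_fun_apply by (simp add: N.tensor_pair2 yz)
  qed
  have dual: "form (b p) (c q) = (if p = q then 1 else 0)" if "p \<in> \<Pi>" "q \<in> \<Pi>" for p q
    using assms(8) that by blast
  have fin: "\<exists>F. finite F \<and> module.span (smul ?B) F = GB i" for i
    using q3 by blast
  have c: "c p \<in> carr ?B" for p by simp
  have lf: "locally_finite (comp2 ?L ?G) \<Pi> ?r_terms"
    by (rule T.locally_finite_canonical[OF assms(6) c dual fin P.e_mem P.e_star_mem P.tilde_form_inverse])
  have rep: "graded_skew_form.represents ?L T.tensor_form ?G m ?r_L (\<lambda>y z. T.tensor_form z y)"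
    by (rule T.represents_canonical[OF assms(6) c dual fin P.e_mem P.e_star_mem P.tilde_form_inverse])
  interpret Q: quasi_frobenius ?L T.tensor_form ?G m ?br ?r_L
    by (rule T.quasi_frobenius_tensor[OF rep])
  have "\<exists>\<delta>. completed_lie_bialgebra ?L ?G ?br \<delta> \<and>
      (\<forall>x\<in>carr ?L. ad_hat_defined ?L ?G ?br x ?r_L \<and> \<delta> x = ad_hat ?L ?G ?br x ?r_L)"
    using Q.completed_lie_bialgebra_cobracket Q.cobracket_defined Q.cobracket_def by blast
  with P.novikov_tilde nybe lf Q.skew_completed_cybe_solution_canonical
  show ?thesis unfolding Let_def by blast
qed

end
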